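(* Let $q_1,q_2,\dots$ be a sequence of positive numbers such that $$\lim_{n\to\infty}\frac{\sum_{i=1}^n q_i^4}{\left(\sum_{i=1}^n q_i^2\right)^2}=0.$$ For each $n$ let $E_n$ be the ellipsoid in $\mathbb{R}^n$ with major semi-axes $a_1=1/q_1,\dots,a_n=1/q_n$, and let $\mathcal{R}(E_n)=V_{n-1}(\partial E_n)/V_n(E_n)$. Then $$\lim_{n\to\infty}\frac{\Gamma\left(\frac{n+1}2\right)}{\Gamma\left(\frac n2\right)}\cdot\frac{\mathcal{R}(E_n)}{n\sqrt{\frac12\sum_{i=1}^n q_i^2}}=1.$$
   Context: $E_n=\{x\in\mathbb{R}^n : \sum_{i=1}^n q_i^2x_i^2\le1\}$. $V_n(E_n)$ is the $n$-dimensional volume of $E_n$ and $V_{n-1}(\partial E_n)$ is the surface area of its boundary. *)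

theory Defs
  imports "HOL-Analysis.Analysis"
begin

text \<open>The dimension varies inside the statement, so \<open>\<real>\<^sup>n\<close> is the set of extensional functions on
  \<open>{1..n}\<close>. This is also the space of the product measure and of the product topology used below.\<close>

definition Rn :: "nat \<Rightarrow> (nat \<Rightarrow> real) set" where
  "Rn n = (\<Pi>\<^sub>E i\<in>{1..n}. UNIV)"

definition Rn_dist :: "nat \<Rightarrow> (nat \<Rightarrow> real) \<Rightarrow> (nat \<Rightarrow> real) \<Rightarrow> real" where
  "Rn_dist n x y = sqrt (\<Sum>i=1..n. (x i - y i)\<^sup>2)"

definition Rn_lebesgue :: "nat \<Rightarrow> (nat \<Rightarrow> real) measure" where
  "Rn_lebesgue n = (\<Pi>\<^sub>M i\<in>{1..n}. lborel)"

definition Rn_topology :: "nat \<Rightarrow> (nat \<Rightarrow> real) topology" where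
  "Rn_topology n = product_topology (\<lambda>i. euclideanreal) {1..n}"

definition Rn_diam :: "nat \<Rightarrow> (nat \<Rightarrow> real) set \<Rightarrow> ennreal" where
  "Rn_diam n U = (SUP x\<in>U. SUP y\<in>U. ennreal (Rn_dist n x y))"

text \<open>The \<open>m\<close>-dimensional Hausdorff measure of a subset \<open>A\<close> of \<open>\<real>\<^sup>n\<close>, before normalization. Empty
  covering sets contribute 0 also for \<open>m = 0\<close>, where it is the counting measure.\<close>

definition hausdorff_delta :: "nat \<Rightarrow> nat \<Rightarrow> real \<Rightarrow> (nat \<Rightarrow> real) set \<Rightarrow> ennreal" where
  "hausdorff_delta n m \<delta> A =
     (INF C \<in> {C :: nat \<Rightarrow> (nat \<Rightarrow> real) set.
                 A \<subseteq> (\<Union>k. C k) \<and> (\<forall>k. C k \<subseteq> Rn n \<and> Rn_diam n (C k) \<le> ennreal \<delta>)}.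
        \<Sum>k. if C k = {} then 0 else Rn_diam n (C k) ^ m)"

definition hausdorff :: "nat \<Rightarrow> nat \<Rightarrow> (nat \<Rightarrow> real) set \<Rightarrow> ennreal" where
  "hausdorff n m A = (SUP \<delta>\<in>{0<..}. hausdorff_delta n m \<delta> A)"

definition unit_cube :: "nat \<Rightarrow> (nat \<Rightarrow> real) set" where
  "unit_cube m = (\<Pi>\<^sub>E i\<in>{1..m}. {0..1})"

text \<open>The \<open>m\<close>-dimensional volume of a subset of \<open>\<real>\<^sup>n\<close>: Hausdorff measure, normalized such that the
  unit cube of \<open>\<real>\<^sup>m\<close> has volume 1, so that it is Lebesgue measure on \<open>\<real>\<^sup>m\<close>. The
  unnormalized measure of the cube is positive and finite, so the quotient is a genuine one.\<close>

definition hausdorff_vol :: "nat \<Rightarrow> nat \<Rightarrow> (nat \<Rightarrow> real) set \<Rightarrow> real" where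
  "hausdorff_vol n m A = enn2real (hausdorff n m A / hausdorff m m (unit_cube m))"

definition volume :: "nat \<Rightarrow> (nat \<Rightarrow> real) set \<Rightarrow> real" where
  "volume n A = measure (Rn_lebesgue n) A"

definition surface_area :: "nat \<Rightarrow> (nat \<Rightarrow> real) set \<Rightarrow> real" where
  "surface_area n A = hausdorff_vol n (n - 1) (Rn_topology n frontier_of A)"

definition ellipsoid :: "(nat \<Rightarrow> real) \<Rightarrow> nat \<Rightarrow> (nat \<Rightarrow> real) set" where
  "ellipsoid q n = {x \<in> Rn n. (\<Sum>i=1..n. (q i)\<^sup>2 * (x i)\<^sup>2) \<le> 1}"

definition surface_volume_ratio :: "nat \<Rightarrow> (nat \<Rightarrow> real) set \<Rightarrow> real" where
  "surface_volume_ratio n A = surface_area n A / volume n A"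

end

theory Submission
  imports Defs "HOL-Probability.Distributions"
begin

text \<open>
  Write \<open>g(x)\<^sup>2 = \<Sum> q\<^sub>i\<^sup>2 x\<^sub>i\<^sup>2\<close>, so that \<open>E\<^sub>n\<close> is the unit ball of \<open>g\<close>, and \<open>w(x)\<^sup>2 = \<Sum> q\<^sub>i\<^sup>4 x\<^sub>i\<^sup>2\<close>. At a
  boundary point \<open>x\<close> the vector with entries \<open>q\<^sub>i\<^sup>2 x\<^sub>i\<close> is normal to the ellipsoid and \<open>1 / w(x)\<close> is the
  distance from the origin to the tangent hyperplane. A cone with apex \<open>0\<close> over a small boundary piece
  of area \<open>dS\<close> therefore has volume \<open>dS / (n w)\<close>. Summing \<open>dS = n w dV\<close> over all pieces expresses the
  surface area as a volume integral, and since \<open>w\<close> and \<open>g\<close> are homogeneous of degree 1, integrating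
  radially turns that into
  \<open>S = (\<integral> w exp(-g\<^sup>2)) / (\<Gamma>((n+1)/2)/2)\<close>, and in the same way
  \<open>V = (\<integral> exp(-g\<^sup>2)) / (n \<Gamma>(n/2)/2)\<close>. Hence the Gamma quotient in the theorem cancels exactly, and for
  \<open>n \<ge> 2\<close> the \<open>n\<close>-th term equals the expectation of \<open>sqrt Y\<close> divided by \<open>sqrt a\<close>, where
  \<open>Y = w\<^sup>2\<close> is evaluated at a Gaussian vector with density
  proportional to \<open>exp(-g\<^sup>2)\<close> and \<open>a = \<Sum> q\<^sub>i\<^sup>2 / 2\<close>
  (\<open>surface_volume_ratio_ellipsoid\<close>). Now \<open>Y\<close> has mean \<open>a\<close> and variance \<open>\<Sum> q\<^sub>i\<^sup>4 / 2\<close>, so the elementary bounds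
  \<open>(3 r - r\<^sup>2) / 2 \<le> sqrt r \<le> (1 + r) / 2\<close> at \<open>r = Y / a\<close> squeeze the \<open>n\<close>-th term between
  \<open>1 - \<Sum> q\<^sub>i\<^sup>4 / (\<Sum> q\<^sub>i\<^sup>2)\<^sup>2\<close> and \<open>1\<close> (\<open>gauss_normal_length_bounds\<close>).

  The work lies in the surface area, which is a Hausdorff measure. Three facts about Hausdorff measures
  suffice: a Lipschitz map with constant \<open>L\<close> multiplies \<open>m\<close>-dimensional measure by at most \<open>L\<^sup>m\<close>; the
  measure is countably additive on Borel sets; and on \<open>\<real>\<^sup>m\<close> it is a constant multiple of Lebesgue measure
  (\<open>hausdorff_eq_lebesgue\<close>), the constant being the one that the normalization of the volume divides out.
  The last fact also makes Lebesgue measure invariant under isometries, so a Householder reflection moves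
  any tangent hyperplane to a coordinate hyperplane, where Fubini gives the volume of a cone over a flat
  base exactly (\<open>hausdorff_cone_section\<close>). Central projection of a boundary piece of diameter \<open>d\<close> onto a
  tangent hyperplane is bi-Lipschitz with constants \<open>1 + O(d)\<close> and changes the cone by a factor
  \<open>1 + O(d)\<close>, so the identity \<open>dS = n w dV\<close> holds on the piece up to such a factor
  (\<open>hausdorff_boundary_piece\<close>); cutting the boundary by ever finer dyadic cubes makes it exact
  (\<open>hausdorff_boundary\<close>).
\<close>

section \<open>Hausdorff measure as a metric outer measure\<close>

lemma space_Rn_lebesgue [simp]: "space (Rn_lebesgue n) = Rn n"
  by (simp add: Rn_lebesgue_def Rn_def space_PiM)

lemma Rn_dist_L2_set: "Rn_dist n x y = L2_set (\<lambda>i. x i - y i) {1..n}"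
  by (simp add: Rn_dist_def L2_set_def)

lemma Rn_dist_nonneg [simp]: "0 \<le> Rn_dist n x y"
  by (simp add: Rn_dist_L2_set)

lemma Rn_dist_coordinate_le: "i \<in> {1..n} \<Longrightarrow> \<bar>x i - y i\<bar> \<le> Rn_dist n x y"
  using member_le_L2_set[of "{1..n}" i "\<lambda>i. \<bar>x i - y i\<bar>"] by (simp add: Rn_dist_def L2_set_def)

definition cover_cost :: "nat \<Rightarrow> nat \<Rightarrow> (nat \<Rightarrow> real) set \<Rightarrow> ennreal" where
  "cover_cost n m U = (if U = {} then 0 else Rn_diam n U ^ m)"

definition covers :: "nat \<Rightarrow> real \<Rightarrow> (nat \<Rightarrow> real) set \<Rightarrow> (nat \<Rightarrow> (nat \<Rightarrow> real) set) set" where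
  "covers n \<delta> A = {C. A \<subseteq> (\<Union>k. C k) \<and> (\<forall>k. C k \<subseteq> Rn n \<and> Rn_diam n (C k) \<le> ennreal \<delta>)}"

lemma hausdorff_delta_covers: "hausdorff_delta n m \<delta> A = (INF C\<in>covers n \<delta> A. \<Sum>k. cover_cost n m (C k))"
  by (simp add: hausdorff_delta_def covers_def cover_cost_def)

lemma Rn_diam_le_iff:
  assumes "d \<ge> 0"
  shows "Rn_diam n U \<le> ennreal d \<longleftrightarrow> (\<forall>x\<in>U. \<forall>y\<in>U. Rn_dist n x y \<le> d)"
  using assms by (auto simp: Rn_diam_def SUP_le_iff)

lemma dist_le_Rn_diam: "x \<in> U \<Longrightarrow> y \<in> U \<Longrightarrow> ennreal (Rn_dist n x y) \<le> Rn_diam n U"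
  unfolding Rn_diam_def by (meson SUP_upper2 order_refl)

lemma Rn_diam_mono: "U \<subseteq> V \<Longrightarrow> Rn_diam n U \<le> Rn_diam n V"
  unfolding Rn_diam_def by (intro SUP_subset_mono) auto

lemma cover_cost_mono: "U \<subseteq> V \<Longrightarrow> cover_cost n m U \<le> cover_cost n m V"
  unfolding cover_cost_def by (auto intro!: power_mono Rn_diam_mono)

lemma cover_cost_empty [simp]: "cover_cost n m {} = 0"
  by (simp add: cover_cost_def)

lemma covers_Int: "C \<in> covers n \<delta> A \<Longrightarrow> B \<subseteq> A \<Longrightarrow> (\<lambda>k. C k \<inter> B) \<in> covers n \<delta> B"
  unfolding covers_def by (auto intro: order_trans[OF Rn_diam_mono])

lemma hausdorff_delta_antimono:
  assumes "\<delta> \<le> \<epsilon>" shows "hausdorff_delta n m \<epsilon> A \<le> hausdorff_delta n m \<delta> A"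
  unfolding hausdorff_delta_covers
  using assms by (intro INF_superset_mono) (auto simp: covers_def intro: order_trans ennreal_leI)

lemma hausdorff_delta_mono: "A \<subseteq> B \<Longrightarrow> hausdorff_delta n m \<delta> A \<le> hausdorff_delta n m \<delta> B"
  unfolding hausdorff_delta_covers by (intro INF_superset_mono) (auto simp: covers_def)

lemma hausdorff_mono: "A \<subseteq> B \<Longrightarrow> hausdorff n m A \<le> hausdorff n m B"
  unfolding hausdorff_def by (intro SUP_mono) (auto intro: hausdorff_delta_mono)

lemma hausdorff_delta_le_hausdorff: "\<delta> > 0 \<Longrightarrow> hausdorff_delta n m \<delta> A \<le> hausdorff n m A"
  unfolding hausdorff_def by (rule SUP_upper) auto

lemma hausdorff_delta_empty [simp]: "hausdorff_delta n m \<delta> {} = 0"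
proof -
  have "(\<lambda>k. {}) \<in> covers n \<delta> {}" by (auto simp: covers_def Rn_diam_def bot_ennreal)
  then have "hausdorff_delta n m \<delta> {} \<le> (\<Sum>k::nat. cover_cost n m {})"
    unfolding hausdorff_delta_covers by (rule INF_lower)
  then show ?thesis by simp
qed

lemma hausdorff_empty [simp]: "hausdorff n m {} = 0"
  by (simp add: hausdorff_def)

lemma Rn_diam_Lipschitz_image:
  assumes L: "L > 0" and f: "\<And>x y. x \<in> U \<Longrightarrow> y \<in> U \<Longrightarrow> Rn_dist n' (f x) (f y) \<le> L * Rn_dist n x y"
  shows "Rn_diam n' (f ` U) \<le> ennreal L * Rn_diam n U"
proof -
  have "ennreal (Rn_dist n' (f x) (f y)) \<le> ennreal L * Rn_diam n U" if "x \<in> U" "y \<in> U" for x y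
  proof -
    have "ennreal (Rn_dist n' (f x) (f y)) \<le> ennreal (L * Rn_dist n x y)"
      using f[OF that] by (rule ennreal_leI)
    also have "\<dots> = ennreal L * ennreal (Rn_dist n x y)" using L by (simp add: ennreal_mult)
    also have "\<dots> \<le> ennreal L * Rn_diam n U" by (intro mult_left_mono dist_le_Rn_diam that) auto
    finally show ?thesis .
  qed
  then show ?thesis unfolding Rn_diam_def[of n' "f ` U"] by (auto simp: SUP_le_iff)
qed

text \<open>Push the cover forward, after intersecting its members with \<open>A\<close>: the Lipschitz bound is only
  available there. Diameters grow by at most the factor \<open>L\<close>, hence the scale \<open>L * \<delta>\<close> on the left.\<close>

lemma hausdorff_delta_Lipschitz_image:
  assumes L: "L > 0" and f: "\<And>x y. x \<in> A \<Longrightarrow> y \<in> A \<Longrightarrow> Rn_dist n' (f x) (f y) \<le> L * Rn_dist n x y"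
    and im: "f ` A \<subseteq> Rn n'" and \<delta>: "\<delta> > 0"
  shows "hausdorff_delta n' m (L * \<delta>) (f ` A) \<le> ennreal (L ^ m) * hausdorff_delta n m \<delta> A"
proof -
  have *: "ennreal (inverse (L ^ m)) * hausdorff_delta n' m (L * \<delta>) (f ` A) \<le> (\<Sum>k. cover_cost n m (C k))"
    if C: "C \<in> covers n \<delta> A" for C
  proof -
    let ?D = "\<lambda>k. f ` (C k \<inter> A)"
    have d: "Rn_diam n' (?D k) \<le> ennreal L * Rn_diam n (C k)" for k
      using Rn_diam_Lipschitz_image[OF L, of "C k \<inter> A" n' f n] f Rn_diam_mono[of "C k \<inter> A" "C k" n]
      by (meson IntD2 inf.cobounded1 mult_left_mono order_trans zero_le)
    have "Rn_diam n' (?D k) \<le> ennreal (L * \<delta>)" for k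
    proof -
      have "ennreal L * Rn_diam n (C k) \<le> ennreal L * ennreal \<delta>"
        using C by (intro mult_left_mono) (auto simp: covers_def)
      with d[of k] show ?thesis using L \<delta> by (simp add: ennreal_mult)
    qed
    then have D: "?D \<in> covers n' (L * \<delta>) (f ` A)"
    proof -
      have "A \<subseteq> (\<Union>k. C k)" using C by (simp add: covers_def)
      then have "f ` A \<subseteq> (\<Union>k. ?D k)" by (simp add: image_UN[symmetric] Int_UN_distrib2[symmetric]) blast
      moreover have "?D k \<subseteq> Rn n'" for k using im by auto
      moreover assume "\<And>k. Rn_diam n' (?D k) \<le> ennreal (L * \<delta>)"
      ultimately show ?thesis unfolding covers_def by simp
    qed
    have c: "cover_cost n' m (?D k) \<le> ennreal (L ^ m) * cover_cost n m (C k)" for k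
    proof (cases "?D k = {}")
      case False
      then have "cover_cost n' m (?D k) \<le> (ennreal L * Rn_diam n (C k)) ^ m"
        using d[of k] by (auto simp: cover_cost_def intro!: power_mono)
      also have "\<dots> = ennreal (L ^ m) * cover_cost n m (C k)"
        using False L by (auto simp: cover_cost_def power_mult_distrib ennreal_power)
      finally show ?thesis .
    qed (simp add: cover_cost_def)
    have "hausdorff_delta n' m (L * \<delta>) (f ` A) \<le> (\<Sum>k. cover_cost n' m (?D k))"
      unfolding hausdorff_delta_covers using D by (rule INF_lower)
    also have "\<dots> \<le> (\<Sum>k. ennreal (L ^ m) * cover_cost n m (C k))"
      by (intro suminf_le c) auto
    finally have "hausdorff_delta n' m (L * \<delta>) (f ` A) \<le> ennreal (L ^ m) * (\<Sum>k. cover_cost n m (C k))"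
      by (simp add: ennreal_suminf_cmult)
    then have "ennreal (inverse (L ^ m)) * hausdorff_delta n' m (L * \<delta>) (f ` A)
        \<le> ennreal (inverse (L ^ m)) * (ennreal (L ^ m) * (\<Sum>k. cover_cost n m (C k)))"
      by (rule mult_left_mono) simp
    then show ?thesis using L by (simp add: mult.assoc[symmetric] ennreal_mult[symmetric])
  qed
  have "ennreal (inverse (L ^ m)) * hausdorff_delta n' m (L * \<delta>) (f ` A) \<le> hausdorff_delta n m \<delta> A"
    unfolding hausdorff_delta_covers[of n m] by (intro INF_greatest *)
  then have "ennreal (L ^ m) * (ennreal (inverse (L ^ m)) * hausdorff_delta n' m (L * \<delta>) (f ` A))
     \<le> ennreal (L ^ m) * hausdorff_delta n m \<delta> A"
    by (rule mult_left_mono) simp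
  then show ?thesis using L by (simp add: mult.assoc[symmetric] ennreal_mult[symmetric])
qed

lemma hausdorff_Lipschitz_image:
  assumes L: "L > 0" and f: "\<And>x y. x \<in> A \<Longrightarrow> y \<in> A \<Longrightarrow> Rn_dist n' (f x) (f y) \<le> L * Rn_dist n x y"
    and im: "f ` A \<subseteq> Rn n'"
  shows "hausdorff n' m (f ` A) \<le> ennreal (L ^ m) * hausdorff n m A"
  unfolding hausdorff_def[of n']
proof (rule SUP_least)
  fix \<delta> :: real assume "\<delta> \<in> {0<..}"
  then have \<delta>: "\<delta> / L > 0" using L by auto
  have "hausdorff_delta n' m \<delta> (f ` A) = hausdorff_delta n' m (L * (\<delta> / L)) (f ` A)" using L by simp
  also have "\<dots> \<le> ennreal (L ^ m) * hausdorff_delta n m (\<delta> / L) A"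
    by (rule hausdorff_delta_Lipschitz_image[OF L f im \<delta>])
  also have "\<dots> \<le> ennreal (L ^ m) * hausdorff n m A"
    by (intro mult_left_mono hausdorff_delta_le_hausdorff \<delta>) auto
  finally show "hausdorff_delta n' m \<delta> (f ` A) \<le> ennreal (L ^ m) * hausdorff n m A" .
qed

text \<open>The dimension \<open>n'\<close> of the target space may differ from \<open>n\<close>: the measure of a set depends only on its
  metric, so a piece of a hyperplane can be measured inside a space of one dimension less.\<close>

lemma hausdorff_isometric_image:
  assumes f: "\<And>x y. x \<in> A \<Longrightarrow> y \<in> A \<Longrightarrow> Rn_dist n' (f x) (f y) = Rn_dist n x y"
    and im: "f ` A \<subseteq> Rn n'" and A: "A \<subseteq> Rn n"
  shows "hausdorff n' m (f ` A) = hausdorff n m A"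
proof (rule antisym)
  show "hausdorff n' m (f ` A) \<le> hausdorff n m A"
    using hausdorff_Lipschitz_image[of 1 A n' f n m] f im by simp
  \<comment> \<open>An isometry is injective, because points of the extensional space at distance 0 coincide; its
    inverse is then 1-Lipschitz as well.\<close>
  have zero: "x = y" if "x \<in> A" "y \<in> A" "Rn_dist n x y = 0" for x y
  proof -
    have "\<forall>i\<in>{1..n}. x i = y i" using that(3) by (simp add: Rn_dist_L2_set L2_set_eq_0_iff)
    then show ?thesis using that A unfolding Rn_def by (meson PiE_ext subsetD)
  qed
  have inj: "inj_on f A"
  proof (rule inj_onI)
    fix x y assume *: "x \<in> A" "y \<in> A" "f x = f y"
    then have "Rn_dist n x y = Rn_dist n' (f x) (f x)" using f[of x y] by simp
    also have "\<dots> = 0" by (simp add: Rn_dist_def)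
    finally show "x = y" using zero * by blast
  qed
  have "hausdorff n m (inv_into A f ` f ` A) \<le> ennreal (1 ^ m) * hausdorff n' m (f ` A)"
    using inj f A by (intro hausdorff_Lipschitz_image) auto
  then show "hausdorff n m A \<le> hausdorff n' m (f ` A)" using inj by simp
qed

text \<open>Covers of the \<open>A i\<close> that are optimal up to \<open>e / 2\<^sup>i\<^sup>+\<^sup>1\<close> are merged into one cover, enumerated by
  \<open>prod_decode\<close>.\<close>

lemma hausdorff_delta_countably_subadditive:
  "hausdorff_delta n m \<delta> (\<Union>i. A i) \<le> (\<Sum>i. hausdorff_delta n m \<delta> (A i))"
proof (rule ennreal_le_epsilon)
  fix e :: real assume e: "0 < e" and fin: "(\<Sum>i. hausdorff_delta n m \<delta> (A i)) < top"
  have fi: "hausdorff_delta n m \<delta> (A i) < top" for i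
    using ennreal_suminf_lessD[OF fin] .
  have "\<exists>C\<in>covers n \<delta> (A i). (\<Sum>k. cover_cost n m (C k)) \<le> hausdorff_delta n m \<delta> (A i) + ennreal (e * (1/2)^Suc i)" for i
  proof -
    have "hausdorff_delta n m \<delta> (A i) < hausdorff_delta n m \<delta> (A i) + ennreal (e * (1/2)^Suc i)"
      using fi[of i] e by (simp add: ennreal_zero_less_mult_iff less_top)
    then show ?thesis unfolding hausdorff_delta_covers INF_less_iff by (auto intro: less_imp_le)
  qed
  then obtain C where C: "\<And>i. C i \<in> covers n \<delta> (A i)"
    and Cs: "\<And>i. (\<Sum>k. cover_cost n m (C i k)) \<le> hausdorff_delta n m \<delta> (A i) + ennreal (e * (1/2)^Suc i)"
    by metis
  let ?D = "\<lambda>j. C (fst (prod_decode j)) (snd (prod_decode j))"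
  have "?D \<in> covers n \<delta> (\<Union>i. A i)"
    unfolding covers_def
  proof (safe)
    fix x i assume "x \<in> A i"
    then obtain k where "x \<in> C i k" using C[of i] by (auto simp: covers_def)
    then have "x \<in> ?D (prod_encode (i, k))" by simp
    then show "x \<in> (\<Union>j. ?D j)" by blast
  next
    fix j x assume "x \<in> ?D j"
    then show "x \<in> Rn n" using C[of "fst (prod_decode j)"] unfolding covers_def by blast
  next
    fix j show "Rn_diam n (?D j) \<le> ennreal \<delta>" using C[of "fst (prod_decode j)"] unfolding covers_def by blast
  qed
  then have "hausdorff_delta n m \<delta> (\<Union>i. A i) \<le> (\<Sum>j. cover_cost n m (?D j))"
    unfolding hausdorff_delta_covers by (rule INF_lower)
  also have "\<dots> = (\<Sum>j. (\<lambda>(i, k). cover_cost n m (C i k)) (prod_decode j))"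
    by (simp add: case_prod_beta)
  also have "\<dots> = (\<Sum>i. \<Sum>k. cover_cost n m (C i k))"
    by (rule suminf_ennreal_2dimen) simp
  also have "\<dots> \<le> (\<Sum>i. hausdorff_delta n m \<delta> (A i) + ennreal (e * (1/2)^Suc i))"
    by (intro suminf_le Cs) auto
  also have "\<dots> = (\<Sum>i. hausdorff_delta n m \<delta> (A i)) + (\<Sum>i. ennreal (e * (1/2)^Suc i))"
    by (intro suminf_add[symmetric]) auto
  also have "(\<Sum>i. ennreal (e * (1/2)^Suc i)) = ennreal e"
    using sums_mult[OF power_half_series, of e] e
    by (subst suminf_ennreal_eq[where x=e]) auto
  finally show "hausdorff_delta n m \<delta> (\<Union>i. A i) \<le> (\<Sum>i. hausdorff_delta n m \<delta> (A i)) + ennreal e" .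
qed

lemma hausdorff_countably_subadditive: "hausdorff n m (\<Union>i. A i) \<le> (\<Sum>i. hausdorff n m (A i))"
  unfolding hausdorff_def[of n m "\<Union>i. A i"]
proof (rule SUP_least)
  fix \<delta> :: real assume "\<delta> \<in> {0<..}"
  then show "hausdorff_delta n m \<delta> (\<Union>i. A i) \<le> (\<Sum>i. hausdorff n m (A i))"
    by (intro order_trans[OF hausdorff_delta_countably_subadditive] suminf_le hausdorff_delta_le_hausdorff) auto
qed

lemma hausdorff_Un_le: "hausdorff n m (A \<union> B) \<le> hausdorff n m A + hausdorff n m B"
proof -
  have "hausdorff n m (\<Union>i. binaryset A B i) \<le> (\<Sum>i. hausdorff n m (binaryset A B i))"
    by (rule hausdorff_countably_subadditive)
  then show ?thesis by (simp add: UN_binaryset_eq suminf_binaryset_eq)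
qed

text \<open>Once \<open>\<delta> < d\<close>, no member of a cover meets both sets, so every cover of the union splits into a cover of
  \<open>A\<close> and a cover of \<open>B\<close>.\<close>

lemma hausdorff_Un_separated:
  assumes d: "d > 0" and sep: "\<And>x y. x \<in> A \<Longrightarrow> y \<in> B \<Longrightarrow> d \<le> Rn_dist n x y"
  shows "hausdorff n m A + hausdorff n m B \<le> hausdorff n m (A \<union> B)"
proof -
  have *: "hausdorff_delta n m \<delta> A + hausdorff_delta n m \<delta> B \<le> hausdorff_delta n m \<delta> (A \<union> B)"
    if \<delta>: "0 < \<delta>" "\<delta> < d" for \<delta>
    unfolding hausdorff_delta_covers[of n m \<delta> "A \<union> B"]
  proof (rule INF_greatest)
    fix C assume C: "C \<in> covers n \<delta> (A \<union> B)"
    have one: "C k \<inter> A = {} \<or> C k \<inter> B = {}" for k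
    proof (rule ccontr)
      assume "\<not> ?thesis"
      then obtain x y where xy: "x \<in> C k" "x \<in> A" "y \<in> C k" "y \<in> B" by auto
      then have "Rn_dist n x y \<le> \<delta>" using C \<delta> Rn_diam_le_iff[of \<delta> n "C k"] by (auto simp: covers_def)
      with sep[of x y] xy \<delta> show False by auto
    qed
    have "hausdorff_delta n m \<delta> A \<le> (\<Sum>k. cover_cost n m (C k \<inter> A))"
      unfolding hausdorff_delta_covers by (intro INF_lower covers_Int[OF C]) auto
    moreover have "hausdorff_delta n m \<delta> B \<le> (\<Sum>k. cover_cost n m (C k \<inter> B))"
      unfolding hausdorff_delta_covers by (intro INF_lower covers_Int[OF C]) auto
    ultimately have "hausdorff_delta n m \<delta> A + hausdorff_delta n m \<delta> B
        \<le> (\<Sum>k. cover_cost n m (C k \<inter> A)) + (\<Sum>k. cover_cost n m (C k \<inter> B))"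
      by (rule add_mono)
    also have "\<dots> = (\<Sum>k. cover_cost n m (C k \<inter> A) + cover_cost n m (C k \<inter> B))"
      by (intro suminf_add) auto
    also have "\<dots> \<le> (\<Sum>k. cover_cost n m (C k))"
    proof (intro suminf_le)
      fix k
      show "cover_cost n m (C k \<inter> A) + cover_cost n m (C k \<inter> B) \<le> cover_cost n m (C k)"
        using one[of k] by (auto intro: cover_cost_mono)
    qed auto
    finally show "hausdorff_delta n m \<delta> A + hausdorff_delta n m \<delta> B \<le> (\<Sum>k. cover_cost n m (C k))" .
  qed
  have "hausdorff n m A + hausdorff n m B
      = (SUP \<delta>\<in>{0<..}. hausdorff_delta n m \<delta> A + hausdorff_delta n m \<delta> B)"
    unfolding hausdorff_def
  proof (rule SUP_add_directed_ennreal[symmetric])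
    fix \<delta> \<epsilon> :: real assume "\<delta> \<in> {0<..}" "\<epsilon> \<in> {0<..}"
    then show "\<exists>k\<in>{0<..}. hausdorff_delta n m \<delta> A + hausdorff_delta n m \<epsilon> B
        \<le> hausdorff_delta n m k A + hausdorff_delta n m k B"
      by (intro bexI[of _ "min \<delta> \<epsilon>"] add_mono hausdorff_delta_antimono) auto
  qed
  also have "\<dots> \<le> hausdorff n m (A \<union> B)"
  proof (rule SUP_least)
    fix \<delta> :: real assume \<delta>: "\<delta> \<in> {0<..}"
    let ?e = "min \<delta> (d/2)"
    have e: "0 < ?e" "?e < d" using \<delta> d by auto
    have "hausdorff_delta n m \<delta> A + hausdorff_delta n m \<delta> B \<le> hausdorff_delta n m ?e A + hausdorff_delta n m ?e B"
      by (intro add_mono hausdorff_delta_antimono) auto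
    also have "\<dots> \<le> hausdorff_delta n m ?e (A \<union> B)" by (rule *[OF e])
    also have "\<dots> \<le> hausdorff n m (A \<union> B)" by (rule hausdorff_delta_le_hausdorff[OF e(1)])
    finally show "hausdorff_delta n m \<delta> A + hausdorff_delta n m \<delta> B \<le> hausdorff n m (A \<union> B)" .
  qed
  finally show ?thesis .
qed

section \<open>Additivity on Borel sets\<close>

text \<open>The half-spaces \<open>x i \<le> a\<close> and \<open>x i > a\<close> are not at positive distance, so the open side is exhausted by
  the sets \<open>T k\<close> where \<open>x i\<close> exceeds \<open>a\<close> by at least \<open>1 / (k + 1)\<close>. The error is the part outside \<open>T k\<close>, a union of
  slabs \<open>R j\<close> with \<open>j \<ge> k\<close>. Slabs of equal parity are at positive distance from each other, so all
  slabs together have measures summing to at most twice that of \<open>X\<close>, and the tails of a convergent series vanish.\<close>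

lemma hausdorff_halfspace_Caratheodory:
  assumes fin: "hausdorff n m X < top" and i: "i \<in> {1..n}"
  shows "hausdorff n m {x\<in>X. x i \<le> a} + hausdorff n m {x\<in>X. a < x i} \<le> hausdorff n m X"
proof -
  let ?H = "hausdorff n m"
  define \<tau> where "\<tau> k = a + 1 / (real k + 1)" for k
  have tau_mono: "\<tau> l \<le> \<tau> k" if "k \<le> l" for k l
    using that by (auto simp: \<tau>_def intro!: divide_left_mono)
  have tau_Suc: "\<tau> (Suc k) < \<tau> k" for k
    by (auto simp: \<tau>_def intro!: divide_strict_left_mono)
  have tau_gt: "a < \<tau> k" for k by (simp add: \<tau>_def)
  define T where "T k = {x\<in>X. \<tau> k \<le> x i}" for k
  define R where "R k = {x\<in>X. \<tau> (Suc k) \<le> x i \<and> x i < \<tau> k}" for k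
  have sep: "?H A + ?H B \<le> ?H (A \<union> B)"
    if "\<And>x. x \<in> A \<Longrightarrow> x i \<le> r" "\<And>x. x \<in> B \<Longrightarrow> s \<le> x i" "r < s" for A B r s
  proof (rule hausdorff_Un_separated)
    show "0 < s - r" using that by simp
    fix x y assume "x \<in> A" "y \<in> B"
    then have "s - r \<le> \<bar>x i - y i\<bar>" using that(1)[of x] that(2)[of y] by linarith
    also have "\<dots> \<le> Rn_dist n x y" by (rule Rn_dist_coordinate_le[OF i])
    finally show "s - r \<le> Rn_dist n x y" .
  qed
  have alternate: "(\<Sum>j<N. ?H (R (2 * j + p))) \<le> ?H (\<Union>j<N. R (2 * j + p))" for N p
  proof (induction N)
    case (Suc N)
    have "?H (R (2 * N + p)) + ?H (\<Union>j<N. R (2 * j + p)) \<le> ?H (R (2 * N + p) \<union> (\<Union>j<N. R (2 * j + p)))"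
    proof (cases N)
      case (Suc N')
      show ?thesis
      proof (rule sep)
        fix x assume "x \<in> (\<Union>j<N. R (2 * j + p))"
        then obtain j where "j < N" "x \<in> R (2 * j + p)" by auto
        then show "\<tau> (Suc (2 * N' + p)) \<le> x i"
          using tau_mono[of "Suc (2 * j + p)" "Suc (2 * N' + p)"] Suc by (auto simp: R_def)
      next
        show "\<tau> (2 * N + p) < \<tau> (Suc (2 * N' + p))" using tau_Suc[of "Suc (2 * N' + p)"] Suc by simp
      qed (auto simp: R_def)
    qed simp
    with Suc.IH show ?case
      by (simp add: lessThan_Suc add.commute) (meson add_left_mono order_trans)
  qed simp
  have half: "(\<Sum>j<N. ?H (R (2 * j + p))) \<le> ?H X" for N p
    by (rule order_trans[OF alternate hausdorff_mono]) (auto simp: R_def)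
  have split: "(\<Sum>j<2*N. f j) = (\<Sum>j<N. f (2 * j + 0)) + (\<Sum>j<N. f (2 * j + 1))" for f :: "nat \<Rightarrow> ennreal" and N
    by (induction N) (auto simp: ac_simps)
  have "(\<Sum>j<N. ?H (R j)) \<le> ?H X + ?H X" for N
  proof -
    have "(\<Sum>j<N. ?H (R j)) \<le> (\<Sum>j<2*N. ?H (R j))" by (rule sum_mono2) auto
    also have "\<dots> \<le> ?H X + ?H X" unfolding split by (intro add_mono half)
    finally show ?thesis .
  qed
  then have "(\<Sum>j. ?H (R j)) \<le> ?H X + ?H X" by (intro suminf_le_const) auto
  then have S: "(\<Sum>j. ?H (R j)) < top" using fin by (auto intro: le_less_trans simp: ennreal_add_less_top)
  \<comment> \<open>The first \<open>k\<close> slabs are added on the left to complete the tail of the series on the right, so that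
    \<open>k\<close> can grow without taking a limit of tails.\<close>
  have bound: "(\<Sum>j<k. ?H (R j)) + (?H {x\<in>X. x i \<le> a} + ?H {x\<in>X. a < x i}) \<le> ?H X + (\<Sum>j. ?H (R j))" for k
  proof -
    have "{x\<in>X. a < x i} \<subseteq> T k \<union> (\<Union>j. R (j + k))"
    proof
      fix x assume x: "x \<in> {x\<in>X. a < x i}"
      have "(\<lambda>k. a + 1 / (real k + 1)) \<longlonglongrightarrow> a + 0"
        by (intro tendsto_add tendsto_const) (use LIMSEQ_inverse_real_of_nat in \<open>simp add: inverse_eq_divide add.commute\<close>)
      then have "\<forall>\<^sub>F k in sequentially. \<tau> k < x i" unfolding \<tau>_def by (rule order_tendstoD) (use x in auto)
      then obtain l where l: "\<tau> l < x i" by (auto simp: eventually_sequentially)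
      define l0 where "l0 = (LEAST l. \<tau> l \<le> x i)"
      have l0: "\<tau> l0 \<le> x i" unfolding l0_def using l by (intro LeastI) (rule less_imp_le)
      show "x \<in> T k \<union> (\<Union>j. R (j + k))"
      proof (cases "l0 \<le> k")
        case True
        then show ?thesis using l0 tau_mono[OF True] x by (auto simp: T_def)
      next
        case False
        then obtain j where j: "l0 = Suc (j + k)" by (metis add.commute less_imp_Suc_add not_le_imp_less add_Suc_right)
        have "\<not> \<tau> (j + k) \<le> x i" using not_less_Least[of "j + k" "\<lambda>l. \<tau> l \<le> x i"] j by (simp add: l0_def)
        then have "x \<in> R (j + k)" using l0 j x by (auto simp: R_def)
        then show ?thesis by blast
      qed
    qed
    then have "?H {x\<in>X. a < x i} \<le> ?H (T k \<union> (\<Union>j. R (j + k)))" by (rule hausdorff_mono)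
    also have "\<dots> \<le> ?H (T k) + ?H (\<Union>j. R (j + k))" by (rule hausdorff_Un_le)
    also have "\<dots> \<le> ?H (T k) + (\<Sum>j. ?H (R (j + k)))" by (intro add_left_mono hausdorff_countably_subadditive)
    finally have 1: "?H {x\<in>X. a < x i} \<le> ?H (T k) + (\<Sum>j. ?H (R (j + k)))" .
    have "?H {x\<in>X. x i \<le> a} + ?H (T k) \<le> ?H ({x\<in>X. x i \<le> a} \<union> T k)"
      by (rule sep[of _ a _ "\<tau> k"]) (auto simp: T_def tau_gt)
    also have "\<dots> \<le> ?H X" by (rule hausdorff_mono) (auto simp: T_def)
    finally have 2: "?H {x\<in>X. x i \<le> a} + ?H (T k) \<le> ?H X" .
    have "(\<Sum>j<k. ?H (R j)) + (?H {x\<in>X. x i \<le> a} + ?H {x\<in>X. a < x i})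
       \<le> (\<Sum>j<k. ?H (R j)) + (?H {x\<in>X. x i \<le> a} + (?H (T k) + (\<Sum>j. ?H (R (j + k)))))"
      by (intro add_left_mono 1)
    also have "\<dots> = (?H {x\<in>X. x i \<le> a} + ?H (T k)) + ((\<Sum>j. ?H (R (j + k))) + (\<Sum>j<k. ?H (R j)))"
      by (simp add: ac_simps)
    also have "\<dots> \<le> ?H X + (\<Sum>j. ?H (R j))"
      by (subst suminf_offset[of "\<lambda>j. ?H (R j)" k]) (auto intro: add_right_mono 2)
    finally show ?thesis .
  qed
  have "(\<Sum>j. ?H (R j)) + (?H {x\<in>X. x i \<le> a} + ?H {x\<in>X. a < x i}) \<le> ?H X + (\<Sum>j. ?H (R j))"
    by (rule ennreal_suminf_bound_add) (rule bound)
  then show ?thesis using S by (auto simp add: add.commute[of "?H X"] ennreal_add_left_cancel_le)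
qed

text \<open>A sigma-algebra that contains the closed coordinate half-spaces contains all coordinate cylinders, and
  these generate the product sigma-algebra.\<close>

lemma sets_Rn_lebesgue_subset:
  assumes S: "sigma_algebra (Rn n) S"
    and half: "\<And>i a. i \<in> {1..n} \<Longrightarrow> {x\<in>Rn n. x i \<le> a} \<in> S"
  shows "sets (Rn_lebesgue n) \<subseteq> S"
proof -
  interpret S: sigma_algebra "Rn n" S by fact
  have cyl: "{x\<in>Rn n. x i \<in> B} \<in> S" if i: "i \<in> {1..n}" and B: "B \<in> sigma_sets UNIV (range atMost)" for i and B :: "real set"
    using B
  proof (induction rule: sigma_sets.induct)
    case (Basic B)
    then show ?case using half[OF i] by auto
  next
    case (Compl B)
    have "{x\<in>Rn n. x i \<in> UNIV - B} = Rn n - {x\<in>Rn n. x i \<in> B}" by auto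
    then show ?case using S.compl_sets[OF Compl.IH] by simp
  next
    case (Union B)
    have "{x\<in>Rn n. x i \<in> (\<Union>j. B j)} = (\<Union>j. {x\<in>Rn n. x i \<in> B j})" by auto
    then show ?case using Union by auto
  qed auto
  have borel: "sets (borel :: real measure) = sigma_sets UNIV (range atMost)"
    by (subst borel_eq_atMost) (simp add: sets_measure_of)
  have "sets (Rn_lebesgue n) = sigma_sets (Rn n) {{f\<in>Rn n. f i \<in> B} | i B. i \<in> {1..n} \<and> B \<in> sets borel}"
    unfolding Rn_lebesgue_def by (subst sets_PiM_single) (simp add: Rn_def)
  also have "\<dots> \<subseteq> S"
    using cyl unfolding borel by (intro S.sigma_sets_subset) blast
  finally show ?thesis .
qed

definition hausdorff_measure :: "nat \<Rightarrow> nat \<Rightarrow> (nat \<Rightarrow> real) measure" where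
  "hausdorff_measure n m = measure_of (Rn n) (sets (Rn_lebesgue n)) (hausdorff n m)"

lemma space_hausdorff_measure [simp]: "space (hausdorff_measure n m) = Rn n"
  by (simp add: hausdorff_measure_def space_measure_of_conv)

lemma sets_hausdorff_measure [simp, measurable_cong]:
  "sets (hausdorff_measure n m) = sets (Rn_lebesgue n)"
  using sets.sigma_sets_eq[of "Rn_lebesgue n"] sets.space_closed[of "Rn_lebesgue n"]
  by (simp add: hausdorff_measure_def sets_measure_of)

text \<open>Caratheodory: the sets that split every set additively form a sigma-algebra on which the outer measure is
  a measure; half-spaces belong to it, hence so do all Borel sets.\<close>

lemma emeasure_hausdorff_measure:
  assumes A: "A \<in> sets (Rn_lebesgue n)"
  shows "emeasure (hausdorff_measure n m) A = hausdorff n m A"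
proof -
  interpret P: sigma_algebra "Rn n" "Pow (Rn n)" by (rule sigma_algebra_Pow)
  let ?L = "lambda_system (Rn n) (Pow (Rn n)) (hausdorff n m)"
  have "outer_measure_space (Pow (Rn n)) (hausdorff n m)"
    by (auto simp: outer_measure_space_def positive_def increasing_def countably_subadditive_def
        hausdorff_mono hausdorff_countably_subadditive)
  then have ms: "measure_space (Rn n) ?L (hausdorff n m)" by (rule P.caratheodory_lemma)
  have sub: "sets (Rn_lebesgue n) \<subseteq> ?L"
  proof (rule sets_Rn_lebesgue_subset)
    show "sigma_algebra (Rn n) ?L" using ms by (simp add: measure_space_def)
    fix i a assume i: "i \<in> {1..n}"
    show "{x\<in>Rn n. x i \<le> a} \<in> ?L"
      unfolding P.lambda_system_eq
    proof (intro CollectI conjI ballI)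
      fix X assume X: "X \<in> Pow (Rn n)"
      have eq: "X \<inter> {x\<in>Rn n. x i \<le> a} = {x\<in>X. x i \<le> a}" "X - {x\<in>Rn n. x i \<le> a} = {x\<in>X. a < x i}"
        using X by auto
      show "hausdorff n m (X \<inter> {x\<in>Rn n. x i \<le> a}) + hausdorff n m (X - {x\<in>Rn n. x i \<le> a}) = hausdorff n m X"
        unfolding eq
      proof (rule antisym)
        show "hausdorff n m {x\<in>X. x i \<le> a} + hausdorff n m {x\<in>X. a < x i} \<le> hausdorff n m X"
          by (cases "hausdorff n m X = top") (auto simp: hausdorff_halfspace_Caratheodory[OF _ i] less_top)
        have "X = {x\<in>X. x i \<le> a} \<union> {x\<in>X. a < x i}" by auto
        then show "hausdorff n m X \<le> hausdorff n m {x\<in>X. x i \<le> a} + hausdorff n m {x\<in>X. a < x i}"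
          using hausdorff_Un_le[of n m "{x\<in>X. x i \<le> a}" "{x\<in>X. a < x i}"] by simp
      qed
    qed auto
  qed
  show ?thesis
    unfolding hausdorff_measure_def
  proof (rule emeasure_measure_of_sigma[OF _ _ _ A])
    show "sigma_algebra (Rn n) (sets (Rn_lebesgue n))"
      using sets.sigma_algebra_axioms[of "Rn_lebesgue n"] by simp
    show "positive (sets (Rn_lebesgue n)) (hausdorff n m)" by (simp add: positive_def)
    show "countably_additive (sets (Rn_lebesgue n)) (hausdorff n m)"
      using ms sub unfolding measure_space_def countably_additive_def by (meson order_trans subsetD)
  qed
qed

section \<open>Hausdorff and Lebesgue measure on the full space\<close>

definition homothety :: "nat \<Rightarrow> (nat \<Rightarrow> real) \<Rightarrow> real \<Rightarrow> (nat \<Rightarrow> real) \<Rightarrow> nat \<Rightarrow> real" where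
  "homothety n a s x = (\<lambda>i\<in>{1..n}. a i + s * x i)"

lemma homothety_in_Rn [simp]: "homothety n a s x \<in> Rn n"
  by (simp add: homothety_def Rn_def)

lemma Rn_dist_homothety: "Rn_dist n (homothety n a s x) (homothety n a s y) = \<bar>s\<bar> * Rn_dist n x y"
proof -
  have "(\<Sum>i=1..n. (homothety n a s x i - homothety n a s y i)\<^sup>2) = (\<Sum>i=1..n. s\<^sup>2 * (x i - y i)\<^sup>2)"
    by (intro sum.cong refl) (simp add: homothety_def power2_eq_square algebra_simps)
  then show ?thesis
    by (simp add: Rn_dist_def sum_distrib_left[symmetric] real_sqrt_mult)
qed

lemma homothety_inverse:
  "s \<noteq> 0 \<Longrightarrow> x \<in> Rn n \<Longrightarrow> homothety n (\<lambda>i. - (a i / s)) (1 / s) (homothety n a s x) = x"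
  by (auto simp: homothety_def Rn_def fun_eq_iff PiE_def extensional_def field_simps)

lemma hausdorff_homothety:
  assumes s: "s > 0" and A: "A \<subseteq> Rn n"
  shows "hausdorff n m (homothety n a s ` A) = ennreal (s ^ m) * hausdorff n m A"
proof (rule antisym)
  show "hausdorff n m (homothety n a s ` A) \<le> ennreal (s ^ m) * hausdorff n m A"
    using s by (intro hausdorff_Lipschitz_image) (auto simp: Rn_dist_homothety)
  let ?g = "homothety n (\<lambda>i. - (a i / s)) (1 / s)"
  have inv: "?g ` homothety n a s ` A = A"
    using A s by (force simp: image_image homothety_inverse subset_eq)
  have "hausdorff n m (?g ` homothety n a s ` A) \<le> ennreal ((1 / s) ^ m) * hausdorff n m (homothety n a s ` A)"
    using s by (intro hausdorff_Lipschitz_image) (auto simp: Rn_dist_homothety)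
  then have "hausdorff n m A \<le> ennreal ((1 / s) ^ m) * hausdorff n m (homothety n a s ` A)" unfolding inv .
  then have "ennreal (s ^ m) * hausdorff n m A \<le> ennreal (s ^ m) * (ennreal ((1 / s) ^ m) * hausdorff n m (homothety n a s ` A))"
    by (rule mult_left_mono) simp
  then show "ennreal (s ^ m) * hausdorff n m A \<le> hausdorff n m (homothety n a s ` A)"
    using s by (simp add: mult.assoc[symmetric] ennreal_mult[symmetric] power_one_over)
qed

lemma Rn_dist_le_of_coordinates:
  assumes "\<And>i. i \<in> {1..n} \<Longrightarrow> \<bar>x i - y i\<bar> \<le> d"
  shows "Rn_dist n x y \<le> real n * d"
proof -
  have "Rn_dist n x y \<le> (\<Sum>i\<in>{1..n}. \<bar>x i - y i\<bar>)"
    unfolding Rn_dist_L2_set by (rule L2_set_le_sum_abs)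
  also have "\<dots> \<le> (\<Sum>i\<in>{1..n}. d)" by (intro sum_mono assms)
  finally show ?thesis by simp
qed

text \<open>Cutting the cube into \<open>N\<^sup>m\<close> cubes of side \<open>1 / N\<close> and diameter at most \<open>m / N\<close> gives covers of cost \<open>m\<^sup>m\<close> at
  every scale.\<close>

lemma hausdorff_unit_cube_finite: "hausdorff m m (unit_cube m) < top"
proof -
  have "hausdorff_delta m m \<delta> (unit_cube m) \<le> ennreal (real m ^ m)" if \<delta>: "\<delta> > 0" for \<delta>
  proof -
    obtain N :: nat where N: "real m / \<delta> < real N" using reals_Archimedean2 by blast
    have N0: "N > 0" using N \<delta> by (metis divide_nonneg_pos not_gr_zero of_nat_0 of_nat_0_le_iff not_less)
    define Z where "Z = (\<Pi>\<^sub>E i\<in>{1..m}. {..<N})"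
    have Z: "finite Z" "card Z = N ^ m" by (auto simp: Z_def finite_PiE card_PiE)
    define Q where "Q z = {x\<in>Rn m. \<forall>i\<in>{1..m}. real (z i) / real N \<le> x i \<and> x i \<le> (real (z i) + 1) / real N}"
      for z :: "nat \<Rightarrow> nat"
    obtain h where h: "bij_betw h {0..<N ^ m} Z" using ex_bij_betw_nat_finite[OF Z(1)] Z(2) by metis
    define C where "C k = (if k < N ^ m then Q (h k) else {})" for k
    have d: "Rn_diam m (Q z) \<le> ennreal (real m / real N)" for z
    proof (subst Rn_diam_le_iff, simp, intro ballI)
      fix x y assume xy: "x \<in> Q z" "y \<in> Q z"
      have "Rn_dist m x y \<le> real m * (1 / real N)"
      proof (rule Rn_dist_le_of_coordinates)
        fix i assume "i \<in> {1..m}"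
        then show "\<bar>x i - y i\<bar> \<le> 1 / real N" using xy unfolding Q_def by (auto simp: add_divide_distrib abs_le_iff) force+
      qed
      then show "Rn_dist m x y \<le> real m / real N" by simp
    qed
    have C: "C \<in> covers m \<delta> (unit_cube m)"
      unfolding covers_def
    proof (intro CollectI conjI allI)
      show "unit_cube m \<subseteq> (\<Union>k. C k)"
      proof
        fix x assume x: "x \<in> unit_cube m"
        then have xi: "0 \<le> x i" "x i \<le> 1" if "i \<in> {1..m}" for i using that by (auto simp: unit_cube_def)
        \<comment> \<open>The minimum puts the face \<open>x i = 1\<close> into the last subcube.\<close>
        define z where "z = (\<lambda>i\<in>{1..m}. min (N - 1) (nat \<lfloor>real N * x i\<rfloor>))"
        have "z \<in> Z" using N0 by (auto simp: z_def Z_def)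
        then obtain k where k: "k < N ^ m" "h k = z" using h by (metis atLeastLessThan_iff bij_betw_def imageE)
        have "real (z i) / real N \<le> x i \<and> x i \<le> (real (z i) + 1) / real N" if i: "i \<in> {1..m}" for i
        proof -
          have f: "real (nat \<lfloor>real N * x i\<rfloor>) \<le> real N * x i" "real N * x i \<le> real (nat \<lfloor>real N * x i\<rfloor>) + 1"
            using xi[OF i] by (auto intro: of_nat_floor order.strict_implies_order real_nat_ceiling_ge)
          have zi: "z i = min (N - 1) (nat \<lfloor>real N * x i\<rfloor>)" using i by (simp add: z_def)
          have "real (z i) \<le> real N * x i" using f zi by linarith
          moreover have "real N * x i \<le> real (z i) + 1"
          proof (cases "nat \<lfloor>real N * x i\<rfloor> \<le> N - 1")
            case False
            then have "real (z i) + 1 = real N" using zi N0 by (simp add: of_nat_diff)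
            then show ?thesis using mult_left_mono[OF xi(2)[OF i], of "real N"] by simp
          qed (use f zi in auto)
          ultimately show ?thesis using N0 by (simp add: field_simps)
        qed
        then have "x \<in> C k" using k x by (auto simp: C_def Q_def unit_cube_def Rn_def)
        then show "x \<in> (\<Union>k. C k)" by blast
      qed
      fix k
      show "C k \<subseteq> Rn m" by (auto simp: C_def Q_def)
      have "real m / real N \<le> \<delta>" using N N0 \<delta> by (simp add: field_simps)
      then show "Rn_diam m (C k) \<le> ennreal \<delta>"
        using d[of "h k"] order_trans[OF d[of "h k"] ennreal_leI] by (auto simp: C_def Rn_diam_def[of m "{}"] bot_ennreal)
    qed
    have "hausdorff_delta m m \<delta> (unit_cube m) \<le> (\<Sum>k. cover_cost m m (C k))"
      unfolding hausdorff_delta_covers using C by (rule INF_lower)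
    also have "\<dots> = (\<Sum>k<N ^ m. cover_cost m m (C k))" by (intro suminf_finite) (auto simp: C_def)
    also have "\<dots> \<le> (\<Sum>k<N ^ m. ennreal ((real m / real N) ^ m))"
    proof (intro sum_mono)
      fix k
      have "cover_cost m m (C k) \<le> ennreal (real m / real N) ^ m"
        using d[of "h k"] by (auto simp: cover_cost_def C_def intro!: power_mono)
      then show "cover_cost m m (C k) \<le> ennreal ((real m / real N) ^ m)" by (simp add: ennreal_power)
    qed
    also have "\<dots> = ennreal (real m ^ m)"
      using N0 by (simp add: ennreal_of_nat_eq_real_of_nat ennreal_mult[symmetric] power_divide)
    finally show ?thesis .
  qed
  then have "hausdorff m m (unit_cube m) \<le> ennreal (real m ^ m)"
    unfolding hausdorff_def by (auto intro: SUP_least)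
  then show ?thesis by (simp add: le_less_trans)
qed

lemma emeasure_Rn_lebesgue_PiE:
  assumes "\<And>i. i \<in> {1..n} \<Longrightarrow> B i \<in> sets borel"
  shows "emeasure (Rn_lebesgue n) (\<Pi>\<^sub>E i\<in>{1..n}. B i) = (\<Prod>i=1..n. emeasure lborel (B i))"
proof -
  interpret product_sigma_finite "\<lambda>i::nat. lborel :: real measure" by standard
  show ?thesis unfolding Rn_lebesgue_def using assms by (subst emeasure_PiM) auto
qed

text \<open>A set of diameter \<open>d\<close> lies in a box with sides \<open>2 d\<close>, so the cost of a cover is at least \<open>2\<^sup>-\<^sup>m\<close> times the
  Lebesgue measure of the set that is covered.\<close>

lemma hausdorff_unit_cube_positive: "hausdorff m m (unit_cube m) > 0"
proof -
  have "1 \<le> ennreal (2 ^ m) * (\<Sum>k. cover_cost m m (C k))" if C: "C \<in> covers m 1 (unit_cube m)" for C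
  proof -
    define d where "d k = enn2real (Rn_diam m (C k))" for k
    have d: "Rn_diam m (C k) = ennreal (d k)" for k
      using C by (auto simp: covers_def d_def intro!: ennreal_enn2real[symmetric] intro: le_less_trans)
    have dn: "0 \<le> d k" for k by (simp add: d_def)
    define p where "p k = (SOME x. x \<in> C k)" for k
    define B where "B k = (if C k = {} then {} else \<Pi>\<^sub>E i\<in>{1..m}. {p k i - d k .. p k i + d k})" for k
    have Bs: "B k \<in> sets (Rn_lebesgue m)" for k
      unfolding B_def Rn_lebesgue_def by (auto intro!: sets_PiM_I_finite)
    have CB: "C k \<subseteq> B k" for k
    proof
      fix x assume x: "x \<in> C k"
      then have p: "p k \<in> C k" unfolding p_def by (rule someI[where P="\<lambda>x. x \<in> C k"])
      have "Rn_dist m x (p k) \<le> d k" using dist_le_Rn_diam[OF x p, of m] by (simp add: d dn)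
      then have "\<bar>x i - p k i\<bar> \<le> d k" if "i \<in> {1..m}" for i using Rn_dist_coordinate_le[OF that, of x "p k"] by simp
      then have "\<forall>i\<in>{1..m}. p k i - d k \<le> x i \<and> x i \<le> p k i + d k" by (simp add: abs_diff_le_iff)
      moreover have "x \<in> Rn m" using x C by (auto simp: covers_def)
      ultimately show "x \<in> B k" using x by (auto simp: B_def Rn_def PiE_iff)
    qed
    have eB: "emeasure (Rn_lebesgue m) (B k) = ennreal (2 ^ m) * cover_cost m m (C k)" for k
    proof (cases "C k = {}")
      case False
      have "emeasure (Rn_lebesgue m) (B k) = (\<Prod>i=1..m. emeasure lborel {p k i - d k .. p k i + d k})"
        using False unfolding B_def by (simp only: if_False, subst emeasure_Rn_lebesgue_PiE) auto
      also have "\<dots> = ennreal (2 * d k) ^ m" using dn[of k] by simp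
      also have "\<dots> = ennreal (2 ^ m) * cover_cost m m (C k)"
        using False by (simp add: cover_cost_def d dn ennreal_mult[symmetric] power_mult_distrib ennreal_power)
      finally show ?thesis .
    qed (simp add: B_def)
    have "1 = emeasure (Rn_lebesgue m) (unit_cube m)"
      unfolding unit_cube_def by (subst emeasure_Rn_lebesgue_PiE) auto
    also have "\<dots> \<le> emeasure (Rn_lebesgue m) (\<Union>k. B k)"
      using C CB Bs by (intro emeasure_mono) (auto simp: covers_def, blast)
    also have "\<dots> \<le> (\<Sum>k. emeasure (Rn_lebesgue m) (B k))"
      using Bs by (intro emeasure_subadditive_countably) auto
    also have "\<dots> = ennreal (2 ^ m) * (\<Sum>k. cover_cost m m (C k))" by (simp add: eB)
    finally show ?thesis .
  qed
  then have "inverse (ennreal (2 ^ m)) \<le> (\<Sum>k. cover_cost m m (C k))" if "C \<in> covers m 1 (unit_cube m)" for C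
  proof -
    have "inverse (ennreal (2 ^ m)) * 1 \<le> inverse (ennreal (2 ^ m)) * (ennreal (2 ^ m) * (\<Sum>k. cover_cost m m (C k)))"
      using \<open>\<And>C. C \<in> covers m 1 (unit_cube m) \<Longrightarrow> 1 \<le> ennreal (2 ^ m) * (\<Sum>k. cover_cost m m (C k))\<close>[OF that]
      by (intro mult_left_mono) auto
    then show ?thesis by (simp add: mult.assoc[symmetric] inverse_ennreal ennreal_mult[symmetric])
  qed
  then have "inverse (ennreal (2 ^ m)) \<le> hausdorff_delta m m 1 (unit_cube m)"
    unfolding hausdorff_delta_covers by (rule INF_greatest)
  also have "\<dots> \<le> hausdorff m m (unit_cube m)" by (rule hausdorff_delta_le_hausdorff) simp
  finally show ?thesis by (rule less_le_trans[rotated]) (simp add: inverse_ennreal)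
qed

lemma Rn_iff_extensional: "x \<in> Rn n \<longleftrightarrow> x \<in> extensional {1..n}"
  by (simp add: Rn_def PiE_iff)

text \<open>Half-open cubes of side \<open>2\<^sup>-\<^sup>k\<close>, given by rounding so that they visibly partition the space.\<close>

definition dyadic_cube :: "nat \<Rightarrow> nat \<Rightarrow> (nat \<Rightarrow> int) \<Rightarrow> (nat \<Rightarrow> real) set" where
  "dyadic_cube n k z = {x\<in>Rn n. \<forall>i\<in>{1..n}. \<lfloor>2 ^ k * x i\<rfloor> = z i}"

definition cube_index :: "nat \<Rightarrow> (nat \<Rightarrow> int) set" where
  "cube_index n = (\<Pi>\<^sub>E i\<in>{1..n}. UNIV)"

lemma countable_cube_index: "countable (cube_index n)"
  unfolding cube_index_def by (intro countable_PiE) auto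

definition cube_of :: "nat \<Rightarrow> nat \<Rightarrow> (nat \<Rightarrow> real) \<Rightarrow> nat \<Rightarrow> int" where
  "cube_of n k x = (\<lambda>i\<in>{1..n}. \<lfloor>2 ^ k * x i\<rfloor>)"

lemma cube_of_index [simp]: "cube_of n k x \<in> cube_index n"
  by (auto simp: cube_of_def cube_index_def)

lemma in_dyadic_cube_iff: "z \<in> cube_index n \<Longrightarrow> x \<in> dyadic_cube n k z \<longleftrightarrow> x \<in> Rn n \<and> z = cube_of n k x"
  by (auto simp: dyadic_cube_def cube_of_def cube_index_def fun_eq_iff PiE_def extensional_def)

lemma Union_dyadic_cubes: "(\<Union>z\<in>cube_index n. dyadic_cube n k z) = Rn n"
  by (auto simp: in_dyadic_cube_iff)

lemma disjoint_dyadic_cubes: "disjoint_family_on (dyadic_cube n k) (cube_index n)"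
  by (auto simp: disjoint_family_on_def in_dyadic_cube_iff)

lemma dyadic_cube_eq_PiE:
  "dyadic_cube n k z = (\<Pi>\<^sub>E i\<in>{1..n}. {of_int (z i) / 2 ^ k ..< (of_int (z i) + 1) / 2 ^ k})"
proof -
  have "\<lfloor>2 ^ k * t\<rfloor> = j \<longleftrightarrow> t \<in> {of_int j / 2 ^ k ..< (of_int j + 1) / 2 ^ k}" for t :: real and j
    by (simp add: floor_eq_iff divide_le_eq less_divide_eq mult.commute)
  then show ?thesis by (auto simp: dyadic_cube_def Rn_iff_extensional PiE_iff extensional_def)
qed

lemma sets_dyadic_cube [measurable]: "dyadic_cube n k z \<in> sets (Rn_lebesgue n)"
  unfolding dyadic_cube_eq_PiE Rn_lebesgue_def by (auto intro!: sets_PiM_I_finite)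

lemma dyadic_cube_coordinate_dist:
  assumes "x \<in> dyadic_cube n k z" "y \<in> dyadic_cube n k z" "i \<in> {1..n}"
  shows "\<bar>x i - y i\<bar> < 1 / 2 ^ k"
proof -
  have "of_int (z i) / 2 ^ k \<le> x i" "x i < (of_int (z i) + 1) / 2 ^ k"
       "of_int (z i) / 2 ^ k \<le> y i" "y i < (of_int (z i) + 1) / 2 ^ k"
    using assms by (auto simp: dyadic_cube_eq_PiE PiE_iff)
  then show ?thesis by (simp add: add_divide_distrib abs_less_iff)
qed

text \<open>Rounding at the coarse scale is integer division of the rounding at the fine scale.\<close>

lemma dyadic_cube_nested:
  assumes "k \<le> l" "x \<in> dyadic_cube n k z" "x \<in> dyadic_cube n l w"
  shows "dyadic_cube n l w \<subseteq> dyadic_cube n k z"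
proof
  fix y assume y: "y \<in> dyadic_cube n l w"
  have fl: "\<lfloor>2 ^ k * u\<rfloor> = \<lfloor>2 ^ l * u\<rfloor> div 2 ^ (l - k)" for u :: real
  proof -
    have "2 ^ k * u = 2 ^ l * u / real_of_int (2 ^ (l - k))"
      using power_add[of "2::real" k "l - k"] assms(1) by simp
    then show ?thesis by (simp only: floor_divide_real_eq_div zero_le_power zero_le_numeral)
  qed
  show "y \<in> dyadic_cube n k z"
    using y assms(2,3) by (auto simp: dyadic_cube_def fl)
qed

text \<open>All scales together, with the empty set added for closure under intersection. Two dyadic cubes are
  nested or disjoint, which makes this a generator of the Borel sets on which measures can be compared.\<close>

definition dyadic_cubes :: "nat \<Rightarrow> (nat \<Rightarrow> real) set set" where
  "dyadic_cubes n = insert {} (\<Union>k. dyadic_cube n k ` cube_index n)"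

lemma Int_stable_dyadic_cubes: "Int_stable (dyadic_cubes n)"
proof (rule Int_stableI)
  have *: "dyadic_cube n k z \<inter> dyadic_cube n l w \<in> dyadic_cubes n"
    if "k \<le> l" "z \<in> cube_index n" "w \<in> cube_index n" for k l z w
  proof (cases "dyadic_cube n k z \<inter> dyadic_cube n l w = {}")
    case False
    then have "dyadic_cube n k z \<inter> dyadic_cube n l w = dyadic_cube n l w"
      using dyadic_cube_nested[OF that(1)] by blast
    then show ?thesis using that by (auto simp: dyadic_cubes_def)
  qed (simp add: dyadic_cubes_def)
  fix a b assume "a \<in> dyadic_cubes n" "b \<in> dyadic_cubes n"
  then consider "a = {}" | "b = {}" | k z l w where "a = dyadic_cube n k z" "b = dyadic_cube n l w"
      "z \<in> cube_index n" "w \<in> cube_index n"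
    unfolding dyadic_cubes_def by blast
  then show "a \<inter> b \<in> dyadic_cubes n"
  proof cases
    case 3
    then show ?thesis using *[of k l z w] *[of l k w z] by (cases "k \<le> l") (auto simp: Int_commute)
  qed (auto simp: dyadic_cubes_def)
qed

text \<open>An open half-space is the union of the dyadic cubes inside it, and there are only countably many.\<close>

lemma sets_Rn_lebesgue_dyadic: "sets (Rn_lebesgue n) = sigma_sets (Rn n) (dyadic_cubes n)"
proof
  have sub: "dyadic_cubes n \<subseteq> Pow (Rn n)" by (auto simp: dyadic_cubes_def dyadic_cube_def)
  have S: "sigma_algebra (Rn n) (sigma_sets (Rn n) (dyadic_cubes n))"
    by (rule sigma_algebra_sigma_sets[OF sub])
  interpret S: sigma_algebra "Rn n" "sigma_sets (Rn n) (dyadic_cubes n)" by (rule S)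
  show "sets (Rn_lebesgue n) \<subseteq> sigma_sets (Rn n) (dyadic_cubes n)"
  proof (rule sets_Rn_lebesgue_subset[OF S])
    fix i a assume i: "i \<in> {1..n}"
    let ?U = "{x\<in>Rn n. a < x i}"
    have "?U = \<Union>{D\<in>dyadic_cubes n. D \<subseteq> ?U}"
    proof (intro antisym subsetI)
      fix x assume x: "x \<in> ?U"
      then obtain k where k: "(1/2) ^ k < x i - a" using real_arch_pow_inv[of "x i - a" "1/2"] by auto
      let ?D = "dyadic_cube n k (cube_of n k x)"
      have xD: "x \<in> ?D" using x by (simp add: in_dyadic_cube_iff)
      have "?D \<subseteq> ?U"
      proof
        fix y assume y: "y \<in> ?D"
        have "\<bar>x i - y i\<bar> < 1 / 2 ^ k" by (rule dyadic_cube_coordinate_dist[OF xD y i])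
        then have "a < y i" using k by (simp add: power_one_over abs_less_iff)
        then show "y \<in> ?U" using y by (simp add: dyadic_cube_def)
      qed
      moreover have "?D \<in> dyadic_cubes n" unfolding dyadic_cubes_def using cube_of_index by blast
      ultimately show "x \<in> \<Union>{D\<in>dyadic_cubes n. D \<subseteq> ?U}" using xD by blast
    qed auto
    moreover have "countable {D\<in>dyadic_cubes n. D \<subseteq> ?U}"
      by (rule countable_subset[of _ "dyadic_cubes n"]) (auto simp: dyadic_cubes_def countable_cube_index)
    ultimately have "?U \<in> sigma_sets (Rn n) (dyadic_cubes n)"
      by (metis (no_types, lifting) S.countable_Union mem_Collect_eq sigma_sets.Basic subsetI)
    then have "Rn n - ?U \<in> sigma_sets (Rn n) (dyadic_cubes n)" by (rule S.compl_sets)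
    moreover have "Rn n - ?U = {x\<in>Rn n. x i \<le> a}" by auto
    ultimately show "{x\<in>Rn n. x i \<le> a} \<in> sigma_sets (Rn n) (dyadic_cubes n)" by simp
  qed
  show "sigma_sets (Rn n) (dyadic_cubes n) \<subseteq> sets (Rn_lebesgue n)"
  proof -
    have "dyadic_cubes n \<subseteq> sets (Rn_lebesgue n)" by (auto simp: dyadic_cubes_def)
    from sets.sigma_sets_subset[OF this] show ?thesis by simp
  qed
qed

text \<open>The half-open cube contains closed cubes of side \<open>s\<close> for all \<open>s < 1\<close>, whose measure is \<open>s\<^sup>n\<close> times that of the
  closed unit cube.\<close>

lemma hausdorff_half_open_unit_cube:
  "hausdorff n n (\<Pi>\<^sub>E i\<in>{1..n}. {0..<1}) = hausdorff n n (unit_cube n)"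
proof (rule antisym)
  let ?Q = "\<Pi>\<^sub>E i\<in>{1..n}. {0..<1::real}"
  show "hausdorff n n ?Q \<le> hausdorff n n (unit_cube n)"
    by (rule hausdorff_mono) (auto simp: unit_cube_def PiE_iff less_imp_le)
  have "(1 - 1 / real (Suc N)) ^ n * enn2real (hausdorff n n (unit_cube n)) \<le> enn2real (hausdorff n n ?Q)" if "N \<ge> 1" for N
  proof -
    let ?s = "1 - 1 / real (Suc N)"
    have s: "?s > 0" "?s < 1" using that by (auto simp: field_simps)
    have "ennreal (?s ^ n) * hausdorff n n (unit_cube n) = hausdorff n n (homothety n (\<lambda>_. 0) ?s ` unit_cube n)"
      using s by (intro hausdorff_homothety[symmetric]) (auto simp: unit_cube_def Rn_def)
    also have "\<dots> \<le> hausdorff n n ?Q"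
    proof (rule hausdorff_mono, rule image_subsetI)
      fix x assume x: "x \<in> unit_cube n"
      have "?s * x i < 1" if "i \<in> {1..n}" for i
      proof -
        have "?s * x i \<le> ?s * 1" using x that s by (intro mult_left_mono) (auto simp: unit_cube_def)
        also have "\<dots> < 1" using s(2) by simp
        finally show ?thesis .
      qed
      then show "homothety n (\<lambda>_. 0) ?s x \<in> ?Q" using x s unfolding homothety_def unit_cube_def
        by (auto simp: PiE_iff simp del: of_nat_Suc intro!: mult_nonneg_nonneg)
    qed
    finally have *: "ennreal (?s ^ n) * hausdorff n n (unit_cube n) \<le> hausdorff n n ?Q" .
    have fin: "hausdorff n n ?Q < top"
      by (rule le_less_trans[OF _ hausdorff_unit_cube_finite[of n]], rule hausdorff_mono) (auto simp: unit_cube_def PiE_iff less_imp_le)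
    have "enn2real (ennreal (?s ^ n) * hausdorff n n (unit_cube n)) \<le> enn2real (hausdorff n n ?Q)"
      by (rule enn2real_mono[OF * fin])
    then show ?thesis using s by (simp add: enn2real_mult del: of_nat_Suc)
  qed
  moreover have "(\<lambda>N. (1 - 1 / real (Suc N)) ^ n * enn2real (hausdorff n n (unit_cube n)))
      \<longlonglongrightarrow> (1 - 0) ^ n * enn2real (hausdorff n n (unit_cube n))"
    by (intro tendsto_intros LIMSEQ_Suc[OF lim_1_over_n])
  ultimately have "(1 - 0) ^ n * enn2real (hausdorff n n (unit_cube n)) \<le> enn2real (hausdorff n n ?Q)"
    by (intro LIMSEQ_le_const2) auto
  then have "ennreal (enn2real (hausdorff n n (unit_cube n))) \<le> ennreal (enn2real (hausdorff n n ?Q))"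
    by (intro ennreal_leI) simp
  also have "\<dots> \<le> hausdorff n n ?Q" by (metis ennreal_enn2real_if order_refl top_greatest)
  finally show "hausdorff n n (unit_cube n) \<le> hausdorff n n ?Q"
    using hausdorff_unit_cube_finite[of n] by (simp add: less_top)
qed

text \<open>Both sides scale by \<open>s\<^sup>n\<close> under homotheties and agree on the half-open unit cube, hence on every dyadic
  cube, hence on every Borel set.\<close>

lemma hausdorff_eq_lebesgue:
  assumes "A \<in> sets (Rn_lebesgue n)"
  shows "hausdorff n n A = hausdorff n n (unit_cube n) * emeasure (Rn_lebesgue n) A"
proof -
  let ?c = "hausdorff n n (unit_cube n)"
  let ?Q = "\<Pi>\<^sub>E i\<in>{1..n}. {0..<1::real}"
  have cube: "hausdorff n n (dyadic_cube n k z) = ?c * emeasure (Rn_lebesgue n) (dyadic_cube n k z)"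
    and fin: "hausdorff n n (dyadic_cube n k z) < top" for k z
  proof -
    have "dyadic_cube n k z = homothety n (\<lambda>i. of_int (z i) / 2 ^ k) (1 / 2 ^ k) ` ?Q"
    proof (intro antisym subsetI)
      fix x assume x: "x \<in> dyadic_cube n k z"
      let ?y = "\<lambda>i\<in>{1..n}. 2 ^ k * x i - of_int (z i)"
      have "of_int (z i) \<le> 2 ^ k * x i \<and> 2 ^ k * x i < of_int (z i) + 1" if "i \<in> {1..n}" for i
        using x that floor_eq_iff[of "2 ^ k * x i" "z i"] by (auto simp: dyadic_cube_def)
      then have "?y \<in> ?Q" by (auto simp: PiE_iff algebra_simps)
      moreover have "x = homothety n (\<lambda>i. of_int (z i) / 2 ^ k) (1 / 2 ^ k) ?y"
        using x by (auto simp: homothety_def dyadic_cube_def Rn_def fun_eq_iff PiE_def extensional_def field_simps)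
      ultimately show "x \<in> homothety n (\<lambda>i. of_int (z i) / 2 ^ k) (1 / 2 ^ k) ` ?Q" by blast
    next
      fix x assume "x \<in> homothety n (\<lambda>i. of_int (z i) / 2 ^ k) (1 / 2 ^ k) ` ?Q"
      then show "x \<in> dyadic_cube n k z"
        by (auto simp: homothety_def dyadic_cube_eq_PiE PiE_iff field_simps)
    qed
    moreover have "?Q \<subseteq> Rn n" by (auto simp: Rn_def)
    ultimately have "hausdorff n n (dyadic_cube n k z) = ennreal ((1 / 2 ^ k) ^ n) * ?c"
      by (simp add: hausdorff_homothety flip: hausdorff_half_open_unit_cube)
    moreover have "emeasure (Rn_lebesgue n) (dyadic_cube n k z) = (\<Prod>i=1..n. ennreal (1 / 2 ^ k))"
      unfolding dyadic_cube_eq_PiE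
      by (subst emeasure_Rn_lebesgue_PiE) (auto simp: add_divide_distrib divide_right_mono intro!: prod.cong)
    ultimately show "hausdorff n n (dyadic_cube n k z) = ?c * emeasure (Rn_lebesgue n) (dyadic_cube n k z)"
      "hausdorff n n (dyadic_cube n k z) < top"
      using hausdorff_unit_cube_finite[of n]
      by (auto simp: ennreal_power mult.commute ennreal_mult_less_top)
  qed
  have "hausdorff_measure n n = scale_measure ?c (Rn_lebesgue n)"
  proof (rule measure_eqI_generator_eq_countable[OF Int_stable_dyadic_cubes[of n]])
    show "dyadic_cubes n \<subseteq> Pow (Rn n)" by (auto simp: dyadic_cubes_def dyadic_cube_def)
    show "sets (hausdorff_measure n n) = sigma_sets (Rn n) (dyadic_cubes n)"
         "sets (scale_measure ?c (Rn_lebesgue n)) = sigma_sets (Rn n) (dyadic_cubes n)"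
      by (simp_all add: sets_Rn_lebesgue_dyadic)
    fix D assume "D \<in> dyadic_cubes n"
    then show "emeasure (hausdorff_measure n n) D = emeasure (scale_measure ?c (Rn_lebesgue n)) D"
      by (auto simp: dyadic_cubes_def emeasure_hausdorff_measure cube)
  next
    show "dyadic_cube n 0 ` cube_index n \<subseteq> dyadic_cubes n" by (auto simp: dyadic_cubes_def)
    show "\<Union> (dyadic_cube n 0 ` cube_index n) = Rn n" by (rule Union_dyadic_cubes)
    show "countable (dyadic_cube n 0 ` cube_index n)" by (intro countable_image countable_cube_index)
    fix D assume "D \<in> dyadic_cube n 0 ` cube_index n"
    then show "emeasure (hausdorff_measure n n) D \<noteq> \<infinity>"
      using fin by (auto simp: emeasure_hausdorff_measure less_top[symmetric] simp flip: top_ennreal.rep_eq)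
  qed
  then show ?thesis using assms by (metis emeasure_hausdorff_measure emeasure_scale_measure)
qed

section \<open>Isometries, dilations and reflections\<close>

lemma measurable_Rn_component [measurable (raw)]:
  "i \<in> {1..n} \<Longrightarrow> (\<lambda>x. x i) \<in> borel_measurable (Rn_lebesgue n)"
  unfolding Rn_lebesgue_def using measurable_component_singleton[of i "{1..n}" "\<lambda>_. lborel"] by simp

lemma measurable_Rn_restrict:
  assumes "\<And>i. i \<in> {1..n} \<Longrightarrow> f i \<in> borel_measurable M"
  shows "(\<lambda>x. \<lambda>i\<in>{1..n}. f i x) \<in> measurable M (Rn_lebesgue n)"
  unfolding Rn_lebesgue_def using assms by (intro measurable_restrict) simp

lemma sets_preimage_Rn:
  assumes "f \<in> measurable (Rn_lebesgue n) M" "A \<in> sets M"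
  shows "{x\<in>Rn n. f x \<in> A} \<in> sets (Rn_lebesgue n)"
  using measurable_sets[OF assms] by (simp add: vimage_def Int_def conj_commute)

text \<open>How Lebesgue measure changes under a map is read off from Hausdorff measure, for which it follows from
  the metric alone.\<close>

lemma emeasure_eq_of_hausdorff_eq:
  assumes "A \<in> sets (Rn_lebesgue n)" "B \<in> sets (Rn_lebesgue n)"
    and "hausdorff n n B = k * hausdorff n n A"
  shows "emeasure (Rn_lebesgue n) B = k * emeasure (Rn_lebesgue n) A"
proof -
  let ?c = "hausdorff n n (unit_cube n)"
  have "?c * emeasure (Rn_lebesgue n) B = ?c * (k * emeasure (Rn_lebesgue n) A)"
    using assms by (simp add: hausdorff_eq_lebesgue ac_simps)
  then show ?thesis
    using hausdorff_unit_cube_positive[of n] hausdorff_unit_cube_finite[of n]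
    by (auto simp: ennreal_mult_cancel_left)
qed

lemma emeasure_isometric_image:
  assumes "A \<in> sets (Rn_lebesgue n)" "f ` A \<in> sets (Rn_lebesgue n)"
    and "\<And>x y. x \<in> A \<Longrightarrow> y \<in> A \<Longrightarrow> Rn_dist n (f x) (f y) = Rn_dist n x y"
  shows "emeasure (Rn_lebesgue n) (f ` A) = emeasure (Rn_lebesgue n) A"
proof -
  have "A \<subseteq> Rn n" "f ` A \<subseteq> Rn n"
    using assms(1,2)[THEN sets.sets_into_space] by auto
  then have "hausdorff n n (f ` A) = 1 * hausdorff n n A"
    using hausdorff_isometric_image[of A n f n n] assms(3) by simp
  from emeasure_eq_of_hausdorff_eq[OF assms(1,2) this] show ?thesis by simp
qed

abbreviation dilate :: "nat \<Rightarrow> real \<Rightarrow> (nat \<Rightarrow> real) \<Rightarrow> nat \<Rightarrow> real" where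
  "dilate n \<equiv> homothety n (\<lambda>_. 0)"

lemma dilate_dilate: "dilate n s (dilate n t x) = dilate n (s * t) x"
  by (auto simp: homothety_def)

lemma dilate_one: "x \<in> Rn n \<Longrightarrow> dilate n 1 x = x"
  by (auto simp: homothety_def Rn_iff_extensional extensional_def fun_eq_iff)

lemma measurable_dilate [measurable]: "dilate n t \<in> measurable (Rn_lebesgue n) (Rn_lebesgue n)"
  unfolding homothety_def by (intro measurable_Rn_restrict) auto

lemma dilate_image_eq:
  assumes "t > 0" "A \<subseteq> Rn n"
  shows "dilate n t ` A = {x\<in>Rn n. dilate n (1 / t) x \<in> A}"
proof (intro antisym subsetI)
  fix x assume "x \<in> {x\<in>Rn n. dilate n (1 / t) x \<in> A}"
  moreover then have "x = dilate n t (dilate n (1 / t) x)"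
    using assms by (simp add: dilate_dilate dilate_one)
  ultimately show "x \<in> dilate n t ` A" by blast
next
  fix x assume "x \<in> dilate n t ` A"
  then obtain y where "y \<in> A" "x = dilate n t y" by auto
  then show "x \<in> {x\<in>Rn n. dilate n (1 / t) x \<in> A}"
    using assms by (simp add: dilate_dilate dilate_one subset_eq)
qed

lemma sets_dilate_image:
  "t > 0 \<Longrightarrow> A \<in> sets (Rn_lebesgue n) \<Longrightarrow> dilate n t ` A \<in> sets (Rn_lebesgue n)"
  using sets.sets_into_space[of A "Rn_lebesgue n"] sets_preimage_Rn[OF measurable_dilate, of A n "1 / t"]
  by (simp add: dilate_image_eq)

lemma emeasure_dilate_image:
  assumes "t > 0" "A \<in> sets (Rn_lebesgue n)"
  shows "emeasure (Rn_lebesgue n) (dilate n t ` A) = ennreal (t ^ n) * emeasure (Rn_lebesgue n) A"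
  using assms sets.sets_into_space[of A "Rn_lebesgue n"]
  by (intro emeasure_eq_of_hausdorff_eq sets_dilate_image hausdorff_homothety) auto

definition Rn_inner :: "nat \<Rightarrow> (nat \<Rightarrow> real) \<Rightarrow> (nat \<Rightarrow> real) \<Rightarrow> real" where
  "Rn_inner n x y = (\<Sum>i=1..n. x i * y i)"

lemma Rn_inner_commute: "Rn_inner n x y = Rn_inner n y x"
  by (simp add: Rn_inner_def mult.commute)

lemma Rn_inner_lincomb:
  "Rn_inner n w (\<lambda>i. a * x i + b * y i) = a * Rn_inner n w x + b * Rn_inner n w y"
  by (simp add: Rn_inner_def algebra_simps sum.distrib sum_distrib_left)

lemma Rn_inner_cong: "(\<And>i. i \<in> {1..n} \<Longrightarrow> x i = x' i) \<Longrightarrow> Rn_inner n w x = Rn_inner n w x'"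
  by (auto simp: Rn_inner_def)

lemma Rn_inner_dilate: "Rn_inner n w (dilate n t x) = t * Rn_inner n w x"
  by (auto simp: Rn_inner_def homothety_def sum_distrib_left intro!: sum.cong)

lemma measurable_Rn_inner [measurable]: "Rn_inner n w \<in> borel_measurable (Rn_lebesgue n)"
  unfolding Rn_inner_def by (intro borel_measurable_sum borel_measurable_times) auto

text \<open>The reflection in the hyperplane orthogonal to \<open>v\<close>. Since division by zero yields zero, it is the
  identity on \<open>Rn n\<close> when \<open>v\<close> vanishes on \<open>{1..n}\<close>.\<close>

definition reflect :: "nat \<Rightarrow> (nat \<Rightarrow> real) \<Rightarrow> (nat \<Rightarrow> real) \<Rightarrow> nat \<Rightarrow> real" where
  "reflect n v x = (\<lambda>i\<in>{1..n}. x i - 2 * Rn_inner n v x / Rn_inner n v v * v i)"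

lemma reflect_in_Rn [simp]: "reflect n v x \<in> Rn n"
  by (simp add: reflect_def Rn_def)

lemma measurable_reflect [measurable]: "reflect n v \<in> measurable (Rn_lebesgue n) (Rn_lebesgue n)"
  unfolding reflect_def by (intro measurable_Rn_restrict) measurable

lemma Rn_inner_reflect:
  "Rn_inner n w (reflect n v x) = Rn_inner n w x - 2 * Rn_inner n v x / Rn_inner n v v * Rn_inner n w v"
proof -
  have "Rn_inner n w (reflect n v x)
      = Rn_inner n w (\<lambda>i. 1 * x i + (- (2 * Rn_inner n v x / Rn_inner n v v)) * v i)"
    by (rule Rn_inner_cong) (simp add: reflect_def)
  then show ?thesis unfolding Rn_inner_lincomb by simp
qed

lemma Rn_inner_self_eq_0: "Rn_inner n v v = 0 \<Longrightarrow> Rn_inner n v x = 0"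
proof -
  assume "Rn_inner n v v = 0"
  then have "\<forall>i\<in>{1..n}. v i * v i = 0"
    unfolding Rn_inner_def by (subst (asm) sum_nonneg_eq_0_iff) auto
  then show ?thesis unfolding Rn_inner_def by (intro sum.neutral) auto
qed

lemma reflect_involution: "x \<in> Rn n \<Longrightarrow> reflect n v (reflect n v x) = x"
proof -
  assume x: "x \<in> Rn n"
  have "reflect n v (reflect n v x) i = x i" for i
  proof (cases "i \<in> {1..n}")
    case True
    have "Rn_inner n v (reflect n v x) = - Rn_inner n v x"
      using Rn_inner_self_eq_0[of n v x] unfolding Rn_inner_reflect by (cases "Rn_inner n v v = 0") auto
    then have "reflect n v (reflect n v x) i = reflect n v x i + 2 * Rn_inner n v x / Rn_inner n v v * v i"
      unfolding reflect_def[of n v "reflect n v x"] using True by simp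
    then show ?thesis using True by (simp add: reflect_def)
  next
    case False
    then show ?thesis using x reflect_in_Rn[of n v "reflect n v x"]
      by (simp add: Rn_iff_extensional extensional_def del: reflect_in_Rn)
  qed
  then show ?thesis by auto
qed

lemma Rn_dist_reflect: "Rn_dist n (reflect n v x) (reflect n v y) = Rn_dist n x y"
proof -
  define d where "d i = x i - y i" for i
  define k where "k = 2 * Rn_inner n v d / Rn_inner n v v"
  have vd: "Rn_inner n v d = Rn_inner n v x - Rn_inner n v y"
    using Rn_inner_lincomb[of n v 1 x "-1" y] by (simp add: d_def[abs_def])
  have "(\<Sum>i=1..n. (reflect n v x i - reflect n v y i)\<^sup>2) = (\<Sum>i=1..n. (d i - k * v i)\<^sup>2)"
    by (intro sum.cong) (auto simp: reflect_def d_def k_def vd diff_divide_distrib algebra_simps)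
  also have "\<dots> = (\<Sum>i=1..n. (d i)\<^sup>2) - 2 * k * Rn_inner n v d + k\<^sup>2 * Rn_inner n v v"
    by (simp add: Rn_inner_def power2_eq_square algebra_simps sum.distrib sum_subtractf sum_distrib_left)
  also have "k\<^sup>2 * Rn_inner n v v = 2 * k * Rn_inner n v d"
    by (cases "Rn_inner n v v = 0") (auto simp: k_def power2_eq_square)
  finally show ?thesis by (simp add: Rn_dist_def d_def[abs_def])
qed

lemma reflect_dilate: "reflect n v (dilate n t x) = dilate n t (reflect n v x)"
proof
  fix i
  show "reflect n v (dilate n t x) i = dilate n t (reflect n v x) i"
    unfolding reflect_def Rn_inner_dilate by (simp add: homothety_def algebra_simps)
qed

lemma reflect_image_eq: "A \<subseteq> Rn n \<Longrightarrow> reflect n v ` A = {x\<in>Rn n. reflect n v x \<in> A}"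
  by (force simp: reflect_involution image_iff subset_eq)

lemma emeasure_reflect_image:
  assumes "A \<in> sets (Rn_lebesgue n)"
  shows "emeasure (Rn_lebesgue n) {x\<in>Rn n. reflect n v x \<in> A} = emeasure (Rn_lebesgue n) A"
proof -
  have "A \<subseteq> Rn n" using sets.sets_into_space[OF assms] by simp
  then show ?thesis
    using emeasure_isometric_image[of A n "reflect n v"] assms
      sets_preimage_Rn[OF measurable_reflect assms, of v]
    by (simp add: reflect_image_eq Rn_dist_reflect)
qed

text \<open>The reflection that exchanges the unit vector \<open>u\<close> and the last basis vector. For \<open>u\<close> equal to that basis
  vector it is the identity, by the convention for \<open>reflect\<close>.\<close>

definition householder :: "nat \<Rightarrow> (nat \<Rightarrow> real) \<Rightarrow> (nat \<Rightarrow> real) \<Rightarrow> nat \<Rightarrow> real" where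
  "householder n u = reflect n (\<lambda>i. u i - (if i = n then 1 else 0))"

lemma Rn_inner_householder:
  assumes n: "n \<ge> 1" and u: "Rn_inner n u u = 1"
  shows "Rn_inner n u (householder n u x) = x n"
proof -
  let ?e = "\<lambda>i. if i = n then 1 else 0 :: real"
  let ?v = "\<lambda>i. u i - ?e i"
  have e: "Rn_inner n ?e x = x n" for x :: "nat \<Rightarrow> real"
    unfolding Rn_inner_def using n by (subst sum.cong[OF refl, of _ _ "\<lambda>i. if n = i then x i else 0"]) auto
  have v: "Rn_inner n w ?v = Rn_inner n w u - w n" for w
    using Rn_inner_lincomb[of n w 1 u "-1" ?e] e[of w] Rn_inner_commute[of n w ?e] by simp
  have v': "Rn_inner n ?v w = Rn_inner n u w - w n" for w
    using v[of w] by (simp add: Rn_inner_commute)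
  have uv: "Rn_inner n u ?v = 1 - u n" using v[of u] u by simp
  have vv: "Rn_inner n ?v ?v = 2 * (1 - u n)"
    using v[of ?v] v'[of u] u n by simp
  show ?thesis
  proof (cases "u n = 1")
    case True
    then have "Rn_inner n ?v x = 0" using vv Rn_inner_self_eq_0 by simp
    then show ?thesis unfolding householder_def Rn_inner_reflect using v'[of x] by simp
  next
    case False
    then show ?thesis unfolding householder_def Rn_inner_reflect vv uv v' by (simp add: field_simps)
  qed
qed

section \<open>Cones over flat bases and radial integration\<close>

definition cone_set :: "nat \<Rightarrow> (nat \<Rightarrow> real) set \<Rightarrow> bool" where
  "cone_set n C \<longleftrightarrow> C \<in> sets (Rn_lebesgue n) \<and> (\<forall>x\<in>C. \<forall>t>0. dilate n t x \<in> C)"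

lemma cone_setD:
  assumes "cone_set n C"
  shows "C \<in> sets (Rn_lebesgue n)" "C \<subseteq> Rn n" "x \<in> C \<Longrightarrow> t > 0 \<Longrightarrow> dilate n t x \<in> C"
  using assms sets.sets_into_space[of C "Rn_lebesgue n"] by (auto simp: cone_set_def)

lemma cone_set_dilate_iff:
  assumes "cone_set n C" "x \<in> Rn n" "t > 0"
  shows "dilate n t x \<in> C \<longleftrightarrow> x \<in> C"
  using cone_setD(3)[OF assms(1), of "dilate n t x" "1 / t"] cone_setD(3)[OF assms(1), of x t] assms
  by (auto simp: dilate_dilate dilate_one)

lemma Rn_fun_upd: "y \<in> Rn m \<Longrightarrow> y(Suc m := t) \<in> Rn (Suc m)"
  by (auto simp: Rn_iff_extensional extensional_def)

lemma Rn_dist_fun_upd: "Rn_dist (Suc m) (x(Suc m := t)) (y(Suc m := t)) = Rn_dist m x y"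
  by (simp add: Rn_dist_def)

lemma dilate_fun_upd: "(dilate m t y)(Suc m := t * s) = dilate (Suc m) t (y(Suc m := s))"
  by (rule ext) (auto simp: homothety_def)

lemma nn_integral_power_Icc:
  assumes "h > 0"
  shows "(\<integral>\<^sup>+t. ennreal ((t / h) ^ m) * indicator {0..h} t \<partial>lborel) = ennreal (h / real (Suc m))"
proof -
  have "(\<integral>\<^sup>+t. ennreal ((t / h) ^ m) * indicator {0..h} t \<partial>lborel)
      = ennreal (h / real (Suc m) * (h / h) ^ Suc m - h / real (Suc m) * (0 / h) ^ Suc m)"
  proof (rule nn_integral_FTC_Icc[of _ 0 h "\<lambda>t. h / real (Suc m) * (t / h) ^ Suc m"])
    fix t :: real
    show "((\<lambda>t. h / real (Suc m) * (t / h) ^ Suc m) has_real_derivative (t / h) ^ m) (at t)"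
      using assms by (auto intro!: derivative_eq_intros simp del: of_nat_Suc power_Suc)
  qed (use assms in auto)
  then show ?thesis using assms by simp
qed

lemma nn_integral_Rn_lebesgue_Suc:
  assumes [measurable]: "f \<in> borel_measurable (Rn_lebesgue (Suc m))"
  shows "(\<integral>\<^sup>+z. f z \<partial>Rn_lebesgue (Suc m)) = (\<integral>\<^sup>+t. (\<integral>\<^sup>+y. f (y(Suc m := t)) \<partial>Rn_lebesgue m) \<partial>lborel)"
proof -
  interpret product_sigma_finite "\<lambda>i::nat. lborel :: real measure" by standard
  have ins: "{1..Suc m} = insert (Suc m) {1..m}" by auto
  show ?thesis
    using assms unfolding Rn_lebesgue_def ins by (intro product_nn_integral_insert_rev) auto
qed

text \<open>The volume of a cone is its height times the area of its base divided by the dimension. Here the base is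
  the section by the hyperplane with normal vector \<open>N\<close> at distance \<open>h = 1 / |N|\<close> from the apex. A
  Householder reflection makes the hyperplane horizontal; the slice at height \<open>t\<close> is then the base shrunk by
  the factor \<open>t / h\<close>.\<close>

lemma hausdorff_cone_section:
  assumes C: "cone_set (Suc m) C" and m: "m \<ge> 1" and N: "Rn_inner (Suc m) N N > 0"
    and pos: "\<And>x. x \<in> C \<Longrightarrow> Rn_inner (Suc m) N x > 0"
  shows "hausdorff (Suc m) m {x\<in>C. Rn_inner (Suc m) N x = 1}
       = hausdorff m m (unit_cube m) * (ennreal (real (Suc m) * sqrt (Rn_inner (Suc m) N N))
          * emeasure (Rn_lebesgue (Suc m)) {x\<in>C. Rn_inner (Suc m) N x \<le> 1})"
proof -
  define n where "n = Suc m"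
  note C = C[folded n_def] and N = N[folded n_def] and pos = pos[folded n_def]
  note [measurable] = cone_setD(1)[OF C]
  define h where "h = 1 / sqrt (Rn_inner n N N)"
  have h: "h > 0" using N by (simp add: h_def)
  define u where "u i = h * N i" for i
  have uN: "Rn_inner n u x = h * Rn_inner n N x" for x
    by (simp add: Rn_inner_def u_def sum_distrib_left mult.assoc)
  have uu: "Rn_inner n u u = 1"
    using uN[of N] uN[of u] N by (simp add: h_def Rn_inner_commute[of n N u] power2_eq_square[symmetric])
  define P where "P = householder n u"
  have P_Rn: "P z \<in> Rn n" and PP: "z \<in> Rn n \<Longrightarrow> P (P z) = z"
    and Pm [measurable]: "P \<in> measurable (Rn_lebesgue n) (Rn_lebesgue n)"
    and Pd: "P (dilate n t z) = dilate n t (P z)" for z t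
    by (simp_all add: P_def householder_def reflect_involution reflect_dilate)
  have uP: "Rn_inner n u (P z) = z n" for z
    unfolding P_def using uu by (intro Rn_inner_householder) (auto simp: n_def)
  have NP: "Rn_inner n N (P z) = z n / h" for z
    using uP[of z] h by (simp add: uN field_simps)
  define B where "B = {y\<in>Rn m. P (y(n := h)) \<in> C}"
  have upd [measurable]: "(\<lambda>y. y(n := t)) \<in> measurable (Rn_lebesgue m) (Rn_lebesgue n)" for t
  proof -
    have "(\<lambda>y. \<lambda>i\<in>{1..n}. if i = n then t else y i) \<in> measurable (Rn_lebesgue m) (Rn_lebesgue n)"
    proof (rule measurable_Rn_restrict)
      fix i assume "i \<in> {1..n}"
      then show "(\<lambda>y. if i = n then t else y i) \<in> borel_measurable (Rn_lebesgue m)"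
        by (cases "i = n") (auto simp: n_def intro!: measurable_Rn_component)
    qed
    moreover have "y(n := t) = (\<lambda>i\<in>{1..n}. if i = n then t else y i)" if "y \<in> Rn m" for y
      using that by (auto simp: n_def Rn_iff_extensional extensional_def fun_eq_iff)
    ultimately show ?thesis by (subst measurable_cong) auto
  qed
  have Bs: "B \<in> sets (Rn_lebesgue m)"
    unfolding B_def by (rule sets_preimage_Rn[of "\<lambda>y. P (y(n := h))"]) measurable
  have sec: "{x\<in>C. Rn_inner n N x = 1} = (\<lambda>y. P (y(n := h))) ` B"
  proof (intro antisym subsetI)
    fix x assume x: "x \<in> {x\<in>C. Rn_inner n N x = 1}"
    then have xR: "x \<in> Rn n" using cone_setD(2)[OF C] by auto
    have "P x n = h" using uP[of "P x"] PP[OF xR] uN[of x] x by simp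
    then have "(restrict (P x) {1..m})(n := h) = P x"
      using P_Rn[of x] by (auto simp: Rn_iff_extensional extensional_def n_def fun_eq_iff le_Suc_eq)
    then have "restrict (P x) {1..m} \<in> B" "x = P ((restrict (P x) {1..m})(n := h))"
      using x PP[OF xR] by (auto simp: B_def Rn_def)
    then show "x \<in> (\<lambda>y. P (y(n := h))) ` B" by blast
  qed (use h in \<open>auto simp: B_def NP\<close>)
  have "hausdorff n m {x\<in>C. Rn_inner n N x = 1} = hausdorff m m B"
    unfolding sec
  proof (rule hausdorff_isometric_image)
    show "Rn_dist n (P (x(n := h))) (P (y(n := h))) = Rn_dist m x y" for x y
      unfolding P_def householder_def Rn_dist_reflect unfolding n_def by (rule Rn_dist_fun_upd)
  qed (auto simp: P_Rn B_def)
  also have "\<dots> = hausdorff m m (unit_cube m) * emeasure (Rn_lebesgue m) B"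
    by (rule hausdorff_eq_lebesgue[OF Bs])
  also have "emeasure (Rn_lebesgue m) B
      = ennreal (real n / h) * emeasure (Rn_lebesgue n) {x\<in>C. Rn_inner n N x \<le> 1}"
  proof -
    let ?D = "{x\<in>C. Rn_inner n N x \<le> 1}"
    let ?D' = "{z\<in>Rn n. P z \<in> ?D}"
    have Ds: "?D \<in> sets (Rn_lebesgue n)"
    proof -
      have "{x\<in>space (Rn_lebesgue n). Rn_inner n N x \<le> 1} \<in> sets (Rn_lebesgue n)" by measurable
      moreover have "?D = C \<inter> {x\<in>space (Rn_lebesgue n). Rn_inner n N x \<le> 1}" using cone_setD(2)[OF C] by auto
      ultimately show ?thesis using cone_setD(1)[OF C] by simp
    qed
    have D's [measurable]: "?D' \<in> sets (Rn_lebesgue n)" using Ds by (intro sets_preimage_Rn[OF Pm])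
    have "emeasure (Rn_lebesgue n) ?D = emeasure (Rn_lebesgue n) ?D'"
      unfolding P_def householder_def by (rule emeasure_reflect_image[OF Ds, symmetric])
    also have "\<dots> = (\<integral>\<^sup>+z. indicator ?D' z \<partial>Rn_lebesgue n)"
      using D's by (rule nn_integral_indicator[symmetric])
    also have "\<dots> = (\<integral>\<^sup>+t. (\<integral>\<^sup>+y. indicator ?D' (y(n := t)) \<partial>Rn_lebesgue m) \<partial>lborel)"
      using D's unfolding n_def by (intro nn_integral_Rn_lebesgue_Suc) simp
    also have "\<dots> = (\<integral>\<^sup>+t. (ennreal ((t / h) ^ m) * indicator {0..h} t) * emeasure (Rn_lebesgue m) B \<partial>lborel)"
    proof (rule nn_integral_cong)
      fix t :: real
      have "(\<integral>\<^sup>+y. indicator ?D' (y(n := t)) \<partial>Rn_lebesgue m)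
          = (\<integral>\<^sup>+y. indicator {y\<in>Rn m. y(n := t) \<in> ?D'} y \<partial>Rn_lebesgue m)"
        by (intro nn_integral_cong) (auto simp: indicator_def)
      also have "\<dots> = emeasure (Rn_lebesgue m) {y\<in>Rn m. y(n := t) \<in> ?D'}"
        by (intro nn_integral_indicator sets_preimage_Rn[OF upd D's])
      also have "\<dots> = (ennreal ((t / h) ^ m) * indicator {0..h} t) * emeasure (Rn_lebesgue m) B"
      proof -
        consider "t \<le> 0" | "0 < t" "t \<le> h" | "t > h" by linarith
        then show ?thesis
        proof cases
          case 1
          have e: "{y\<in>Rn m. y(n := t) \<in> ?D'} = {}"
          proof -
            have "P (y(n := t)) \<notin> C" for y
              using pos[of "P (y(n := t))"] 1 h by (auto simp: NP zero_less_divide_iff)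
            then show ?thesis by auto
          qed
          \<comment> \<open>At \<open>t = 0\<close> the slice is empty, in agreement with \<open>0 ^ m = 0\<close> for positive \<open>m\<close>.\<close>
          show ?thesis unfolding e using 1 m by (cases "t = 0") (auto simp: indicator_def)
        next
          case 2
          have "P (y(n := t)) \<in> C \<longleftrightarrow> P ((dilate m (h / t) y)(n := h)) \<in> C" if "y \<in> Rn m" for y
          proof -
            have "(dilate m (h / t) y)(n := h) = dilate n (h / t) (y(n := t))"
              using 2 dilate_fun_upd[of m "h / t" y t] by (simp add: n_def)
            then show ?thesis
              using cone_set_dilate_iff[OF C P_Rn, of "h / t" "y(n := t)"] 2 h by (simp add: Pd)
          qed
          then have "{y\<in>Rn m. y(n := t) \<in> ?D'} = {y\<in>Rn m. dilate m (1 / (t / h)) y \<in> B}"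
            using 2 h Rn_fun_upd[of _ m t, folded n_def] by (auto simp: B_def NP)
          also have "\<dots> = dilate m (t / h) ` B"
            using 2 h by (intro dilate_image_eq[symmetric]) (auto simp: B_def)
          finally show ?thesis using 2 h emeasure_dilate_image[OF _ Bs, of "t / h"] by simp
        next
          case 3
          then have e: "{y\<in>Rn m. y(n := t) \<in> ?D'} = {}" using h by (auto simp: NP)
          show ?thesis unfolding e using 3 by simp
        qed
      qed
      finally show "(\<integral>\<^sup>+y. indicator ?D' (y(n := t)) \<partial>Rn_lebesgue m)
          = (ennreal ((t / h) ^ m) * indicator {0..h} t) * emeasure (Rn_lebesgue m) B" .
    qed
    also have "\<dots> = ennreal (h / real n) * emeasure (Rn_lebesgue m) B"
      by (subst nn_integral_multc) (auto simp: nn_integral_power_Icc[OF h] n_def simp del: of_nat_Suc)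
    finally have "ennreal (real n / h) * emeasure (Rn_lebesgue n) ?D
        = (ennreal (real n / h) * ennreal (h / real n)) * emeasure (Rn_lebesgue m) B"
      by (simp add: mult.assoc)
    also have "ennreal (real n / h) * ennreal (h / real n) = 1"
      using h by (simp add: ennreal_mult[symmetric] n_def del: of_nat_Suc)
    finally show ?thesis by simp
  qed
  also have "real n / h = real n * sqrt (Rn_inner n N N)" by (simp add: h_def)
  finally show ?thesis unfolding n_def .
qed

text \<open>By homogeneity the part of the cone with \<open>g \<le> t\<close> has volume \<open>t\<^sup>n V\<close>, where \<open>V\<close> is its volume for \<open>t = 1\<close>. So \<open>g\<close>
  pushes Lebesgue measure on the cone forward to the measure with density \<open>n t\<^sup>n\<^sup>-\<^sup>1 V\<close>.\<close>

lemma nn_integral_cone_radial: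
  assumes C: "cone_set n C" and n: "n \<ge> 1"
    and g [measurable]: "g \<in> borel_measurable (Rn_lebesgue n)"
    and hom: "\<And>x t. x \<in> Rn n \<Longrightarrow> t > 0 \<Longrightarrow> g (dilate n t x) = t * g x"
    and pos: "\<And>x. x \<in> C \<Longrightarrow> g x > 0"
    and fin: "emeasure (Rn_lebesgue n) {x\<in>C. g x \<le> 1} < top"
    and \<phi> [measurable]: "\<phi> \<in> borel_measurable borel"
  shows "(\<integral>\<^sup>+x. indicator C x * \<phi> (g x) \<partial>Rn_lebesgue n)
       = emeasure (Rn_lebesgue n) {x\<in>C. g x \<le> 1}
          * (\<integral>\<^sup>+t. ennreal (real n * t ^ (n - 1)) * indicator {0..} t * \<phi> t \<partial>lborel)"
proof -
  note [measurable] = cone_setD(1)[OF C]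
  let ?V = "emeasure (Rn_lebesgue n) {x\<in>C. g x \<le> 1}"
  define M1 where "M1 = distr (density (Rn_lebesgue n) (indicator C)) borel g"
  define M2 where "M2 = density lborel (\<lambda>t. ?V * (ennreal (real n * t ^ (n - 1)) * indicator {0..} t))"
  have le_set: "{x\<in>C. g x \<le> t} \<in> sets (Rn_lebesgue n)" for t
  proof -
    have "{x\<in>space (Rn_lebesgue n). g x \<le> t} \<in> sets (Rn_lebesgue n)" by measurable
    moreover have "{x\<in>C. g x \<le> t} = C \<inter> {x\<in>space (Rn_lebesgue n). g x \<le> t}" using cone_setD(2)[OF C] by auto
    ultimately show ?thesis using cone_setD(1)[OF C] by simp
  qed
  have e1: "emeasure M1 {..t} = (if t > 0 then ennreal (t ^ n) * ?V else 0)" for t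
  proof -
    have "emeasure M1 {..t} = (\<integral>\<^sup>+x. indicator C x * indicator (g -` {..t} \<inter> space (Rn_lebesgue n)) x \<partial>Rn_lebesgue n)"
      unfolding M1_def
      by (subst emeasure_distr) (auto intro!: emeasure_density measurable_sets[OF g] simp flip: space_Rn_lebesgue)
    also have "\<dots> = (\<integral>\<^sup>+x. indicator {x\<in>C. g x \<le> t} x \<partial>Rn_lebesgue n)"
      by (intro nn_integral_cong) (auto simp: indicator_def)
    also have "\<dots> = emeasure (Rn_lebesgue n) {x\<in>C. g x \<le> t}" by (intro nn_integral_indicator le_set)
    also have "\<dots> = (if t > 0 then ennreal (t ^ n) * ?V else 0)"
    proof (cases "t > 0")
      case True
      have "{x\<in>C. g x \<le> t} = dilate n t ` {x\<in>C. g x \<le> 1}"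
        using True cone_setD(2)[OF C] cone_set_dilate_iff[OF C, of _ "1 / t"] hom
        by (subst dilate_image_eq) (auto simp: subset_eq)
      then show ?thesis using True emeasure_dilate_image[OF True le_set] by simp
    next
      case False
      then have e: "{x\<in>C. g x \<le> t} = {}" using pos by force
      show ?thesis unfolding e using False by simp
    qed
    finally show ?thesis .
  qed
  have e2: "emeasure M2 {..t} = (if t > 0 then ennreal (t ^ n) * ?V else 0)" for t
  proof -
    have "emeasure M2 {..t} = (\<integral>\<^sup>+s. ?V * (ennreal (real n * s ^ (n - 1)) * indicator {0..t} s) \<partial>lborel)"
      unfolding M2_def by (subst emeasure_density) (auto intro!: nn_integral_cong simp: indicator_def)
    also have "\<dots> = ?V * (\<integral>\<^sup>+s. ennreal (real n * s ^ (n - 1)) * indicator {0..t} s \<partial>lborel)"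
      by (intro nn_integral_cmult) measurable
    also have "(\<integral>\<^sup>+s. ennreal (real n * s ^ (n - 1)) * indicator {0..t} s \<partial>lborel) = (if t > 0 then ennreal (t ^ n) else 0)"
    proof (cases "t \<ge> 0")
      case True
      have "(\<integral>\<^sup>+s. ennreal (real n * s ^ (n - 1)) * indicator {0..t} s \<partial>lborel) = ennreal (t ^ n - 0 ^ n)"
      proof (rule nn_integral_FTC_Icc)
        fix s
        show "((\<lambda>s. s ^ n) has_real_derivative real n * s ^ (n - 1)) (at s)"
          by (auto intro!: derivative_eq_intros)
      qed (use True in auto)
      then show ?thesis using True n by (auto simp: zero_power)
    qed auto
    finally show ?thesis by (simp add: mult.commute)
  qed
  have "M1 = M2"
  proof (rule measure_eqI_generator_eq[where E="range atMost" and \<Omega>=UNIV and A="\<lambda>i. {..real i}"])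
    show "Int_stable (range atMost :: real set set)" by (auto simp: Int_stable_def)
    have "sets (borel :: real measure) = sigma_sets UNIV (range atMost)"
      by (subst borel_eq_atMost) (simp add: sets_measure_of)
    then show "sets M1 = sigma_sets UNIV (range atMost)" "sets M2 = sigma_sets UNIV (range atMost)"
      by (simp_all add: M1_def M2_def)
    show "(\<Union>i. {..real i}) = UNIV" by (auto intro: real_arch_simple)
    show "emeasure M1 {..real i} \<noteq> \<infinity>" for i
      using fin by (auto simp: e1 ennreal_mult_eq_top_iff)
  qed (auto simp: e1 e2)
  have "(\<integral>\<^sup>+x. indicator C x * \<phi> (g x) \<partial>Rn_lebesgue n) = (\<integral>\<^sup>+t. \<phi> t \<partial>M1)"
    unfolding M1_def by (simp add: nn_integral_distr nn_integral_density)
  also have "\<dots> = (\<integral>\<^sup>+t. ?V * (ennreal (real n * t ^ (n - 1)) * indicator {0..} t) * \<phi> t \<partial>lborel)"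
    unfolding \<open>M1 = M2\<close> M2_def by (subst nn_integral_density) auto
  also have "\<dots> = ?V * (\<integral>\<^sup>+t. ennreal (real n * t ^ (n - 1)) * indicator {0..} t * \<phi> t \<partial>lborel)"
    by (subst nn_integral_cmult[symmetric]) (auto simp: mult.assoc)
  finally show ?thesis .
qed

section \<open>The ellipsoid and its tangent hyperplanes\<close>

lemma L2_set_scale: "L2_set (\<lambda>i. c * f i) A = \<bar>c\<bar> * L2_set f A"
  by (simp add: L2_set_def power_mult_distrib sum_distrib_left[symmetric] real_sqrt_mult)

lemma L2_set_triangle_diff: "\<bar>L2_set f A - L2_set g A\<bar> \<le> L2_set (\<lambda>i. f i - g i) A"
  using L2_set_triangle_ineq[of "\<lambda>i. f i - g i" g A] L2_set_triangle_ineq[of "\<lambda>i. g i - f i" f A]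
  by (simp add: L2_set_def power2_commute abs_le_iff)

lemma L2_set_abs_mono: "(\<And>i. i \<in> A \<Longrightarrow> \<bar>f i\<bar> \<le> \<bar>g i\<bar>) \<Longrightarrow> L2_set f A \<le> L2_set g A"
  unfolding L2_set_def by (intro real_sqrt_le_mono sum_mono) (simp add: abs_le_square_iff)

lemma measurable_L2_set_Rn [measurable]:
  "(\<lambda>x. L2_set (\<lambda>i. a i * x i) {1..n}) \<in> borel_measurable (Rn_lebesgue n)"
  unfolding L2_set_def
  by (intro borel_measurable_sqrt[THEN measurable_compose[rotated]] borel_measurable_sum borel_measurable_power
      borel_measurable_times measurable_Rn_component) auto

text \<open>The dimension \<open>m\<close> of the boundary is a parameter of its own, so that facts about \<open>Suc m\<close> apply without
  subtraction.\<close>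

locale ellipsoid_axes =
  fixes q :: "nat \<Rightarrow> real" and n m :: nat
  assumes q_pos: "i \<in> {1..n} \<Longrightarrow> q i > 0" and n_Suc: "n = Suc m" and m_pos: "m \<ge> 1"
begin

text \<open>The norm whose unit ball is the ellipsoid.\<close>

definition gauge :: "(nat \<Rightarrow> real) \<Rightarrow> real" where
  "gauge x = L2_set (\<lambda>i. q i * x i) {1..n}"

text \<open>The length of the normal vector \<open>normal x\<close> below (see \<open>normal_norm\<close>).\<close>

definition normal_length :: "(nat \<Rightarrow> real) \<Rightarrow> real" where
  "normal_length x = L2_set (\<lambda>i. (q i)\<^sup>2 * x i) {1..n}"

definition qmax :: real where "qmax = Max (q ` {1..n})"
definition qmin :: real where "qmin = Min (q ` {1..n})"

definition boundary :: "(nat \<Rightarrow> real) set" where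
  "boundary = {x\<in>Rn n. gauge x = 1}"

lemma n_pos: "n \<ge> 1" by (simp add: n_Suc)

lemma q_le_qmax: "i \<in> {1..n} \<Longrightarrow> q i \<le> qmax"
  unfolding qmax_def by (intro Max_ge) auto

lemma qmin_le_q: "i \<in> {1..n} \<Longrightarrow> qmin \<le> q i"
  unfolding qmin_def by (intro Min_le) auto

lemma qmin_pos: "qmin > 0"
  unfolding qmin_def using n_pos q_pos by (subst Min_gr_iff) auto

lemma qmin_le_qmax: "qmin \<le> qmax"
  using qmin_le_q[of 1] q_le_qmax[of 1] n_pos by simp

lemma qmax_pos: "qmax > 0" using qmin_pos qmin_le_qmax by simp

lemma gauge_nonneg [simp]: "gauge x \<ge> 0" by (simp add: gauge_def)
lemma normal_length_nonneg [simp]: "normal_length x \<ge> 0" by (simp add: normal_length_def)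

lemma measurable_gauge [measurable]: "gauge \<in> borel_measurable (Rn_lebesgue n)"
  unfolding gauge_def[abs_def] by measurable

lemma measurable_normal_length [measurable]: "normal_length \<in> borel_measurable (Rn_lebesgue n)"
  unfolding normal_length_def[abs_def] by measurable

lemma gauge_dilate: "t > 0 \<Longrightarrow> gauge (dilate n t x) = t * gauge x"
proof -
  assume "t > 0"
  have "gauge (dilate n t x) = L2_set (\<lambda>i. t * (q i * x i)) {1..n}"
    unfolding gauge_def by (intro L2_set_cong) (auto simp: homothety_def)
  then show ?thesis using \<open>t > 0\<close> by (simp add: L2_set_scale gauge_def)
qed

lemma normal_length_dilate: "t > 0 \<Longrightarrow> normal_length (dilate n t x) = t * normal_length x"
proof -
  assume "t > 0"
  have "normal_length (dilate n t x) = L2_set (\<lambda>i. t * ((q i)\<^sup>2 * x i)) {1..n}"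
    unfolding normal_length_def by (intro L2_set_cong) (auto simp: homothety_def)
  then show ?thesis using \<open>t > 0\<close> by (simp add: L2_set_scale normal_length_def)
qed

lemma normal_length_le: "normal_length x \<le> qmax * gauge x"
proof -
  have "normal_length x \<le> L2_set (\<lambda>i. qmax * (q i * x i)) {1..n}"
    unfolding normal_length_def
  proof (rule L2_set_abs_mono)
    fix i assume i: "i \<in> {1..n}"
    have "q i * \<bar>q i * x i\<bar> \<le> qmax * \<bar>q i * x i\<bar>" by (intro mult_right_mono q_le_qmax i) auto
    then show "\<bar>(q i)\<^sup>2 * x i\<bar> \<le> \<bar>qmax * (q i * x i)\<bar>"
      using q_pos[OF i] qmax_pos by (simp add: abs_mult power2_eq_square mult.assoc)
  qed
  then show ?thesis using qmax_pos by (simp add: L2_set_scale gauge_def)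
qed

lemma normal_length_ge: "qmin * gauge x \<le> normal_length x"
proof -
  have "L2_set (\<lambda>i. qmin * (q i * x i)) {1..n} \<le> normal_length x"
    unfolding normal_length_def
  proof (rule L2_set_abs_mono)
    fix i assume i: "i \<in> {1..n}"
    have "qmin * \<bar>q i * x i\<bar> \<le> q i * \<bar>q i * x i\<bar>" by (intro mult_right_mono qmin_le_q i) auto
    then show "\<bar>qmin * (q i * x i)\<bar> \<le> \<bar>(q i)\<^sup>2 * x i\<bar>"
      using q_pos[OF i] qmin_pos by (simp add: abs_mult power2_eq_square mult.assoc)
  qed
  then show ?thesis using qmin_pos by (simp add: L2_set_scale gauge_def)
qed

lemma gauge_diff_le: "gauge (\<lambda>i. x i - y i) \<le> qmax * Rn_dist n x y"
proof -
  have "gauge (\<lambda>i. x i - y i) \<le> L2_set (\<lambda>i. qmax * (x i - y i)) {1..n}"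
    unfolding gauge_def
  proof (rule L2_set_abs_mono)
    fix i assume i: "i \<in> {1..n}"
    show "\<bar>q i * (x i - y i)\<bar> \<le> \<bar>qmax * (x i - y i)\<bar>"
      using q_pos[OF i] q_le_qmax[OF i] by (simp add: abs_mult mult_right_mono)
  qed
  then show ?thesis using qmax_pos by (simp add: L2_set_scale Rn_dist_L2_set)
qed

lemma norm_le_gauge: "qmin * L2_set x {1..n} \<le> gauge x"
proof -
  have "L2_set (\<lambda>i. qmin * x i) {1..n} \<le> gauge x"
    unfolding gauge_def
  proof (rule L2_set_abs_mono)
    fix i assume i: "i \<in> {1..n}"
    show "\<bar>qmin * x i\<bar> \<le> \<bar>q i * x i\<bar>"
      using q_pos[OF i] qmin_le_q[OF i] qmin_pos by (simp add: abs_mult mult_right_mono)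
  qed
  then show ?thesis using qmin_pos by (simp add: L2_set_scale)
qed

text \<open>For \<open>x0\<close> on the boundary, the tangent hyperplane at \<open>x0\<close> consists of the points whose inner product with
  this vector is 1.\<close>

definition normal :: "(nat \<Rightarrow> real) \<Rightarrow> nat \<Rightarrow> real" where
  "normal x0 i = (q i)\<^sup>2 * x0 i"

lemma normal_norm: "sqrt (Rn_inner n (normal x0) (normal x0)) = normal_length x0"
  by (simp add: Rn_inner_def normal_def normal_length_def L2_set_def power2_eq_square)

text \<open>Polarization for the inner product that induces \<open>gauge\<close>: near \<open>x0\<close> the boundary deviates from its
  tangent hyperplane only to second order.\<close>

lemma normal_inner:
  assumes "gauge x0 = 1" "gauge x = 1"
  shows "Rn_inner n (normal x0) x = 1 - (gauge (\<lambda>i. x i - x0 i))\<^sup>2 / 2"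
proof -
  have sq: "(gauge y)\<^sup>2 = (\<Sum>i=1..n. (q i * y i)\<^sup>2)" for y
    unfolding gauge_def L2_set_def by (intro real_sqrt_pow2 sum_nonneg) auto
  have "(gauge (\<lambda>i. x i - x0 i))\<^sup>2 = (\<Sum>i=1..n. (q i * x i)\<^sup>2 - 2 * (normal x0 i * x i) + (q i * x0 i)\<^sup>2)"
    unfolding sq by (intro sum.cong) (auto simp: normal_def power2_eq_square algebra_simps)
  also have "\<dots> = (gauge x)\<^sup>2 - 2 * Rn_inner n (normal x0) x + (gauge x0)\<^sup>2"
    by (simp add: sq Rn_inner_def sum.distrib sum_subtractf sum_distrib_left)
  finally show ?thesis using assms by (simp add: field_simps)
qed

text \<open>The projection sends \<open>x\<close> to \<open>x / b x\<close>. Near \<open>x0\<close> the factor \<open>1 / b\<close> is within \<open>2 \<delta>\<close> of 1, and it is itself Lipschitz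
  with constant of order \<open>\<delta>\<close>, because \<open>b\<close> is 1 minus half the square of a function that is at most \<open>\<delta>\<close>. Both effects
  perturb distances by a relative error of order \<open>\<delta>\<close>.\<close>

lemma central_projection_bilipschitz:
  assumes x0: "gauge x0 = 1" and x: "gauge x = 1" and y: "gauge y = 1"
    and dx: "gauge (\<lambda>i. x i - x0 i) \<le> \<delta>" and dy: "gauge (\<lambda>i. y i - x0 i) \<le> \<delta>" and \<delta>: "\<delta> \<le> 1/2"
  defines "b \<equiv> Rn_inner n (normal x0)"
  shows "\<bar>Rn_dist n (dilate n (1 / b x) x) (dilate n (1 / b y) y) - Rn_dist n x y\<bar>
       \<le> ((2 + 4 * qmax / qmin) * \<delta>) * Rn_dist n x y"
proof -
  let ?D = "Rn_dist n x y"
  have \<delta>0: "0 \<le> \<delta>" using gauge_nonneg dx order_trans by blast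
  have b_bounds: "1 - \<delta> \<le> b u" "b u \<le> 1" if "gauge u = 1" "gauge (\<lambda>i. u i - x0 i) \<le> \<delta>" for u
  proof -
    have "(gauge (\<lambda>i. u i - x0 i))\<^sup>2 \<le> \<delta> * 1"
      unfolding power2_eq_square using that(2) \<delta> \<delta>0 by (intro mult_mono) auto
    then have "(gauge (\<lambda>i. u i - x0 i))\<^sup>2 / 2 \<le> \<delta>" using \<delta>0 by linarith
    then show "1 - \<delta> \<le> b u" "b u \<le> 1" unfolding b_def normal_inner[OF x0 that(1)] by auto
  qed
  have bx: "1 - \<delta> \<le> b x" "b x \<le> 1" and by': "1 - \<delta> \<le> b y" "b y \<le> 1"
    using b_bounds x y dx dy by auto
  have bpos: "b x \<ge> 1/2" "b y \<ge> 1/2" using bx by' \<delta> by auto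
  have "b x - b y = ((gauge (\<lambda>i. y i - x0 i))\<^sup>2 - (gauge (\<lambda>i. x i - x0 i))\<^sup>2) / 2"
    unfolding b_def by (simp add: normal_inner x0 x y diff_divide_distrib)
  also have "\<dots> = (gauge (\<lambda>i. y i - x0 i) - gauge (\<lambda>i. x i - x0 i))
      * (gauge (\<lambda>i. y i - x0 i) + gauge (\<lambda>i. x i - x0 i)) / 2"
    by (simp add: power2_eq_square algebra_simps)
  finally have "\<bar>b x - b y\<bar> = \<bar>gauge (\<lambda>i. y i - x0 i) - gauge (\<lambda>i. x i - x0 i)\<bar>
      * (gauge (\<lambda>i. y i - x0 i) + gauge (\<lambda>i. x i - x0 i)) / 2"
    by (simp only: abs_mult abs_divide) (simp add: abs_of_nonneg)
  also have "\<dots> \<le> (qmax * ?D) * (2 * \<delta>) / 2"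
  proof (intro divide_right_mono mult_mono)
    have "\<bar>gauge (\<lambda>i. y i - x0 i) - gauge (\<lambda>i. x i - x0 i)\<bar> \<le> gauge (\<lambda>i. x i - y i)"
      using L2_set_triangle_diff[of "\<lambda>i. q i * (x i - x0 i)" "{1..n}" "\<lambda>i. q i * (y i - x0 i)"]
      by (simp add: gauge_def abs_minus_commute algebra_simps)
    also have "\<dots> \<le> qmax * ?D" by (rule gauge_diff_le)
    finally show "\<bar>gauge (\<lambda>i. y i - x0 i) - gauge (\<lambda>i. x i - x0 i)\<bar> \<le> qmax * ?D" .
  qed (use dx dy qmax_pos in auto)
  finally have bdiff: "\<bar>b x - b y\<bar> \<le> qmax * \<delta> * ?D" by (simp add: mult_ac)
  have sdiff: "\<bar>1 / b x - 1 / b y\<bar> \<le> 4 * qmax * \<delta> * ?D"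
  proof -
    have "1 / b x - 1 / b y = (b y - b x) * (1 / b x * (1 / b y))" using bpos by (simp add: field_simps)
    then have "\<bar>1 / b x - 1 / b y\<bar> = \<bar>b x - b y\<bar> * (1 / b x * (1 / b y))"
      using bpos by (simp add: abs_mult abs_minus_commute)
    also have "\<dots> \<le> (qmax * \<delta> * ?D) * (2 * 2)"
      using bdiff bpos by (intro mult_mono) (auto simp: divide_le_eq)
    finally show ?thesis by simp
  qed
  have sx: "\<bar>1 / b x - 1\<bar> \<le> 2 * \<delta>"
  proof -
    have "1 / b x - 1 = (1 - b x) * (1 / b x)" using bpos by (simp add: field_simps)
    also have "\<dots> \<le> \<delta> * 2" using bx bpos by (intro mult_mono) (auto simp: divide_le_eq)
    finally show ?thesis using bx bpos by (simp add: abs_if field_simps)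
  qed
  have ny: "L2_set y {1..n} \<le> 1 / qmin" using norm_le_gauge[of y] y qmin_pos by (simp add: field_simps)
  define e where "e i = (1 - 1 / b x) * (x i - y i) + (1 / b y - 1 / b x) * y i" for i
  have "Rn_dist n (dilate n (1 / b x) x) (dilate n (1 / b y) y) = L2_set (\<lambda>i. (x i - y i) - e i) {1..n}"
    unfolding Rn_dist_L2_set e_def by (intro L2_set_cong) (auto simp: homothety_def algebra_simps)
  then have "\<bar>Rn_dist n (dilate n (1 / b x) x) (dilate n (1 / b y) y) - ?D\<bar> \<le> L2_set e {1..n}"
    using L2_set_triangle_diff[of "\<lambda>i. (x i - y i) - e i" "{1..n}" "\<lambda>i. x i - y i"]
    by (simp add: Rn_dist_L2_set) (simp add: L2_set_def)
  also have "\<dots> \<le> \<bar>1 - 1 / b x\<bar> * ?D + \<bar>1 / b y - 1 / b x\<bar> * L2_set y {1..n}"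
    unfolding e_def[abs_def] by (rule order_trans[OF L2_set_triangle_ineq]) (simp add: L2_set_scale Rn_dist_L2_set)
  also have "\<dots> \<le> (2 * \<delta>) * ?D + (4 * qmax * \<delta> * ?D) * (1 / qmin)"
    using sx sdiff ny \<delta>0 qmax_pos by (intro add_mono mult_mono mult_right_mono) (auto simp: abs_minus_commute)
  also have "\<dots> = ((2 + 4 * qmax / qmin) * \<delta>) * ?D" by (simp add: algebra_simps)
  finally show ?thesis .
qed

end

section \<open>Surface area as a Gaussian integral\<close>

definition gauss_moment :: "nat \<Rightarrow> ennreal" where
  "gauss_moment k = (\<integral>\<^sup>+t. ennreal (t ^ k * exp (- t\<^sup>2)) * indicator {0..} t \<partial>lborel)"

context ellipsoid_axes
begin

text \<open>The open cone over the part of the boundary that lies in \<open>Q\<close>.\<close>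

definition radial_cone :: "(nat \<Rightarrow> real) set \<Rightarrow> (nat \<Rightarrow> real) set" where
  "radial_cone Q = {x\<in>Rn n. 0 < gauge x \<and> dilate n (1 / gauge x) x \<in> Q}"

lemma cone_set_radial_cone:
  assumes "Q \<in> sets (Rn_lebesgue n)"
  shows "cone_set n (radial_cone Q)"
  unfolding cone_set_def
proof (intro conjI ballI allI impI)
  have r: "(\<lambda>x. dilate n (1 / gauge x) x) \<in> measurable (Rn_lebesgue n) (Rn_lebesgue n)"
    unfolding homothety_def by (intro measurable_Rn_restrict) measurable
  have "{x\<in>space (Rn_lebesgue n). 0 < gauge x} \<in> sets (Rn_lebesgue n)" by measurable
  then have "{x\<in>space (Rn_lebesgue n). 0 < gauge x} \<inter> {x\<in>Rn n. dilate n (1 / gauge x) x \<in> Q} \<in> sets (Rn_lebesgue n)"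
    using sets_preimage_Rn[OF r assms] by auto
  moreover have "{x\<in>space (Rn_lebesgue n). 0 < gauge x} \<inter> {x\<in>Rn n. dilate n (1 / gauge x) x \<in> Q} = radial_cone Q"
    by (auto simp: radial_cone_def)
  ultimately show "radial_cone Q \<in> sets (Rn_lebesgue n)" by simp
  fix x t assume "x \<in> radial_cone Q" "0 < (t::real)"
  then show "dilate n t x \<in> radial_cone Q"
    by (simp add: radial_cone_def gauge_dilate dilate_dilate)
qed

lemma emeasure_gauge_ball_finite: "emeasure (Rn_lebesgue n) {x\<in>Rn n. gauge x \<le> 1} < top"
proof -
  let ?B = "\<Pi>\<^sub>E i\<in>{1..n}. {- 1 / qmin .. 1 / qmin}"
  have "{x\<in>Rn n. gauge x \<le> 1} \<subseteq> ?B"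
  proof
    fix x assume x: "x \<in> {x\<in>Rn n. gauge x \<le> 1}"
    have "\<bar>x i\<bar> \<le> 1 / qmin" if i: "i \<in> {1..n}" for i
    proof -
      have "\<bar>x i\<bar> \<le> L2_set (\<lambda>i. \<bar>x i\<bar>) {1..n}" by (rule member_le_L2_set) (use i in auto)
      also have "\<dots> = L2_set x {1..n}" by (simp add: L2_set_def)
      also have "\<dots> \<le> 1 / qmin" using norm_le_gauge[of x] x qmin_pos by (simp add: field_simps)
      finally show ?thesis .
    qed
    then show "x \<in> ?B" using x by (auto simp: Rn_iff_extensional PiE_iff abs_le_iff minus_le_iff)
  qed
  then have "emeasure (Rn_lebesgue n) {x\<in>Rn n. gauge x \<le> 1} \<le> emeasure (Rn_lebesgue n) ?B"
    by (intro emeasure_mono) (auto simp: Rn_lebesgue_def intro!: sets_PiM_I_finite)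
  also have "\<dots> = ennreal (1 / qmin - - 1 / qmin) ^ n"
    using qmin_pos by (subst emeasure_Rn_lebesgue_PiE) auto
  also have "\<dots> < top" by (simp add: power_less_top_ennreal)
  finally show ?thesis .
qed

text \<open>The relation \<open>dS = n w dV\<close> up to a factor \<open>1 + O(d)\<close>, with \<open>dV\<close> already expressed by the Gaussian integral over the
  whole cone. The area is compared with that of the central projection \<open>T\<close> to a tangent hyperplane (factor
  \<open>(1 \<plusminus> \<epsilon>)\<^sup>m\<close>); the volume below \<open>T\<close> is compared with the volume inside the ellipsoid (factor between
  \<open>(1 - \<epsilon>)\<^sup>n\<close> and 1); and \<open>w\<close> is replaced by its value at the point of tangency, multiplied by \<open>gauge\<close> (factor \<open>1 \<plusminus> \<epsilon>\<close>).
  Powers of the constant \<open>1 - \<epsilon>\<close> stand on the side where no division is required.\<close>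

lemma hausdorff_boundary_piece:
  assumes Q: "Q \<in> sets (Rn_lebesgue n)" and Qd: "\<And>x y. x \<in> Q \<Longrightarrow> y \<in> Q \<Longrightarrow> Rn_dist n x y \<le> d"
    and d: "qmax * d \<le> 1/2" and \<epsilon>_def: "\<epsilon> = (2 + 4 * qmax / qmin) * (qmax * d)" and \<epsilon>1: "\<epsilon> < 1"
  defines "H \<equiv> hausdorff n m (boundary \<inter> Q)" and "c \<equiv> hausdorff m m (unit_cube m)"
    and "W \<equiv> (\<integral>\<^sup>+x. indicator (radial_cone Q) x * ennreal (normal_length x * exp (- (gauge x)\<^sup>2)) \<partial>Rn_lebesgue n)"
  shows "ennreal ((1 - \<epsilon>) ^ (2 * n)) * (gauss_moment n * H) \<le> c * W"
    and "c * W \<le> ennreal ((1 + \<epsilon>) ^ n) * (gauss_moment n * H)"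
proof -
  define A where "A = boundary \<inter> Q"
  define C where "C = radial_cone Q"
  have C: "cone_set n C" unfolding C_def by (rule cone_set_radial_cone[OF Q])
  note Cs [measurable] = cone_setD(1)[OF C]
  have proj: "dilate n (1 / gauge x) x \<in> A" if "x \<in> C" for x
    using that by (auto simp: A_def C_def radial_cone_def boundary_def gauge_dilate)
  have "ennreal ((1 - \<epsilon>) ^ (2 * n)) * (gauss_moment n * H) \<le> c * W \<and> c * W \<le> ennreal ((1 + \<epsilon>) ^ n) * (gauss_moment n * H)"
  proof (cases "A = {}")
    case True
    then have "C = {}" using proj by blast
    then show ?thesis using True unfolding H_def W_def A_def[symmetric] C_def[symmetric] by simp
  next
    case False
    then obtain x0 where x0: "x0 \<in> A" by blast
    define \<delta> where "\<delta> = qmax * d"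
    have \<delta>: "0 \<le> \<delta>" "\<delta> \<le> 1/2"
      using Qd[of x0 x0] x0 qmax_pos d order_trans[OF Rn_dist_nonneg] by (auto simp: \<delta>_def A_def)
    have \<epsilon>: "\<epsilon> = (2 + 4 * qmax / qmin) * \<delta>" by (simp add: \<epsilon>_def \<delta>_def)
    have \<epsilon>0: "0 \<le> \<epsilon>" unfolding \<epsilon> using qmax_pos qmin_pos \<delta> by simp
    have ratio: "1 \<le> qmax / qmin" using qmin_le_qmax qmin_pos by simp
    have \<delta>_le: "\<delta> \<le> \<epsilon>" "qmax / qmin * \<delta> \<le> \<epsilon>"
    proof -
      have "1 * \<delta> \<le> (2 + 4 * qmax / qmin) * \<delta>" using ratio \<delta> by (intro mult_right_mono) auto
      then show "\<delta> \<le> \<epsilon>" by (simp add: \<epsilon>)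
      have "qmax / qmin * \<delta> \<le> (2 + 4 * (qmax / qmin)) * \<delta>" using ratio \<delta> by (intro mult_right_mono) auto
      then show "qmax / qmin * \<delta> \<le> \<epsilon>" by (simp add: \<epsilon>)
    qed
    have g1: "gauge x = 1" and gd: "gauge (\<lambda>i. x i - x0 i) \<le> \<delta>" and AR: "x \<in> Rn n" if "x \<in> A" for x
    proof -
      show "gauge x = 1" "x \<in> Rn n" using that by (auto simp: A_def boundary_def)
      have "gauge (\<lambda>i. x i - x0 i) \<le> qmax * Rn_dist n x x0" by (rule gauge_diff_le)
      also have "\<dots> \<le> \<delta>" unfolding \<delta>_def using Qd[of x x0] that x0 qmax_pos by (auto simp: A_def)
      finally show "gauge (\<lambda>i. x i - x0 i) \<le> \<delta>" .
    qed
    define b where "b = Rn_inner n (normal x0)"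
    define w0 where "w0 = normal_length x0"
    have w0: "w0 \<ge> qmin" unfolding w0_def using normal_length_ge[of x0] g1[OF x0] by simp
    have w0pos: "w0 > 0" using w0 qmin_pos by simp
    have bd: "b (dilate n t x) = t * b x" for t x by (simp add: b_def Rn_inner_dilate)
    have bA: "1 - \<delta> \<le> b x" "b x \<le> 1" if "x \<in> A" for x
    proof -
      have "(gauge (\<lambda>i. x i - x0 i))\<^sup>2 \<le> \<delta> * 1"
        unfolding power2_eq_square using gd[OF that] \<delta> by (intro mult_mono) auto
      then have "(gauge (\<lambda>i. x i - x0 i))\<^sup>2 / 2 \<le> \<delta>" using \<delta> by linarith
      then show "1 - \<delta> \<le> b x" "b x \<le> 1" unfolding b_def normal_inner[OF g1[OF x0] g1[OF that]] by auto
    qed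
    have CR: "x \<in> Rn n" and gC: "gauge x > 0" if "x \<in> C" for x using that by (auto simp: C_def radial_cone_def)
    have bC: "(1 - \<delta>) * gauge x \<le> b x" "b x \<le> gauge x" if "x \<in> C" for x
      using bA[OF proj[OF that]] gC[OF that] by (simp_all add: bd field_simps)
    have bCpos: "b x > 0" if "x \<in> C" for x
      using bC(1)[OF that] gC[OF that] \<delta> by (intro less_le_trans[OF _ bC(1)[OF that]]) auto
    have wC: "(1 - \<epsilon>) * (w0 * gauge x) \<le> normal_length x" "normal_length x \<le> (1 + \<epsilon>) * (w0 * gauge x)" if "x \<in> C" for x
    proof -
      define y where "y = dilate n (1 / gauge x) x"
      have y: "y \<in> A" unfolding y_def by (rule proj[OF that])
      have wy: "normal_length x = gauge x * normal_length y" using gC[OF that] by (simp add: y_def normal_length_dilate)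
      have "\<bar>normal_length y - w0\<bar> \<le> normal_length (\<lambda>i. y i - x0 i)"
        using L2_set_triangle_diff[of "\<lambda>i. (q i)\<^sup>2 * y i" "{1..n}" "\<lambda>i. (q i)\<^sup>2 * x0 i"]
        by (simp add: normal_length_def w0_def algebra_simps)
      also have "\<dots> \<le> qmax * \<delta>" using normal_length_le[of "\<lambda>i. y i - x0 i"] gd[OF y] qmax_pos
        by (meson mult_left_mono less_imp_le order_trans)
      also have "\<dots> = qmin * (qmax / qmin * \<delta>)" using qmin_pos by simp
      also have "\<dots> \<le> w0 * \<epsilon>" using w0 \<delta>_le(2) qmin_pos ratio \<delta> by (intro mult_mono) auto
      finally have "(1 - \<epsilon>) * w0 \<le> normal_length y" "normal_length y \<le> (1 + \<epsilon>) * w0" by (auto simp: abs_le_iff algebra_simps)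
      from mult_left_mono[OF this(1), of "gauge x"] mult_left_mono[OF this(2), of "gauge x"]
      show "(1 - \<epsilon>) * (w0 * gauge x) \<le> normal_length x" "normal_length x \<le> (1 + \<epsilon>) * (w0 * gauge x)"
        unfolding wy by (simp_all add: algebra_simps)
    qed
    \<comment> \<open>Central projection from the origin to the tangent hyperplane at \<open>x0\<close>; its inverse is radial
      normalization by \<open>gauge\<close>.\<close>
    define P where "P x = dilate n (1 / b x) x" for x
    define T where "T = {x\<in>C. b x = 1}"
    have P_T: "P x \<in> T" and P_inv: "dilate n (1 / gauge (P x)) (P x) = x" if "x \<in> A" for x
    proof -
      have b: "b x > 0" using bA[OF that] \<delta> by simp
      have gP: "gauge (P x) = 1 / b x" using b g1[OF that] by (simp add: P_def gauge_dilate)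
      show inv: "dilate n (1 / gauge (P x)) (P x) = x"
        unfolding gP using b AR[OF that] by (simp add: P_def dilate_dilate dilate_one)
      then show "P x \<in> T"
        using that b gP by (auto simp: T_def C_def radial_cone_def A_def) (simp_all add: P_def bd)
    qed
    have PA: "P ` A = T"
    proof (intro antisym subsetI)
      fix z assume z: "z \<in> T"
      then have zC: "z \<in> C" "b z = 1" by (auto simp: T_def)
      have "P (dilate n (1 / gauge z) z) = z"
        using gC[OF zC(1)] zC CR[OF zC(1)] by (simp add: P_def bd dilate_dilate dilate_one)
      then show "z \<in> P ` A" using proj[OF zC(1)] by (metis imageI)
    qed (use P_T in blast)
    have bilip: "\<bar>Rn_dist n (P x) (P y) - Rn_dist n x y\<bar> \<le> \<epsilon> * Rn_dist n x y" if "x \<in> A" "y \<in> A" for x y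
      unfolding \<epsilon> P_def b_def using that x0 \<delta>
      by (intro central_projection_bilipschitz g1 gd) auto
    have H1: "hausdorff n m T \<le> ennreal ((1 + \<epsilon>) ^ m) * H"
      unfolding H_def A_def[symmetric] PA[symmetric]
    proof (rule hausdorff_Lipschitz_image)
      fix x y assume "x \<in> A" "y \<in> A"
      from bilip[OF this] show "Rn_dist n (P x) (P y) \<le> (1 + \<epsilon>) * Rn_dist n x y"
        by (simp add: abs_le_iff algebra_simps)
    qed (use \<epsilon>0 in \<open>auto simp: P_def\<close>)
    have H2: "ennreal ((1 - \<epsilon>) ^ m) * H \<le> hausdorff n m T"
    proof -
      have "(\<lambda>z. dilate n (1 / gauge z) z) ` T = A"
        unfolding PA[symmetric] image_image using P_inv by force
      moreover have "hausdorff n m ((\<lambda>z. dilate n (1 / gauge z) z) ` T) \<le> ennreal ((1 / (1 - \<epsilon>)) ^ m) * hausdorff n m T"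
      proof (rule hausdorff_Lipschitz_image)
        fix z z' assume "z \<in> T" "z' \<in> T"
        then obtain x y where xy: "x \<in> A" "y \<in> A" "z = P x" "z' = P y" using PA by blast
        from bilip[OF xy(1,2)] have "(1 - \<epsilon>) * Rn_dist n x y \<le> Rn_dist n (P x) (P y)"
          by (simp add: abs_le_iff algebra_simps)
        then show "Rn_dist n (dilate n (1 / gauge z) z) (dilate n (1 / gauge z') z') \<le> 1 / (1 - \<epsilon>) * Rn_dist n z z'"
          using \<epsilon>1 unfolding xy(3,4) P_inv[OF xy(1)] P_inv[OF xy(2)] by (simp add: field_simps)
      qed (use \<epsilon>1 in auto)
      ultimately have "H \<le> ennreal ((1 / (1 - \<epsilon>)) ^ m) * hausdorff n m T" by (simp add: H_def A_def)
      then have "ennreal ((1 - \<epsilon>) ^ m) * H \<le> ennreal ((1 - \<epsilon>) ^ m) * (ennreal ((1 / (1 - \<epsilon>)) ^ m) * hausdorff n m T)"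
        by (rule mult_left_mono) simp
      then show ?thesis using \<epsilon>1 by (simp add: mult.assoc[symmetric] ennreal_mult[symmetric] power_one_over)
    qed
    let ?L = "emeasure (Rn_lebesgue n)"
    define VE where "VE = ?L {x\<in>C. gauge x \<le> 1}"
    define VT where "VT = ?L {x\<in>C. b x \<le> 1}"
    have HT: "hausdorff n m T = c * (ennreal (real n * w0) * VT)"
    proof -
      have NN: "Rn_inner n (normal x0) (normal x0) > 0"
        using normal_norm[of x0] w0pos unfolding w0_def by (metis real_sqrt_gt_0_iff)
      show ?thesis
        using hausdorff_cone_section[of m C "normal x0", folded n_Suc, OF C m_pos NN bCpos[unfolded b_def]]
        unfolding T_def c_def VT_def b_def w0_def normal_norm .
    qed
    have lev: "{x\<in>C. f x \<le> 1} \<in> sets (Rn_lebesgue n)" if [measurable]: "f \<in> borel_measurable (Rn_lebesgue n)" for f :: "_ \<Rightarrow> real"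
    proof -
      have "{x\<in>space (Rn_lebesgue n). f x \<le> 1} \<in> sets (Rn_lebesgue n)" by measurable
      moreover have "{x\<in>C. f x \<le> 1} = C \<inter> {x\<in>space (Rn_lebesgue n). f x \<le> 1}" using CR by auto
      ultimately show ?thesis by simp
    qed
    have bm: "b \<in> borel_measurable (Rn_lebesgue n)" unfolding b_def by measurable
    have V1: "VE \<le> VT"
      unfolding VE_def VT_def using bC(2) by (intro emeasure_mono lev bm) (auto intro: order_trans)
    have V2: "ennreal ((1 - \<epsilon>) ^ n) * VT \<le> VE"
    proof -
      have e: "1 - \<epsilon> > 0" using \<epsilon>1 by simp
      have "dilate n (1 - \<epsilon>) ` {x\<in>C. b x \<le> 1} \<subseteq> {x\<in>C. gauge x \<le> 1}"
      proof clarify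
        fix x assume x: "x \<in> C" "b x \<le> 1"
        have "(1 - \<epsilon>) * gauge x \<le> (1 - \<delta>) * gauge x" using \<delta>_le by (intro mult_right_mono) auto
        also have "\<dots> \<le> 1" using bC(1)[OF x(1)] x(2) by simp
        finally show "dilate n (1 - \<epsilon>) x \<in> C \<and> gauge (dilate n (1 - \<epsilon>) x) \<le> 1"
          using cone_setD(3)[OF C x(1) e] e by (simp add: gauge_dilate)
      qed
      then have "?L (dilate n (1 - \<epsilon>) ` {x\<in>C. b x \<le> 1}) \<le> VE"
        unfolding VE_def by (intro emeasure_mono lev) measurable
      then show ?thesis unfolding VT_def emeasure_dilate_image[OF e lev[OF bm]] .
    qed
    \<comment> \<open>The same Gaussian integral with the degree-1 function \<open>gauge\<close> in place of \<open>normal_length\<close>: it depends on the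
      cone only through its volume inside the ellipsoid.\<close>
    define W' where "W' = (\<integral>\<^sup>+x. indicator C x * ennreal (gauge x * exp (- (gauge x)\<^sup>2)) \<partial>Rn_lebesgue n)"
    have W': "W' = VE * (ennreal (real n) * gauss_moment n)"
    proof -
      have fin: "?L {x\<in>C. gauge x \<le> 1} < top"
        by (rule le_less_trans[OF emeasure_mono emeasure_gauge_ball_finite])
          (use CR sets_preimage_Rn[OF measurable_gauge, of "{..1}"] in auto)
      have "W' = VE * (\<integral>\<^sup>+t. ennreal (real n * t ^ (n - 1)) * indicator {0..} t * ennreal (t * exp (- t\<^sup>2)) \<partial>lborel)"
        unfolding W'_def VE_def
        by (intro nn_integral_cone_radial[OF C n_pos measurable_gauge _ gC fin]) (auto simp: gauge_dilate)
      also have "(\<integral>\<^sup>+t. ennreal (real n * t ^ (n - 1)) * indicator {0..} t * ennreal (t * exp (- t\<^sup>2)) \<partial>lborel)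
          = (\<integral>\<^sup>+t. ennreal (real n) * (ennreal (t ^ n * exp (- t\<^sup>2)) * indicator {0..} t) \<partial>lborel)"
        by (intro nn_integral_cong) (auto simp: n_Suc ennreal_mult[symmetric] mult_ac simp del: of_nat_Suc split: split_indicator)
      also have "\<dots> = ennreal (real n) * gauss_moment n"
        unfolding gauss_moment_def by (intro nn_integral_cmult) measurable
      finally show ?thesis .
    qed
    have W1: "ennreal ((1 - \<epsilon>) * w0) * W' \<le> W"
      unfolding W'_def W_def C_def[symmetric]
    proof (subst nn_integral_cmult[symmetric], measurable, rule nn_integral_mono)
      fix x
      show "ennreal ((1 - \<epsilon>) * w0) * (indicator C x * ennreal (gauge x * exp (- (gauge x)\<^sup>2)))
         \<le> indicator C x * ennreal (normal_length x * exp (- (gauge x)\<^sup>2))"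
      proof (cases "x \<in> C")
        case True
        then show ?thesis using mult_right_mono[OF wC(1)[OF True], of "exp (- (gauge x)\<^sup>2)"] \<epsilon>1 w0pos
          by (simp add: ennreal_mult[symmetric] mult_ac)
      qed simp
    qed
    have W2: "W \<le> ennreal ((1 + \<epsilon>) * w0) * W'"
      unfolding W'_def W_def C_def[symmetric]
    proof (subst nn_integral_cmult[symmetric], measurable, rule nn_integral_mono)
      fix x
      show "indicator C x * ennreal (normal_length x * exp (- (gauge x)\<^sup>2))
         \<le> ennreal ((1 + \<epsilon>) * w0) * (indicator C x * ennreal (gauge x * exp (- (gauge x)\<^sup>2)))"
      proof (cases "x \<in> C")
        case True
        then show ?thesis using mult_right_mono[OF wC(2)[OF True], of "exp (- (gauge x)\<^sup>2)"] \<epsilon>0 w0pos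
          by (simp add: ennreal_mult[symmetric] mult_ac)
      qed simp
    qed
    have "ennreal ((1 - \<epsilon>) ^ (2 * n)) * (gauss_moment n * H)
        = ennreal (1 - \<epsilon>) * ennreal ((1 - \<epsilon>) ^ n) * gauss_moment n * (ennreal ((1 - \<epsilon>) ^ m) * H)"
    proof -
      have "(1 - \<epsilon>) ^ (2 * n) = (1 - \<epsilon>) * (1 - \<epsilon>) ^ n * (1 - \<epsilon>) ^ m"
        by (simp add: n_Suc mult_2 power_add)
      then show ?thesis using \<epsilon>1 by (simp add: ennreal_mult mult_ac)
    qed
    also have "\<dots> \<le> ennreal (1 - \<epsilon>) * ennreal ((1 - \<epsilon>) ^ n) * gauss_moment n * hausdorff n m T"
      by (intro mult_left_mono H2) auto
    also have "\<dots> = c * ennreal (1 - \<epsilon>) * ennreal (real n * w0) * gauss_moment n * (ennreal ((1 - \<epsilon>) ^ n) * VT)"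
      unfolding HT by (simp add: mult_ac)
    also have "\<dots> \<le> c * ennreal (1 - \<epsilon>) * ennreal (real n * w0) * gauss_moment n * VE"
      by (intro mult_left_mono V2) auto
    also have "\<dots> = c * (ennreal ((1 - \<epsilon>) * w0) * W')"
      unfolding W' using w0pos \<epsilon>1 by (simp add: ennreal_mult mult_ac)
    also have "\<dots> \<le> c * W" by (intro mult_left_mono W1) auto
    finally have lower: "ennreal ((1 - \<epsilon>) ^ (2 * n)) * (gauss_moment n * H) \<le> c * W" .
    have "c * W \<le> c * (ennreal ((1 + \<epsilon>) * w0) * W')" by (intro mult_left_mono W2) auto
    also have "\<dots> = c * ennreal (1 + \<epsilon>) * ennreal (real n * w0) * gauss_moment n * VE"
      unfolding W' using w0pos \<epsilon>0 by (simp add: ennreal_mult mult_ac)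
    also have "\<dots> \<le> c * ennreal (1 + \<epsilon>) * ennreal (real n * w0) * gauss_moment n * VT"
      by (intro mult_left_mono V1) auto
    also have "\<dots> = ennreal (1 + \<epsilon>) * gauss_moment n * hausdorff n m T"
      unfolding HT by (simp add: mult_ac)
    also have "\<dots> \<le> ennreal (1 + \<epsilon>) * gauss_moment n * (ennreal ((1 + \<epsilon>) ^ m) * H)"
      by (intro mult_left_mono H1) auto
    also have "\<dots> = ennreal ((1 + \<epsilon>) ^ n) * (gauss_moment n * H)"
      using \<epsilon>0 by (simp add: n_Suc ennreal_mult mult_ac)
    finally show ?thesis using lower by blast
  qed
  then show "ennreal ((1 - \<epsilon>) ^ (2 * n)) * (gauss_moment n * H) \<le> c * W"
    and "c * W \<le> ennreal ((1 + \<epsilon>) ^ n) * (gauss_moment n * H)" by auto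
qed

end

lemma ennreal_squeeze_eq:
  fixes X Y :: ennreal and e :: "nat \<Rightarrow> real"
  assumes e: "e \<longlonglongrightarrow> 0"
    and lower: "\<forall>\<^sub>F k in sequentially. ennreal ((1 - e k) ^ p) * X \<le> Y"
    and upper: "\<forall>\<^sub>F k in sequentially. Y \<le> ennreal ((1 + e k) ^ r) * X"
  shows "X = Y"
proof (rule antisym)
  have l: "(\<lambda>k. ennreal ((1 - e k) ^ p) * X) \<longlonglongrightarrow> ennreal ((1 - 0) ^ p) * X"
    by (intro tendsto_mult_ennreal tendsto_ennrealI tendsto_power tendsto_diff tendsto_const e) auto
  have u: "(\<lambda>k. ennreal ((1 + e k) ^ r) * X) \<longlonglongrightarrow> ennreal ((1 + 0) ^ r) * X"
    by (intro tendsto_mult_ennreal tendsto_ennrealI tendsto_power tendsto_add tendsto_const e) auto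
  show "X \<le> Y" using tendsto_upperbound[OF l lower] by simp
  show "Y \<le> X" using tendsto_lowerbound[OF u upper] by simp
qed

context ellipsoid_axes
begin

lemma sets_boundary [measurable]: "boundary \<in> sets (Rn_lebesgue n)"
  using sets_preimage_Rn[OF measurable_gauge, of "{1}"] by (simp add: boundary_def)

text \<open>The estimates for the pieces cut out by dyadic cubes of side \<open>2\<^sup>-\<^sup>k\<close> add up with a common error factor, which
  tends to 1 as \<open>k\<close> grows.\<close>

lemma hausdorff_boundary:
  defines "G \<equiv> (\<integral>\<^sup>+x. ennreal (normal_length x * exp (- (gauge x)\<^sup>2)) \<partial>Rn_lebesgue n)"
  shows "gauss_moment n * hausdorff n m boundary = hausdorff m m (unit_cube m) * G"
proof -
  let ?c = "hausdorff m m (unit_cube m)"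
  define d where "d k = real n * (1 / 2) ^ k" for k :: nat
  define e where "e k = (2 + 4 * qmax / qmin) * (qmax * d k)" for k
  have "(\<lambda>k. (1 / 2 :: real) ^ k) \<longlonglongrightarrow> 0" by (intro LIMSEQ_power_zero) simp
  from tendsto_mult_right_zero[OF this, of "real n"] have "d \<longlonglongrightarrow> 0" unfolding d_def[abs_def] .
  then have qd: "(\<lambda>k. qmax * d k) \<longlonglongrightarrow> 0" by (rule tendsto_mult_right_zero)
  then have e0: "e \<longlonglongrightarrow> 0" unfolding e_def[abs_def] by (rule tendsto_mult_right_zero)
  have small: "\<forall>\<^sub>F k in sequentially. qmax * d k < 1 / 2 \<and> e k < 1"
    by (intro eventually_conj order_tendstoD(2)[OF qd] order_tendstoD(2)[OF e0]) auto
  define \<Gamma> where "\<Gamma> = density (Rn_lebesgue n) (\<lambda>x. ennreal (normal_length x * exp (- (gauge x)\<^sup>2)))"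
  have both: "ennreal ((1 - e k) ^ (2 * n)) * (gauss_moment n * hausdorff n m boundary) \<le> ?c * G"
       "?c * G \<le> ennreal ((1 + e k) ^ n) * (gauss_moment n * hausdorff n m boundary)"
    if k: "qmax * d k < 1 / 2" "e k < 1" for k
  proof -
    let ?Q = "dyadic_cube n k" and ?I = "cube_index n"
    let ?W = "\<lambda>z. (\<integral>\<^sup>+x. indicator (radial_cone (?Q z)) x * ennreal (normal_length x * exp (- (gauge x)\<^sup>2)) \<partial>Rn_lebesgue n)"
    let ?H = "\<lambda>z. hausdorff n m (boundary \<inter> ?Q z)"
    have diam: "Rn_dist n x y \<le> d k" if "x \<in> ?Q z" "y \<in> ?Q z" for x y z
      using Rn_dist_le_of_coordinates[of n x y "(1/2) ^ k"] dyadic_cube_coordinate_dist[OF that]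
      by (simp add: d_def power_one_over less_imp_le)
    have piece: "ennreal ((1 - e k) ^ (2 * n)) * (gauss_moment n * ?H z) \<le> ?c * ?W z"
         "?c * ?W z \<le> ennreal ((1 + e k) ^ n) * (gauss_moment n * ?H z)" for z
      using hausdorff_boundary_piece[OF sets_dyadic_cube diam _ _ k(2)] k(1) by (simp_all add: e_def)
    have cones: "radial_cone (?Q z) \<in> sets (Rn_lebesgue n)" for z
      by (rule cone_setD(1)[OF cone_set_radial_cone]) simp
    have "hausdorff n m boundary = emeasure (hausdorff_measure n m) (\<Union>z\<in>?I. boundary \<inter> ?Q z)"
    proof -
      have "boundary = (\<Union>z\<in>?I. boundary \<inter> ?Q z)"
        using Union_dyadic_cubes[of n k] by (auto simp: boundary_def)
      then show ?thesis by (metis emeasure_hausdorff_measure sets_boundary)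
    qed
    also have "\<dots> = (\<integral>\<^sup>+z. emeasure (hausdorff_measure n m) (boundary \<inter> ?Q z) \<partial>count_space ?I)"
    proof (rule emeasure_UN_countable)
      show "disjoint_family_on (\<lambda>z. boundary \<inter> ?Q z) ?I"
        using disjoint_dyadic_cubes[of n k] by (auto simp: disjoint_family_on_def)
    qed (auto simp: countable_cube_index)
    also have "\<dots> = (\<integral>\<^sup>+z. ?H z \<partial>count_space ?I)"
      by (intro nn_integral_cong emeasure_hausdorff_measure) auto
    finally have HS: "hausdorff n m boundary = (\<integral>\<^sup>+z. ?H z \<partial>count_space ?I)" .
    have "G = (\<integral>\<^sup>+x. ennreal (normal_length x * exp (- (gauge x)\<^sup>2)) * indicator (\<Union>z\<in>?I. radial_cone (?Q z)) x \<partial>Rn_lebesgue n)"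
      unfolding G_def
    proof (rule nn_integral_cong)
      fix x assume "x \<in> space (Rn_lebesgue n)"
      then have x: "x \<in> Rn n" by simp
      show "ennreal (normal_length x * exp (- (gauge x)\<^sup>2))
          = ennreal (normal_length x * exp (- (gauge x)\<^sup>2)) * indicator (\<Union>z\<in>?I. radial_cone (?Q z)) x"
      proof (cases "gauge x = 0")
        case True
        then have "normal_length x = 0" using normal_length_le[of x] normal_length_nonneg[of x] by simp
        then show ?thesis by simp
      next
        case False
        then have "gauge x > 0" using gauge_nonneg[of x] by linarith
        moreover have "dilate n (1 / gauge x) x \<in> (\<Union>z\<in>?I. ?Q z)" unfolding Union_dyadic_cubes by simp
        ultimately have "x \<in> (\<Union>z\<in>?I. radial_cone (?Q z))" using x by (auto simp: radial_cone_def)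
        then show ?thesis by simp
      qed
    qed
    also have "\<dots> = emeasure \<Gamma> (\<Union>z\<in>?I. radial_cone (?Q z))"
      unfolding \<Gamma>_def using cones countable_cube_index
      by (intro emeasure_density[symmetric] sets.countable_UN'') auto
    also have "\<dots> = (\<integral>\<^sup>+z. emeasure \<Gamma> (radial_cone (?Q z)) \<partial>count_space ?I)"
    proof (rule emeasure_UN_countable)
      show "disjoint_family_on (\<lambda>z. radial_cone (?Q z)) ?I"
        using disjoint_dyadic_cubes[of n k] unfolding disjoint_family_on_def radial_cone_def by blast
    qed (use cones in \<open>auto simp: countable_cube_index \<Gamma>_def\<close>)
    also have "\<dots> = (\<integral>\<^sup>+z. ?W z \<partial>count_space ?I)"
      unfolding \<Gamma>_def by (intro nn_integral_cong) (auto simp: emeasure_density cones mult.commute)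
    finally have GS: "G = (\<integral>\<^sup>+z. ?W z \<partial>count_space ?I)" .
    have "ennreal ((1 - e k) ^ (2 * n)) * (gauss_moment n * hausdorff n m boundary)
        = (\<integral>\<^sup>+z. ennreal ((1 - e k) ^ (2 * n)) * (gauss_moment n * ?H z) \<partial>count_space ?I)"
      unfolding HS by (simp add: nn_integral_cmult)
    also have "\<dots> \<le> (\<integral>\<^sup>+z. ?c * ?W z \<partial>count_space ?I)" by (intro nn_integral_mono piece)
    also have "\<dots> = ?c * G" unfolding GS by (simp add: nn_integral_cmult)
    finally show "ennreal ((1 - e k) ^ (2 * n)) * (gauss_moment n * hausdorff n m boundary) \<le> ?c * G" .
    have "?c * G = (\<integral>\<^sup>+z. ?c * ?W z \<partial>count_space ?I)" unfolding GS by (simp add: nn_integral_cmult)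
    also have "\<dots> \<le> (\<integral>\<^sup>+z. ennreal ((1 + e k) ^ n) * (gauss_moment n * ?H z) \<partial>count_space ?I)"
      by (intro nn_integral_mono piece)
    also have "\<dots> = ennreal ((1 + e k) ^ n) * (gauss_moment n * hausdorff n m boundary)"
      unfolding HS by (simp add: nn_integral_cmult)
    finally show "?c * G \<le> ennreal ((1 + e k) ^ n) * (gauss_moment n * hausdorff n m boundary)" .
  qed
  show ?thesis
    by (rule ennreal_squeeze_eq[OF e0, where p="2 * n" and r=n]) (use small both in \<open>auto elim: eventually_mono\<close>)
qed

text \<open>Radial integration over the cone of all points with positive gauge, which omits only the origin.\<close>

lemma emeasure_gauge_ball:
  "(\<integral>\<^sup>+x. ennreal (exp (- (gauge x)\<^sup>2)) \<partial>Rn_lebesgue n)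
     = emeasure (Rn_lebesgue n) {x\<in>Rn n. gauge x \<le> 1} * (ennreal (real n) * gauss_moment (n - 1))"
proof -
  let ?L = "Rn_lebesgue n" and ?C = "radial_cone (Rn n)"
  have Rs: "Rn n \<in> sets ?L" using sets.top[of ?L] by simp
  have C: "cone_set n ?C" by (rule cone_set_radial_cone[OF Rs])
  note [measurable] = cone_setD(1)[OF C]
  have Ceq: "?C = {x\<in>Rn n. 0 < gauge x}" by (auto simp: radial_cone_def)
  have null: "{x\<in>Rn n. gauge x = 0} \<in> null_sets ?L"
  proof (rule null_sets_subset)
    have zero_sets: "(\<Pi>\<^sub>E i\<in>{1..n}. {0}) \<in> sets ?L"
      unfolding Rn_lebesgue_def by (rule sets_PiM_I_finite) auto
    show "(\<Pi>\<^sub>E i\<in>{1..n}. {0}) \<in> null_sets ?L"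
    proof
      have "emeasure ?L (\<Pi>\<^sub>E i\<in>{1..n}. {0}) = (\<Prod>i=1..n. 0)"
        by (subst emeasure_Rn_lebesgue_PiE) auto
      then show "emeasure ?L (\<Pi>\<^sub>E i\<in>{1..n}. {0}) = 0" using n_pos by simp
    qed (rule zero_sets)
    show "{x\<in>Rn n. gauge x = 0} \<in> sets ?L"
      using sets_preimage_Rn[OF measurable_gauge, of "{0}"] by simp
    show "{x\<in>Rn n. gauge x = 0} \<subseteq> (\<Pi>\<^sub>E i\<in>{1..n}. {0})"
    proof
      fix x assume x: "x \<in> {x\<in>Rn n. gauge x = 0}"
      then have "\<forall>i\<in>{1..n}. q i * x i = 0" by (simp add: gauge_def L2_set_eq_0_iff)
      then have "\<forall>i\<in>{1..n}. x i = 0" using q_pos by fastforce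
      then show "x \<in> (\<Pi>\<^sub>E i\<in>{1..n}. {0})"
        using x by (auto simp: Rn_iff_extensional extensional_def fun_eq_iff)
    qed
  qed
  have ae: "AE x in ?L. x \<in> ?C"
    by (rule AE_I'[OF null]) (auto simp: Ceq less_le)
  have ball: "emeasure ?L {x\<in>?C. gauge x \<le> 1} = emeasure ?L {x\<in>Rn n. gauge x \<le> 1}"
  proof (rule emeasure_eq_AE)
    show "AE x in ?L. x \<in> {x\<in>?C. gauge x \<le> 1} \<longleftrightarrow> x \<in> {x\<in>Rn n. gauge x \<le> 1}"
      using ae by eventually_elim (auto simp: Ceq)
    show "{x\<in>Rn n. gauge x \<le> 1} \<in> sets ?L"
      using sets_preimage_Rn[OF measurable_gauge, of "{..1}"] by simp
    moreover have "{x\<in>?C. gauge x \<le> 1} = ?C \<inter> {x\<in>Rn n. gauge x \<le> 1}" by (auto simp: Ceq)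
    ultimately show "{x\<in>?C. gauge x \<le> 1} \<in> sets ?L" by simp
  qed
  have "(\<integral>\<^sup>+x. ennreal (exp (- (gauge x)\<^sup>2)) \<partial>?L) = (\<integral>\<^sup>+x. indicator ?C x * ennreal (exp (- (gauge x)\<^sup>2)) \<partial>?L)"
    by (rule nn_integral_cong_AE) (use ae in eventually_elim, simp)
  also have "\<dots> = emeasure ?L {x\<in>?C. gauge x \<le> 1}
      * (\<integral>\<^sup>+t. ennreal (real n * t ^ (n - 1)) * indicator {0..} t * ennreal (exp (- t\<^sup>2)) \<partial>lborel)"
  proof (rule nn_integral_cone_radial[OF C n_pos measurable_gauge])
    show "emeasure ?L {x\<in>?C. gauge x \<le> 1} < top" unfolding ball by (rule emeasure_gauge_ball_finite)
  qed (auto simp: gauge_dilate Ceq)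
  also have "(\<integral>\<^sup>+t. ennreal (real n * t ^ (n - 1)) * indicator {0..} t * ennreal (exp (- t\<^sup>2)) \<partial>lborel)
      = (\<integral>\<^sup>+t. ennreal (real n) * (ennreal (t ^ (n - 1) * exp (- t\<^sup>2)) * indicator {0..} t) \<partial>lborel)"
    by (intro nn_integral_cong) (auto simp: ennreal_mult[symmetric] mult_ac split: split_indicator)
  also have "\<dots> = ennreal (real n) * gauss_moment (n - 1)"
    unfolding gauss_moment_def by (intro nn_integral_cmult) measurable
  finally show ?thesis unfolding ball .
qed

lemma gauge_squared: "(gauge x)\<^sup>2 = (\<Sum>i=1..n. (q i)\<^sup>2 * (x i)\<^sup>2)"
  unfolding gauge_def L2_set_def by (simp add: sum_nonneg power_mult_distrib)

lemma ellipsoid_eq: "ellipsoid q n = {x\<in>Rn n. gauge x \<le> 1}"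
  unfolding ellipsoid_def gauge_squared[symmetric] by (auto simp: power_le_one_iff abs_square_le_1)

text \<open>A point with gauge 1 is not interior, since moving it outwards along its ray leaves the ellipsoid
  immediately.\<close>

lemma frontier_ellipsoid: "Rn_topology n frontier_of ellipsoid q n = boundary"
proof -
  let ?X = "Rn_topology n"
  have top: "topspace ?X = Rn n" by (simp add: Rn_topology_def Rn_def)
  define f where "f x = (gauge x)\<^sup>2" for x
  have f: "continuous_map ?X euclideanreal f"
    unfolding f_def gauge_squared Rn_topology_def
    by (intro continuous_map_sum continuous_map_real_mult continuous_map_real_pow continuous_map_const[THEN iffD2]
        continuous_map_product_projection) auto
  have E: "ellipsoid q n = {x\<in>topspace ?X. f x \<in> {..1}}"
    unfolding ellipsoid_eq top f_def by (auto simp: abs_square_le_1)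
  have "closedin ?X (ellipsoid q n)"
    unfolding E by (rule closedin_continuous_map_preimage[OF f]) simp
  then have cl: "?X closure_of ellipsoid q n = ellipsoid q n" by (simp add: closure_of_closedin)
  have op: "openin ?X {x\<in>topspace ?X. f x \<in> {..<1}}"
    by (rule openin_continuous_map_preimage[OF f]) simp
  have int: "x \<notin> ?X interior_of ellipsoid q n" if x: "x \<in> Rn n" "gauge x = 1" for x
  proof
    assume "x \<in> ?X interior_of ellipsoid q n"
    then obtain U where U: "openin ?X U" "x \<in> U" "U \<subseteq> ellipsoid q n" by (auto simp: interior_of_def)
    have "continuous_map euclideanreal ?X (\<lambda>t. dilate n t x)"
      unfolding Rn_topology_def continuous_map_componentwise homothety_def
      by (auto intro!: continuous_intros)
    from openin_continuous_map_preimage[OF this U(1)] have "open {t. dilate n t x \<in> U}" by simp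
    moreover have "1 \<in> {t. dilate n t x \<in> U}" using U(2) x by (simp add: dilate_one)
    ultimately obtain r where r: "r > 0" "\<And>t. dist t 1 < r \<Longrightarrow> dilate n t x \<in> U"
      unfolding open_dist by blast
    have "dilate n (1 + r / 2) x \<in> ellipsoid q n" using r U(3) by (auto simp: dist_real_def)
    then have "gauge (dilate n (1 + r / 2) x) \<le> 1" by (simp add: ellipsoid_eq)
    then show False using r(1) x(2) by (simp add: gauge_dilate)
  qed
  have sub: "x \<in> ?X interior_of ellipsoid q n" if "x \<in> Rn n" "gauge x < 1" for x
  proof -
    have "{x\<in>topspace ?X. f x \<in> {..<1}} \<subseteq> ellipsoid q n" unfolding E by auto
    then have "{x\<in>topspace ?X. f x \<in> {..<1}} \<subseteq> ?X interior_of ellipsoid q n"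
      using op by (rule interior_of_maximal)
    then show ?thesis using that by (auto simp: top f_def abs_square_less_1)
  qed
  show ?thesis
    unfolding frontier_of_def cl using int sub
    by (auto simp: ellipsoid_eq boundary_def) force
qed

end

section \<open>Gaussian moments and concentration\<close>

text \<open>Substituting \<open>s = t\<^sup>2\<close> would give this directly; here the known factorial formulas for even and odd moments are
  matched with the values of the Gamma function at half-integers and integers.\<close>

lemma gauss_moment_eq_Gamma: "gauss_moment k = ennreal (Gamma ((real k + 1) / 2) / 2)"
proof -
  have *: "gauss_moment k = ennreal I"
    if "has_bochner_integral lborel (\<lambda>x::real. indicator {0..} x *\<^sub>R (exp (- x\<^sup>2) * x ^ k)) I" for I
  proof -
    have "gauss_moment k = (\<integral>\<^sup>+x. ennreal (indicator {0..} x *\<^sub>R (exp (- x\<^sup>2) * x ^ k)) \<partial>lborel)"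
      unfolding gauss_moment_def by (intro nn_integral_cong) (auto simp: mult.commute split: split_indicator)
    also have "\<dots> = ennreal I"
      using that by (subst nn_integral_eq_integral)
        (auto simp: has_bochner_integral_iff split: split_indicator intro!: AE_I2)
    finally show ?thesis .
  qed
  show ?thesis
  proof (cases "even k")
    case True
    then obtain j where j: "k = 2 * j" by (elim evenE)
    have "Gamma (real j + 1 / 2) = sqrt pi * (fact (2 * j) / (2 ^ (2 * j) * fact j))"
    proof (induction j)
      case (Suc j)
      have "Gamma (real (Suc j) + 1 / 2) = Gamma ((real j + 1 / 2) + 1)" by (simp add: add_ac)
      also have "\<dots> = (real j + 1 / 2) * Gamma (real j + 1 / 2)"
        by (rule Gamma_plus1) (auto simp: nonpos_Ints_def add_eq_0_iff elim!: Ints_cases)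
      also have "\<dots> = sqrt pi * (fact (2 * Suc j) / (2 ^ (2 * Suc j) * fact (Suc j)))"
      proof -
        have f: "(fact (2 * Suc j) :: real) = (2 * real j + 2) * (2 * real j + 1) * fact (2 * j)"
          by (simp add: algebra_simps)
        have p: "(2 :: real) ^ (2 * Suc j) = 4 * 2 ^ (2 * j)" by simp
        have g: "(fact (Suc j) :: real) = (real j + 1) * fact j" by (simp add: algebra_simps)
        have "(r + 1 / 2) * (s * (X / (P * F))) = s * ((2 * r + 2) * (2 * r + 1) * X / (4 * P * ((r + 1) * F)))"
          if "r \<ge> 0" "P > 0" "F > 0" for r s X P F :: real
        proof -
          have "(2 * r + 2) * (2 * r + 1) * X / (4 * P * ((r + 1) * F)) = ((r + 1) * (4 * ((r + 1 / 2) * X))) / ((r + 1) * (4 * (P * F)))"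
            by (simp add: algebra_simps)
          also have "\<dots> = (r + 1 / 2) * X / (P * F)"
            using that by (subst mult_divide_mult_cancel_left, simp, subst mult_divide_mult_cancel_left) simp_all
          finally show ?thesis by simp
        qed
        then show ?thesis unfolding Suc f p g by auto
      qed
      finally show ?case .
    qed (simp add: Gamma_one_half_real)
    then have "sqrt pi / 2 * (fact k / (2 ^ k * fact j)) = Gamma ((real k + 1) / 2) / 2"
      by (simp add: j add_divide_distrib)
    then show ?thesis using *[OF gaussian_moment_even_pos[of j, folded j]] by (simp only:)
  next
    case False
    then obtain j where j: "k = 2 * j + 1" by (elim oddE)
    have "Gamma ((real k + 1) / 2) = fact j"
      using Gamma_fact[of j, where 'a=real] by (simp add: j add_divide_distrib add.commute)
    then show ?thesis using *[OF gaussian_moment_odd_pos[of j, folded j]] by simp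
  qed
qed

lemma sqrt_le_linear: "0 \<le> r \<Longrightarrow> sqrt r \<le> (1 + r) / 2"
  using arith_geo_mean_sqrt[of 1 r] by simp

text \<open>A parabola that touches the square root at 1 and stays below it, so that an expectation of the square root
  can be bounded below by first and second moments.\<close>

lemma sqrt_ge_quadratic:
  assumes "0 \<le> r" shows "(3 * r - r\<^sup>2) / 2 \<le> sqrt r"
proof -
  define s where "s = sqrt r"
  have s: "s \<ge> 0" "r = s\<^sup>2" using assms by (auto simp: s_def)
  have "s - (3 * r - r\<^sup>2) / 2 = s * (s - 1)\<^sup>2 * (s + 2) / 2"
    unfolding s(2) by (simp add: power2_eq_square field_simps)
  also have "\<dots> \<ge> 0" using s by simp
  finally show ?thesis by (simp add: s_def)
qed

context ellipsoid_axes
begin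

text \<open>Standard deviation of the \<open>i\<close>-th coordinate under the density proportional to \<open>exp (- (gauge x)\<^sup>2)\<close>.\<close>

definition \<sigma> :: "nat \<Rightarrow> real" where "\<sigma> i = 1 / (sqrt 2 * q i)"

definition gauss_density :: "(nat \<Rightarrow> real) \<Rightarrow> real" where
  "gauss_density x = (\<Prod>i=1..n. normal_density 0 (\<sigma> i) (x i))"

definition gauss_const :: real where
  "gauss_const = (\<Prod>i=1..n. q i / sqrt pi)"

lemma sigma_pos: "i \<in> {1..n} \<Longrightarrow> \<sigma> i > 0"
  using q_pos by (simp add: \<sigma>_def)

lemma sigma_squared: "(\<sigma> i)\<^sup>2 = 1 / (2 * (q i)\<^sup>2)"
  by (simp add: \<sigma>_def power_divide power_mult_distrib)

lemma gauss_const_pos: "gauss_const > 0"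
  unfolding gauss_const_def using q_pos by (intro prod_pos) auto

lemma gauss_density_eq: "gauss_density x = gauss_const * exp (- (gauge x)\<^sup>2)"
proof -
  have "normal_density 0 (\<sigma> i) (x i) = q i / sqrt pi * exp (- ((q i)\<^sup>2 * (x i)\<^sup>2))" if "i \<in> {1..n}" for i
    using q_pos[OF that] unfolding normal_density_def sigma_squared
    by (simp add: real_sqrt_divide field_simps)
  then have "gauss_density x = (\<Prod>i=1..n. q i / sqrt pi * exp (- ((q i)\<^sup>2 * (x i)\<^sup>2)))"
    unfolding gauss_density_def by (intro prod.cong) auto
  then show ?thesis
    by (simp only: prod.distrib gauss_const_def exp_sum[symmetric] finite_atLeastAtMost sum_negf gauge_squared)
qed

lemma gauss_density_nonneg: "gauss_density x \<ge> 0"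
  using gauss_const_pos by (simp add: gauss_density_eq)

lemma measurable_gauss_density [measurable]: "gauss_density \<in> borel_measurable (Rn_lebesgue n)"
  unfolding gauss_density_eq[abs_def] by measurable

lemma gauss_monomial:
  "has_bochner_integral (Rn_lebesgue n) (\<lambda>x. gauss_density x * (\<Prod>i=1..n. x i ^ (2 * k i)))
     (\<Prod>i=1..n. fact (2 * k i) / ((2 / (\<sigma> i)\<^sup>2) ^ k i * fact (k i)))"
proof -
  interpret product_sigma_finite "\<lambda>i::nat. lborel :: real measure" by standard
  define f where "f i t = normal_density 0 (\<sigma> i) t * t ^ (2 * k i)" for i t
  have f: "has_bochner_integral lborel (f i) (fact (2 * k i) / ((2 / (\<sigma> i)\<^sup>2) ^ k i * fact (k i)))" if "i \<in> {1..n}" for i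
    using normal_moment_even[OF sigma_pos[OF that], of 0 "k i"] by (simp add: f_def[abs_def])
  have "has_bochner_integral (Rn_lebesgue n) (\<lambda>x. \<Prod>i=1..n. f i (x i)) (\<Prod>i=1..n. integral\<^sup>L lborel (f i))"
    unfolding has_bochner_integral_iff Rn_lebesgue_def
    using f by (intro conjI product_integrable_prod product_integral_prod) (auto simp: has_bochner_integral_iff)
  moreover have "(\<Prod>i=1..n. f i (x i)) = gauss_density x * (\<Prod>i=1..n. x i ^ (2 * k i))" for x
    by (simp add: f_def gauss_density_def prod.distrib)
  moreover have "(\<Prod>i=1..n. integral\<^sup>L lborel (f i)) = (\<Prod>i=1..n. fact (2 * k i) / ((2 / (\<sigma> i)\<^sup>2) ^ k i * fact (k i)))"
    using f by (intro prod.cong) (auto simp: has_bochner_integral_iff)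
  ultimately show ?thesis by simp
qed

lemma gauss_total: "has_bochner_integral (Rn_lebesgue n) gauss_density 1"
  using gauss_monomial[of "\<lambda>_. 0"] by simp

lemma gauss_second_moment:
  assumes i: "i \<in> {1..n}"
  shows "has_bochner_integral (Rn_lebesgue n) (\<lambda>x. gauss_density x * (x i)\<^sup>2) ((\<sigma> i)\<^sup>2)"
proof -
  have "(\<Prod>l=1..n. x l ^ (2 * (if l = i then 1 else 0))) = (x i)\<^sup>2" for x :: "nat \<Rightarrow> real"
    using i by (subst prod.cong[OF refl, of _ _ "\<lambda>l. if l = i then (x l)\<^sup>2 else 1"]) auto
  moreover have "(\<Prod>l=1..n. fact (2 * (if l = i then 1 else 0)) / ((2 / (\<sigma> l)\<^sup>2) ^ (if l = i then 1 else 0) * fact (if l = i then 1 else 0)))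
      = (\<sigma> i)\<^sup>2"
    using i by (subst prod.cong[OF refl, of _ _ "\<lambda>l. if l = i then (\<sigma> l)\<^sup>2 else 1"]) auto
  ultimately show ?thesis using gauss_monomial[of "\<lambda>l. if l = i then 1 else 0"] by simp
qed

text \<open>Coordinates are independent, and the fourth moment of a centred normal variable is three times the square
  of its variance.\<close>

lemma gauss_fourth_moment:
  assumes i: "i \<in> {1..n}" and j: "j \<in> {1..n}"
  shows "has_bochner_integral (Rn_lebesgue n) (\<lambda>x. gauss_density x * ((x i)\<^sup>2 * (x j)\<^sup>2))
     ((\<sigma> i)\<^sup>2 * (\<sigma> j)\<^sup>2 * (if i = j then 3 else 1))"
proof -
  define k where "k l = (if l = i then 1 else 0) + (if l = j then 1 else 0 :: nat)" for l
  have x: "(\<Prod>l=1..n. x l ^ (2 * k l)) = (x i)\<^sup>2 * (x j)\<^sup>2" for x :: "nat \<Rightarrow> real"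
  proof -
    have "(\<Prod>l=1..n. x l ^ (2 * k l)) = (\<Prod>l=1..n. (if l = i then (x l)\<^sup>2 else 1) * (if l = j then (x l)\<^sup>2 else 1))"
      by (intro prod.cong) (auto simp: k_def power2_eq_square numeral_eq_Suc)
    then show ?thesis using i j by (simp add: prod.distrib)
  qed
  have s: "(\<Prod>l=1..n. fact (2 * k l) / ((2 / (\<sigma> l)\<^sup>2) ^ k l * fact (k l))) = (\<sigma> i)\<^sup>2 * (\<sigma> j)\<^sup>2 * (if i = j then 3 else 1)"
  proof (cases "i = j")
    case True
    have "(\<Prod>l=1..n. fact (2 * k l) / ((2 / (\<sigma> l)\<^sup>2) ^ k l * fact (k l))) = (\<Prod>l=1..n. if l = i then 3 * ((\<sigma> l)\<^sup>2)\<^sup>2 else 1)"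
      using True by (intro prod.cong) (auto simp: k_def fact_numeral power2_eq_square)
    then show ?thesis using True i by (simp add: power2_eq_square)
  next
    case False
    have "(\<Prod>l=1..n. fact (2 * k l) / ((2 / (\<sigma> l)\<^sup>2) ^ k l * fact (k l)))
        = (\<Prod>l=1..n. (if l = i then (\<sigma> l)\<^sup>2 else 1) * (if l = j then (\<sigma> l)\<^sup>2 else 1))"
      using False by (intro prod.cong) (auto simp: k_def)
    then show ?thesis using False i j by (simp add: prod.distrib)
  qed
  show ?thesis using gauss_monomial[of k] unfolding x s .
qed

text \<open>The expectation of \<open>(normal_length x)\<^sup>2\<close>, by \<open>gauss_normal_length_squared\<close>.\<close>

definition mean_square :: real where "mean_square = (\<Sum>i=1..n. (q i)\<^sup>2) / 2"

lemma mean_square_pos: "mean_square > 0"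
proof -
  have "(q i)\<^sup>2 > 0" if "i \<in> {1..n}" for i using q_pos[OF that] by simp
  then have "(\<Sum>i=1..n. (q i)\<^sup>2) > 0" using n_pos by (intro sum_pos) auto
  then show ?thesis by (simp add: mean_square_def)
qed

lemma normal_length_squared: "(normal_length x)\<^sup>2 = (\<Sum>i=1..n. q i ^ 4 * (x i)\<^sup>2)"
  unfolding normal_length_def L2_set_def by (simp add: sum_nonneg power_mult_distrib)

lemma gauss_normal_length_squared:
  "has_bochner_integral (Rn_lebesgue n) (\<lambda>x. gauss_density x * (normal_length x)\<^sup>2) mean_square"
proof -
  have "has_bochner_integral (Rn_lebesgue n) (\<lambda>x. \<Sum>i=1..n. q i ^ 4 * (gauss_density x * (x i)\<^sup>2)) (\<Sum>i=1..n. q i ^ 4 * (\<sigma> i)\<^sup>2)"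
    by (intro has_bochner_integral_sum has_bochner_integral_mult_right gauss_second_moment)
  moreover have "(\<Sum>i=1..n. q i ^ 4 * (\<sigma> i)\<^sup>2) = mean_square"
    unfolding mean_square_def sum_divide_distrib
  proof (rule sum.cong[OF refl])
    fix i assume "i \<in> {1..n}"
    from q_pos[OF this] show "q i ^ 4 * (\<sigma> i)\<^sup>2 = (q i)\<^sup>2 / 2"
      unfolding sigma_squared by (simp add: power4_eq_xxxx power2_eq_square)
  qed
  moreover have "(\<Sum>i=1..n. q i ^ 4 * (gauss_density x * (x i)\<^sup>2)) = gauss_density x * (normal_length x)\<^sup>2" for x
    by (simp add: normal_length_squared sum_distrib_left mult_ac)
  ultimately show ?thesis by simp
qed

lemma gauss_normal_length_fourth:
  "has_bochner_integral (Rn_lebesgue n) (\<lambda>x. gauss_density x * ((normal_length x)\<^sup>2)\<^sup>2)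
     (mean_square\<^sup>2 + (\<Sum>i=1..n. q i ^ 4) / 2)"
proof -
  let ?f = "\<lambda>x i j. q i ^ 4 * q j ^ 4 * (gauss_density x * ((x i)\<^sup>2 * (x j)\<^sup>2))"
  let ?v = "\<lambda>i j. q i ^ 4 * q j ^ 4 * ((\<sigma> i)\<^sup>2 * (\<sigma> j)\<^sup>2 * (if i = j then 3 else 1))"
  have "has_bochner_integral (Rn_lebesgue n) (\<lambda>x. \<Sum>i=1..n. \<Sum>j=1..n. ?f x i j) (\<Sum>i=1..n. \<Sum>j=1..n. ?v i j)"
    by (intro has_bochner_integral_sum has_bochner_integral_mult_right gauss_fourth_moment)
  moreover have "(\<Sum>i=1..n. \<Sum>j=1..n. ?f x i j) = gauss_density x * ((normal_length x)\<^sup>2)\<^sup>2" for x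
    unfolding normal_length_squared power2_eq_square[of "\<Sum>i=1..n. q i ^ 4 * (x i)\<^sup>2"] sum_product sum_distrib_left
    by (intro sum.cong refl) (simp add: sum_distrib_left mult_ac)
  moreover have "(\<Sum>i=1..n. \<Sum>j=1..n. ?v i j) = mean_square\<^sup>2 + (\<Sum>i=1..n. q i ^ 4) / 2"
  proof -
    have v: "?v i j = (q i)\<^sup>2 / 2 * ((q j)\<^sup>2 / 2) + (if j = i then q i ^ 4 / 2 else 0)" if "i \<in> {1..n}" "j \<in> {1..n}" for i j
      using q_pos[OF that(1)] q_pos[OF that(2)]
      unfolding sigma_squared by (auto simp: power4_eq_xxxx power2_eq_square field_simps)
    have "(\<Sum>i=1..n. \<Sum>j=1..n. ?v i j)
        = (\<Sum>i=1..n. \<Sum>j=1..n. (q i)\<^sup>2 / 2 * ((q j)\<^sup>2 / 2) + (if j = i then q i ^ 4 / 2 else 0))"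
      using v by (intro sum.cong refl) auto
    also have "\<dots> = (\<Sum>i=1..n. (q i)\<^sup>2 / 2) * (\<Sum>j=1..n. (q j)\<^sup>2 / 2) + (\<Sum>i=1..n. q i ^ 4 / 2)"
      by (simp add: sum.distrib sum_product)
    finally show ?thesis by (simp add: mean_square_def sum_divide_distrib power2_eq_square)
  qed
  ultimately show ?thesis by simp
qed

text \<open>The bounds on the square root are integrated at the ratio of \<open>(normal_length x)\<^sup>2\<close> to its mean. The linear
  one sees only the mean and gives the upper bound; the quadratic one sees the variance and gives the lower bound.\<close>

lemma gauss_normal_length_bounds:
  defines "I \<equiv> (\<integral>x. gauss_density x * normal_length x \<partial>Rn_lebesgue n)"
  shows "integrable (Rn_lebesgue n) (\<lambda>x. gauss_density x * normal_length x)"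
    and "I / sqrt mean_square \<le> 1"
    and "1 - (\<Sum>i=1..n. q i ^ 4) / (\<Sum>i=1..n. (q i)\<^sup>2)\<^sup>2 \<le> I / sqrt mean_square"
proof -
  let ?L = "Rn_lebesgue n" and ?a = mean_square
  let ?r = "\<lambda>x. (normal_length x)\<^sup>2 / ?a"
  note a = mean_square_pos
  have w: "normal_length x = sqrt ?a * sqrt (?r x)" for x
    using a by (simp add: real_sqrt_divide)
  have up: "has_bochner_integral ?L (\<lambda>x. sqrt ?a * ((gauss_density x + gauss_density x * (normal_length x)\<^sup>2 / ?a) / 2)) (sqrt ?a * ((1 + ?a / ?a) / 2))"
    by (intro has_bochner_integral_mult_right has_bochner_integral_divide_zero has_bochner_integral_add gauss_total gauss_normal_length_squared)
  have lo: "has_bochner_integral ?L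
      (\<lambda>x. sqrt ?a * ((3 * (gauss_density x * (normal_length x)\<^sup>2 / ?a) - gauss_density x * ((normal_length x)\<^sup>2)\<^sup>2 / ?a\<^sup>2) / 2))
      (sqrt ?a * ((3 * (?a / ?a) - (?a\<^sup>2 + (\<Sum>i=1..n. q i ^ 4) / 2) / ?a\<^sup>2) / 2))"
    by (intro has_bochner_integral_mult_right has_bochner_integral_divide_zero has_bochner_integral_diff
        gauss_normal_length_squared gauss_normal_length_fourth)
  have upper: "gauss_density x * normal_length x \<le> sqrt ?a * ((gauss_density x + gauss_density x * (normal_length x)\<^sup>2 / ?a) / 2)" for x
  proof -
    have "gauss_density x * (sqrt ?a * sqrt (?r x)) \<le> gauss_density x * (sqrt ?a * ((1 + ?r x) / 2))"
      using a gauss_density_nonneg by (intro mult_left_mono sqrt_le_linear) auto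
    then show ?thesis unfolding w[symmetric] by (simp add: field_simps)
  qed
  have lower: "sqrt ?a * ((3 * (gauss_density x * (normal_length x)\<^sup>2 / ?a) - gauss_density x * ((normal_length x)\<^sup>2)\<^sup>2 / ?a\<^sup>2) / 2)
      \<le> gauss_density x * normal_length x" for x
  proof -
    have "gauss_density x * (sqrt ?a * ((3 * ?r x - (?r x)\<^sup>2) / 2)) \<le> gauss_density x * (sqrt ?a * sqrt (?r x))"
      using a gauss_density_nonneg by (intro mult_left_mono sqrt_ge_quadratic) auto
    then show ?thesis unfolding w[symmetric] by (simp add: power_divide algebra_simps)
  qed
  show int: "integrable ?L (\<lambda>x. gauss_density x * normal_length x)"
  proof (rule Bochner_Integration.integrable_bound[OF integrable.intros[OF up]])
    show "AE x in ?L. norm (gauss_density x * normal_length x)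
        \<le> norm (sqrt ?a * ((gauss_density x + gauss_density x * (normal_length x)\<^sup>2 / ?a) / 2))"
      using upper gauss_density_nonneg a by (intro AE_I2) (auto simp: abs_mult intro: order_trans[OF upper])
  qed measurable
  have "I \<le> sqrt ?a * ((1 + ?a / ?a) / 2)"
    unfolding I_def has_bochner_integral_integral_eq[OF up, symmetric]
    by (intro integral_mono int integrable.intros[OF up] upper)
  then show "I / sqrt ?a \<le> 1" using a by simp
  have "sqrt ?a * ((3 * (?a / ?a) - (?a\<^sup>2 + (\<Sum>i=1..n. q i ^ 4) / 2) / ?a\<^sup>2) / 2) \<le> I"
    unfolding I_def has_bochner_integral_integral_eq[OF lo, symmetric]
    by (intro integral_mono int integrable.intros[OF lo] lower)
  then have "(3 * (?a / ?a) - (?a\<^sup>2 + (\<Sum>i=1..n. q i ^ 4) / 2) / ?a\<^sup>2) / 2 \<le> I / sqrt ?a"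
    using a by (simp add: pos_le_divide_eq mult.commute)
  moreover have "(3 * (?a / ?a) - (?a\<^sup>2 + (\<Sum>i=1..n. q i ^ 4) / 2) / ?a\<^sup>2) / 2
      = 1 - (\<Sum>i=1..n. q i ^ 4) / (\<Sum>i=1..n. (q i)\<^sup>2)\<^sup>2"
  proof -
    have s: "(\<Sum>i=1..n. (q i)\<^sup>2) = 2 * ?a" by (simp add: mean_square_def)
    show ?thesis unfolding s using a by (simp add: field_simps power2_eq_square)
  qed
  ultimately show "1 - (\<Sum>i=1..n. q i ^ 4) / (\<Sum>i=1..n. (q i)\<^sup>2)\<^sup>2 \<le> I / sqrt ?a" by linarith
qed

text \<open>Both surface area and volume are Gaussian integrals divided by radial moments, and these moments are
  exactly the two values of the Gamma function in the quotient.\<close>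

lemma surface_volume_ratio_ellipsoid:
  defines "I \<equiv> (\<integral>x. gauss_density x * normal_length x \<partial>Rn_lebesgue n)"
  shows "Gamma ((real n + 1) / 2) / Gamma (real n / 2) * (surface_volume_ratio n (ellipsoid q n)
           / (real n * sqrt (1 / 2 * (\<Sum>i=1..n. (q i)\<^sup>2)))) = I / sqrt mean_square"
proof -
  let ?L = "Rn_lebesgue n" and ?c = "hausdorff m m (unit_cube m)"
  define \<Gamma>1 where "\<Gamma>1 = Gamma ((real n + 1) / 2)"
  define \<Gamma>0 where "\<Gamma>0 = Gamma (real n / 2)"
  have G: "\<Gamma>1 > 0" "\<Gamma>0 > 0" unfolding \<Gamma>1_def \<Gamma>0_def using n_pos by (auto intro!: Gamma_real_pos)
  have I0: "I \<ge> 0" unfolding I_def by (intro integral_nonneg_AE AE_I2) (simp add: gauss_density_nonneg)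
  have D: "gauss_const > 0" by (rule gauss_const_pos)
  have "(\<integral>\<^sup>+x. ennreal (normal_length x * exp (- (gauge x)\<^sup>2)) \<partial>?L) = (\<integral>\<^sup>+x. ennreal (gauss_density x * normal_length x / gauss_const) \<partial>?L)"
    using D by (intro nn_integral_cong) (simp add: gauss_density_eq field_simps)
  also have "\<dots> = ennreal (\<integral>x. gauss_density x * normal_length x / gauss_const \<partial>?L)"
    using gauss_normal_length_bounds(1) D gauss_density_nonneg by (intro nn_integral_eq_integral) auto
  also have "\<dots> = ennreal (I / gauss_const)" by (simp add: I_def)
  finally have GW: "(\<integral>\<^sup>+x. ennreal (normal_length x * exp (- (gauge x)\<^sup>2)) \<partial>?L) = ennreal (I / gauss_const)" .
  have "(\<integral>\<^sup>+x. ennreal (exp (- (gauge x)\<^sup>2)) \<partial>?L) = (\<integral>\<^sup>+x. ennreal (gauss_density x / gauss_const) \<partial>?L)"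
    using D by (intro nn_integral_cong) (simp add: gauss_density_eq field_simps)
  also have "\<dots> = ennreal (\<integral>x. gauss_density x / gauss_const \<partial>?L)"
    using gauss_total D gauss_density_nonneg by (intro nn_integral_eq_integral) (auto simp: has_bochner_integral_iff)
  also have "\<dots> = ennreal (1 / gauss_const)" using gauss_total by (simp add: has_bochner_integral_iff)
  finally have G1: "(\<integral>\<^sup>+x. ennreal (exp (- (gauge x)\<^sup>2)) \<partial>?L) = ennreal (1 / gauss_const)" .
  have c: "?c \<noteq> 0" "?c \<noteq> top"
    using hausdorff_unit_cube_positive[of m] hausdorff_unit_cube_finite[of m] by auto
  have surf: "surface_area n (ellipsoid q n) = 2 * I / (gauss_const * \<Gamma>1)"
  proof -
    have "ennreal (\<Gamma>1 / 2) * hausdorff n m boundary = ?c * ennreal (I / gauss_const)"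
      using hausdorff_boundary unfolding GW gauss_moment_eq_Gamma \<Gamma>1_def .
    then have "ennreal (2 / \<Gamma>1) * (ennreal (\<Gamma>1 / 2) * hausdorff n m boundary) = ?c * (ennreal (2 / \<Gamma>1) * ennreal (I / gauss_const))"
      by (simp add: mult_ac)
    then have "hausdorff n m boundary = ?c * ennreal (2 / \<Gamma>1 * (I / gauss_const))"
      using G I0 D by (simp add: mult.assoc[symmetric] ennreal_mult[symmetric])
    then have "hausdorff n m boundary / ?c = ennreal (2 / \<Gamma>1 * (I / gauss_const))"
      using c by (simp add: mult_divide_eq_ennreal mult.commute[of ?c])
    then show ?thesis
      unfolding surface_area_def frontier_ellipsoid hausdorff_vol_def
      using G I0 D by (simp add: n_Suc mult.commute)
  qed
  have vol: "volume n (ellipsoid q n) = 2 / (gauss_const * real n * \<Gamma>0)"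
  proof -
    have k: "ennreal (real n) * gauss_moment (n - 1) = ennreal (real n * \<Gamma>0 / 2)"
      using n_pos G by (simp add: gauss_moment_eq_Gamma \<Gamma>0_def ennreal_mult[symmetric] of_nat_diff)
    have fin: "emeasure ?L (ellipsoid q n) = ennreal (volume n (ellipsoid q n))"
      unfolding volume_def using emeasure_gauge_ball_finite
      by (intro emeasure_eq_ennreal_measure) (auto simp: ellipsoid_eq)
    have "ennreal (1 / gauss_const) = ennreal (volume n (ellipsoid q n)) * ennreal (real n * \<Gamma>0 / 2)"
      using emeasure_gauge_ball unfolding G1 k ellipsoid_eq[symmetric] fin .
    then have "1 / gauss_const = volume n (ellipsoid q n) * (real n * \<Gamma>0 / 2)"
      using D G by (simp add: ennreal_mult[symmetric] volume_def)
    then show ?thesis using n_pos G D by (simp add: field_simps)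
  qed
  have "surface_volume_ratio n (ellipsoid q n) = real n * I * \<Gamma>0 / \<Gamma>1"
    unfolding surface_volume_ratio_def surf vol using D G n_pos by (simp add: field_simps)
  moreover have "1 / 2 * (\<Sum>i=1..n. (q i)\<^sup>2) = mean_square" by (simp add: mean_square_def)
  ultimately show ?thesis
    unfolding \<Gamma>1_def[symmetric] \<Gamma>0_def[symmetric] using G n_pos mean_square_pos by (simp add: field_simps)
qed

end

theorem theorem11:
  fixes q :: "nat \<Rightarrow> real"
  assumes "\<And>i. i \<ge> 1 \<Longrightarrow> q i > 0"
    and "(\<lambda>n. (\<Sum>i=1..n. q i ^ 4) / (\<Sum>i=1..n. (q i)\<^sup>2)\<^sup>2) \<longlonglongrightarrow> 0"
  shows "(\<lambda>n. Gamma ((real n + 1) / 2) / Gamma (real n / 2)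
            * (surface_volume_ratio n (ellipsoid q n)
                 / (real n * sqrt (1 / 2 * (\<Sum>i=1..n. (q i)\<^sup>2))))) \<longlonglongrightarrow> 1"
proof (rule tendsto_sandwich)
  let ?F = "\<lambda>n. Gamma ((real n + 1) / 2) / Gamma (real n / 2)
            * (surface_volume_ratio n (ellipsoid q n)
                 / (real n * sqrt (1 / 2 * (\<Sum>i=1..n. (q i)\<^sup>2))))"
  have bounds: "1 - (\<Sum>i=1..n. q i ^ 4) / (\<Sum>i=1..n. (q i)\<^sup>2)\<^sup>2 \<le> ?F n \<and> ?F n \<le> 1" if n: "n \<ge> 2" for n
  proof -
    interpret ellipsoid_axes q n "n - 1"
      using n assms(1) by unfold_locales auto
    show ?thesis unfolding surface_volume_ratio_ellipsoid using gauss_normal_length_bounds by blast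
  qed
  then show "\<forall>\<^sub>F n in sequentially. 1 - (\<Sum>i=1..n. q i ^ 4) / (\<Sum>i=1..n. (q i)\<^sup>2)\<^sup>2 \<le> ?F n"
    by (intro eventually_sequentiallyI[of 2]) blast
  show "\<forall>\<^sub>F n in sequentially. ?F n \<le> 1"
    using bounds by (intro eventually_sequentiallyI[of 2]) blast
  show "(\<lambda>n. 1 - (\<Sum>i=1..n. q i ^ 4) / (\<Sum>i=1..n. (q i)\<^sup>2)\<^sup>2) \<longlonglongrightarrow> 1"
    using tendsto_diff[OF tendsto_const[of 1] assms(2)] by simp
qed simp

end
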